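(* Let $\mu>0$ and let $f:[0,\infty)\to[0,\infty)$ be a continuous function satisfying condition (U) with critical point $x_0$. Put $g=\mu^{-1}f$, suppose $g'(0)>1$, and suppose that the unique positive fixed point $K$ of $g$ satisfies $K>x_0$. Put $\beta=g(x_0)$ and $\alpha=g(\beta)=g(g(x_0))$. Assume that $\alpha>x_0$, and that $f$ satisfies condition (S) in the interval $[\alpha,\beta]$. Then exactly one of the following holds: (1) $|g'(K)|\le 1$, and for all values of the delay $\tau>0$ the global attractor of $$x'(t)=-\mu x(t)+f(x(t-\tau)) \qquad (E_\tau)$$ is $\{K\}$. (2) $|g'(K)|>1$, and the sharpest invariant and attracting interval containing the global attractor of $(E_\tau)$ for all values of the delay $\tau>0$ is $[\bar\alpha,\bar\beta]$, where $\{\bar\alpha,\bar\beta\}$ (with $\bar\alpha<\bar\beta$) is the unique $2$-cycle of $g$ in $[\alpha,\beta]$.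
   Context: Condition (U): $f(x)\ge 0$ for all $x\ge 0$, $f(0)=0$, and there is a unique $x_0>0$ such that $f'(x)>0$ if $0\le x<x_0$, $f'(x_0)=0$, and $f'(x)<0$ if $x>x_0$; moreover $f''(x)<0$ for $0\le x\le x_0$. Under (U) with $g'(0)>1$, the fixed points of $g$ are exactly $0$ and one positive point $K$. Condition (S) in an interval $I$: $f$ is three times differentiable on $I$ and $(Sf)(x)<0$ for every $x\in I$ with $f'(x)\ne 0$, where $$(Sf)(x)=\frac{f'''(x)}{f'(x)}-\frac32\left(\frac{f''(x)}{f'(x)}\right)^2 .$$ A $2$-cycle of $g$ is a set $\{p,q\}$ with $p\ne q$, $g(p)=q$, $g(q)=p$. Solutions: for a nonnegative, not identically zero $\phi\in C([-\tau,0],\mathbb{R})$, let $x^\phi$ be the unique solution of $(E_\tau)$ for $t>0$ with $x^\phi=\phi$ on $[-\tau,0]$. Only nonnegative nonzero initial functions are considered; thus the phase space is $X_\tau=\{\phi\in C([-\tau,0],\mathbb{R}):\phi\ge 0,\ \phi\not\equiv 0\}$ with the sup norm and semiflow $\phi\mapsto x^\phi_t$, $x^\phi_t(s)=x^\phi(t+s)$ for $s\in[-\tau,0]$. The global attractor of $(E_\tau)$ is the compact invariant subset $\mathcal{A}_\tau$ of $X_\tau$ that attracts every compact subset of $X_\tau$. The statement that it is $\{K\}$ refers to the constant function $K$; in particular every solution $x^\phi$, $\phi\in X_\tau$, converges to $K$ as $t\to\infty$. An interval $[a,b]$ contains the global attractor if $a\le\phi(s)\le b$ for all $\phi\in\mathcal{A}_\tau$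 and $s\in[-\tau,0]$. An interval $[a,b]\subset(0,\infty)$ is invariant for $(E_\tau)$ if $\phi([-\tau,0])\subset[a,b]$ implies $x^\phi(t)\in[a,b]$ for all $t\ge0$; it is attracting for $(E_\tau)$ if $a\le\liminf_{t\to\infty}x^\phi(t)\le\limsup_{t\to\infty}x^\phi(t)\le b$ for every $\phi\in X_\tau$. The sharpest invariant and attracting interval containing the global attractor for all $\tau$ is the smallest (with respect to inclusion) closed interval $[a,b]$, independent of $\tau$, which for every $\tau>0$ is invariant and attracting for $(E_\tau)$ and contains the global attractor of $(E_\tau)$. *)

theory Defs
  imports "HOL-Analysis.Analysis"
begin

(* Maps on [0, infinity) are modelled by total functions on the reals whose values at
   negative arguments play no role. Hence all derivatives are taken within a set, and they
   are one-sided at the endpoints of that set. *)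

definition deriv_on :: "real set \<Rightarrow> (real \<Rightarrow> real) \<Rightarrow> real \<Rightarrow> real" where
  "deriv_on S f x = vector_derivative f (at x within S)"

definition is_peak :: "(real \<Rightarrow> real) \<Rightarrow> real \<Rightarrow> bool" where
  "is_peak f c \<longleftrightarrow>
     c > 0 \<and>
     (\<forall>x. 0 \<le> x \<and> x < c \<longrightarrow> deriv_on {0..} f x > 0) \<and>
     deriv_on {0..} f c = 0 \<and>
     (\<forall>x>c. deriv_on {0..} f x < 0)"

definition condition_U :: "(real \<Rightarrow> real) \<Rightarrow> real \<Rightarrow> bool" where
  "condition_U f x0 \<longleftrightarrow>
     (\<forall>x\<ge>0. f x \<ge> 0) \<and> f 0 = 0 \<and>
     f differentiable_on {0..} \<and>
     is_peak f x0 \<and> (\<forall>c. is_peak f c \<longrightarrow> c = x0) \<and>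
     (\<forall>x\<in>{0..x0}. deriv_on {0..} f differentiable (at x within {0..}) \<and>
                   deriv_on {0..} (deriv_on {0..} f) x < 0)"

definition schwarzian_on :: "real set \<Rightarrow> (real \<Rightarrow> real) \<Rightarrow> real \<Rightarrow> real" where
  "schwarzian_on S f x =
     (deriv_on S ^^ 3) f x / deriv_on S f x -
     3 / 2 * ((deriv_on S ^^ 2) f x / deriv_on S f x)\<^sup>2"

definition condition_S :: "(real \<Rightarrow> real) \<Rightarrow> real set \<Rightarrow> bool" where
  "condition_S f I \<longleftrightarrow>
     (\<forall>k<3. (deriv_on I ^^ k) f differentiable_on I) \<and>
     (\<forall>x\<in>I. deriv_on I f x \<noteq> 0 \<longrightarrow> schwarzian_on I f x < 0)"

definition is_2cycle :: "(real \<Rightarrow> real) \<Rightarrow> real set \<Rightarrow> bool" where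
  "is_2cycle g C \<longleftrightarrow> (\<exists>p q. C = {p, q} \<and> p \<noteq> q \<and> g p = q \<and> g q = p)"

(* The library's function space consists of functions that are extensional, i.e. undefined
   outside [-tau, 0], so that its elements are exactly the continuous functions on [-tau, 0];
   its distance is the sup distance. *)

definition phase_space :: "real \<Rightarrow> (real \<Rightarrow> real) metric" where
  "phase_space \<tau> =
     submetric (cfunspace (top_of_set {-\<tau>..0}) euclidean_metric)
       {\<phi>. (\<forall>s\<in>{-\<tau>..0}. \<phi> s \<ge> 0) \<and> (\<exists>s\<in>{-\<tau>..0}. \<phi> s \<noteq> 0)}"

definition is_dde_solution ::
  "real \<Rightarrow> (real \<Rightarrow> real) \<Rightarrow> real \<Rightarrow> (real \<Rightarrow> real) \<Rightarrow> (real \<Rightarrow> real) \<Rightarrow> bool" where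
  "is_dde_solution \<mu> f \<tau> \<phi> x \<longleftrightarrow>
     x \<in> extensional {-\<tau>..} \<and> continuous_on {-\<tau>..} x \<and>
     (\<forall>s\<in>{-\<tau>..0}. x s = \<phi> s) \<and>
     (\<forall>t>0. (x has_real_derivative (- \<mu> * x t + f (x (t - \<tau>)))) (at t))"

definition dde_solution ::
  "real \<Rightarrow> (real \<Rightarrow> real) \<Rightarrow> real \<Rightarrow> (real \<Rightarrow> real) \<Rightarrow> real \<Rightarrow> real" where
  "dde_solution \<mu> f \<tau> \<phi> = (THE x. is_dde_solution \<mu> f \<tau> \<phi> x)"

definition semiflow ::
  "real \<Rightarrow> (real \<Rightarrow> real) \<Rightarrow> real \<Rightarrow> real \<Rightarrow> (real \<Rightarrow> real) \<Rightarrow> real \<Rightarrow> real" where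
  "semiflow \<mu> f \<tau> t \<phi> = restrict (\<lambda>s. dde_solution \<mu> f \<tau> \<phi> (t + s)) {-\<tau>..0}"

definition attracts ::
  "real \<Rightarrow> (real \<Rightarrow> real) \<Rightarrow> real \<Rightarrow> (real \<Rightarrow> real) set \<Rightarrow> (real \<Rightarrow> real) set \<Rightarrow> bool" where
  "attracts \<mu> f \<tau> A C \<longleftrightarrow>
     (\<forall>\<epsilon>>0. \<exists>t0\<ge>0. \<forall>t\<ge>t0. \<forall>\<phi>\<in>C. \<exists>\<psi>\<in>A.
        mdist (phase_space \<tau>) (semiflow \<mu> f \<tau> t \<phi>) \<psi> < \<epsilon>)"

(* At most one set A has this property: any two such sets attract, hence contain, each other. *)

definition is_global_attractor ::
  "real \<Rightarrow> (real \<Rightarrow> real) \<Rightarrow> real \<Rightarrow> (real \<Rightarrow> real) set \<Rightarrow> bool" where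
  "is_global_attractor \<mu> f \<tau> A \<longleftrightarrow>
     compactin (mtopology_of (phase_space \<tau>)) A \<and>
     (\<forall>t\<ge>0. semiflow \<mu> f \<tau> t ` A = A) \<and>
     (\<forall>C. compactin (mtopology_of (phase_space \<tau>)) C \<longrightarrow> attracts \<mu> f \<tau> A C)"

definition contains_global_attractor ::
  "real \<Rightarrow> (real \<Rightarrow> real) \<Rightarrow> real \<Rightarrow> real \<Rightarrow> real \<Rightarrow> bool" where
  "contains_global_attractor \<mu> f \<tau> a b \<longleftrightarrow>
     (\<exists>A. is_global_attractor \<mu> f \<tau> A \<and> (\<forall>\<phi>\<in>A. \<forall>s\<in>{-\<tau>..0}. a \<le> \<phi> s \<and> \<phi> s \<le> b))"

definition invariant_interval ::
  "real \<Rightarrow> (real \<Rightarrow> real) \<Rightarrow> real \<Rightarrow> real \<Rightarrow> real \<Rightarrow> bool" where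
  "invariant_interval \<mu> f \<tau> a b \<longleftrightarrow>
     (\<forall>\<phi>\<in>mspace (phase_space \<tau>). \<phi> ` {-\<tau>..0} \<subseteq> {a..b} \<longrightarrow>
        (\<forall>t\<ge>0. dde_solution \<mu> f \<tau> \<phi> t \<in> {a..b}))"

definition attracting_interval ::
  "real \<Rightarrow> (real \<Rightarrow> real) \<Rightarrow> real \<Rightarrow> real \<Rightarrow> real \<Rightarrow> bool" where
  "attracting_interval \<mu> f \<tau> a b \<longleftrightarrow>
     (\<forall>\<phi>\<in>mspace (phase_space \<tau>).
        ereal a \<le> Liminf at_top (\<lambda>t. ereal (dde_solution \<mu> f \<tau> \<phi> t)) \<and>
        Limsup at_top (\<lambda>t. ereal (dde_solution \<mu> f \<tau> \<phi> t)) \<le> ereal b)"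

definition delay_independent_interval ::
  "real \<Rightarrow> (real \<Rightarrow> real) \<Rightarrow> real \<Rightarrow> real \<Rightarrow> bool" where
  "delay_independent_interval \<mu> f a b \<longleftrightarrow>
     0 < a \<and> a \<le> b \<and>
     (\<forall>\<tau>>0. invariant_interval \<mu> f \<tau> a b \<and> attracting_interval \<mu> f \<tau> a b \<and>
            contains_global_attractor \<mu> f \<tau> a b)"

definition sharpest_interval ::
  "real \<Rightarrow> (real \<Rightarrow> real) \<Rightarrow> real \<Rightarrow> real \<Rightarrow> bool" where
  "sharpest_interval \<mu> f a b \<longleftrightarrow>
     delay_independent_interval \<mu> f a b \<and>
     (\<forall>c d. delay_independent_interval \<mu> f c d \<longrightarrow> {a..b} \<subseteq> {c..d})"

end

theory Submission
  imports Defs "HOL-Complex_Analysis.Great_Picard" "HOL-Real_Asymp.Real_Asymp"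
begin

text \<open>
Write \<open>g = f / \<mu>\<close>. The delay equation is \<open>x' = \<mu> (g (x (t - \<tau>)) - x)\<close>, so at every moment the
solution relaxes towards a value of \<open>g\<close> taken on its own past. A solution \<open>y\<close> that is defined on
the whole real line and stays in a compact part of the positive axis has had infinite time to
relax, and therefore its infimum \<open>m\<close> and supremum \<open>M\<close> satisfy \<open>min (g m) (g M) \<le> m\<close>, and
\<open>M\<close> is at most the maximum of \<open>g\<close> on \<open>{m..M}\<close>. For a unimodal \<open>g\<close> with \<open>g (g x0) > x0\<close> this puts \<open>m\<close> and \<open>M\<close> into the
interval \<open>{\<alpha>..\<beta>}\<close>, on which \<open>g\<close> decreases, and then \<open>g (g m) \<le> m\<close> and \<open>M \<le> g (g M)\<close>
(\<open>core_bounds\<close>, \<open>entire_solution_in_core\<close>). So the delay equation is controlled, for every delay,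
by the signs of \<open>g (g x) - x\<close>.

These signs are determined by the Schwarzian condition. The second iterate \<open>h\<close> of \<open>g\<close> is
increasing on \<open>{\<alpha>..\<beta>}\<close> and has negative Schwarzian derivative, hence \<open>h'\<close> has no interior local
minimum (\<open>h1_no_local_min\<close>). With the mean value theorem, the middle one of three fixed points of
\<open>h\<close> is repelling and there are never four of them. Fixed points of \<open>h\<close> other than \<open>K\<close> come in
pairs on the two sides of \<open>K\<close>: if \<open>\<bar>g' K\<bar> \<le> 1\<close> there are none (\<open>stable_core\<close>), and if
\<open>\<bar>g' K\<bar> > 1\<close> there is exactly one pair, which is the 2-cycle (\<open>unstable_core\<close>).

The two alternatives of the theorem are thus one statement about an interval \<open>{a..b}\<close>, with
\<open>a = b = K\<close> in the first one and with the 2-cycle as endpoints in the second one. The set of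
restrictions to \<open>{-\<tau>..0}\<close> of the entire solutions with values in \<open>{a..b}\<close> is the global attractor.
It is invariant because entire solutions can be translated in time. It is compact, and it attracts
compact sets, because solutions are equi-Lipschitz, so that a sequence of solutions that started
longer and longer ago subconverges to an entire solution (\<open>solutions_converge_to_entire\<close>); uniform
persistence keeps the limit away from 0.

For sharpness, let \<open>{c..d}\<close> be invariant and attracting for all delays and contain the attractor.
Constant initial functions and \<open>\<tau> \<longlonglongrightarrow> \<infinity>\<close> show that \<open>g\<close> maps \<open>{c..d}\<close> into itself, and
\<open>K \<in> {c..d}\<close>. Unless \<open>c = d = K\<close>, monotonicity of \<open>g\<close> gives \<open>c < K\<close>, and the sign of
\<open>g (g x) - x\<close> between \<open>a\<close> and \<open>K\<close> then forces \<open>c \<le> a\<close>, whence also \<open>b = g a \<le> d\<close>. The degenerate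
case \<open>c = d = K\<close> is excluded by instability: for a suitable delay the linearisation at \<open>K\<close> has an
oscillating solution with growth rate \<open>\<rho> > 0\<close>, where \<open>2 \<rho>\<close> exceeds the growth rate of every
solution of the linearised equation. Solutions started on this oscillation arbitrarily far back
follow it up to an error of order \<open>exp (2 \<rho> t)\<close> and reach a fixed distance from \<open>K\<close>, although
their initial functions, together with \<open>K\<close>, form a compact set
(\<open>unstable_equilibrium_not_attractor\<close>).
\<close>

section \<open>The phase space\<close>

lemma mspace_phase_space:
  "\<phi> \<in> mspace (phase_space \<tau>) \<longleftrightarrow>
     \<phi> \<in> extensional {-\<tau>..0} \<and> continuous_on {-\<tau>..0} \<phi> \<and>
     (\<forall>s\<in>{-\<tau>..0}. \<phi> s \<ge> 0) \<and> (\<exists>s\<in>{-\<tau>..0}. \<phi> s \<noteq> 0)"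
proof -
  have c: "compactin (top_of_set {-\<tau>..0}) (topspace (top_of_set {-\<tau>..0}))"
    by (metis compact_Icc compactin_subtopology compactin_euclidean_iff order_refl topspace_euclidean_subtopology)
  show ?thesis
    unfolding phase_space_def mspace_submetric compactin_mspace_cfunspace[OF c]
    by auto
qed

text \<open>
Evaluation at a point is contracting on all continuous functions, the zero function included. One
of the arguments will be a state of the semiflow about whose sign nothing is known.
\<close>

lemma mdist_phase_space_less:
  assumes "\<phi> \<in> extensional {-\<tau>..0}" "continuous_on {-\<tau>..0} \<phi>"
    and "\<psi> \<in> extensional {-\<tau>..0}" "continuous_on {-\<tau>..0} \<psi>"
    and "mdist (phase_space \<tau>) \<phi> \<psi> < e" "s \<in> {-\<tau>..0}"
  shows "\<bar>\<phi> s - \<psi> s\<bar> < e"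
proof -
  have c: "compactin (top_of_set {-\<tau>..0}) (topspace (top_of_set {-\<tau>..0}))"
    by (metis compact_Icc compactin_subtopology compactin_euclidean_iff order_refl topspace_euclidean_subtopology)
  have *: "\<phi> \<in> mspace (cfunspace (top_of_set {-\<tau>..0}) euclidean_metric)"
      "\<psi> \<in> mspace (cfunspace (top_of_set {-\<tau>..0}) euclidean_metric)"
    unfolding compactin_mspace_cfunspace[OF c] using assms by auto
  have "mdist euclidean_metric (\<phi> s) (\<psi> s) < e"
    by (rule cfunspace_mdist_lt[OF c *]) (use assms(5,6) in \<open>simp_all add: phase_space_def\<close>)
  then show ?thesis by (simp add: dist_real_def)
qed

lemma mdist_phase_space_le:
  assumes "0 \<le> e" "\<And>s. s \<in> {-\<tau>..0} \<Longrightarrow> \<bar>\<phi> s - \<psi> s\<bar> \<le> e"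
  shows "mdist (phase_space \<tau>) \<phi> \<psi> \<le> e"
  unfolding phase_space_def mdist_submetric
  by (rule mdist_cfunspace_le) (use assms in \<open>auto simp: dist_real_def\<close>)

lemma limitin_phase_space:
  assumes l: "l \<in> mspace (phase_space \<tau>)" and "range \<sigma> \<subseteq> mspace (phase_space \<tau>)"
  shows "limitin (mtopology_of (phase_space \<tau>)) \<sigma> l sequentially \<longleftrightarrow>
     uniform_limit {-\<tau>..0} \<sigma> l sequentially"
proof -
  interpret P: Metric_space "mspace (phase_space \<tau>)" "mdist (phase_space \<tau>)" by simp
  have "limitin (mtopology_of (phase_space \<tau>)) \<sigma> l sequentially \<longleftrightarrow>
    (\<forall>e>0. \<forall>\<^sub>F n in sequentially. mdist (phase_space \<tau>) (\<sigma> n) l < e)"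
    unfolding mtopology_of_def P.limitin_metric using assms by (simp add: image_subset_iff)
  also have "\<dots> \<longleftrightarrow> uniform_limit {-\<tau>..0} \<sigma> l sequentially"
    unfolding uniform_limit_iff
  proof safe
    fix e :: real assume e: "e > 0" and *: "\<forall>e>0. \<forall>\<^sub>F n in sequentially. mdist (phase_space \<tau>) (\<sigma> n) l < e"
    then have "\<forall>\<^sub>F n in sequentially. mdist (phase_space \<tau>) (\<sigma> n) l < e" by blast
    then show "\<forall>\<^sub>F n in sequentially. \<forall>x\<in>{-\<tau>..0}. dist (\<sigma> n x) (l x) < e"
    proof eventually_elim
      case (elim n)
      have "\<sigma> n \<in> mspace (phase_space \<tau>)" using assms(2) by blast
      then show ?case using mdist_phase_space_less[OF _ _ _ _ elim] l
        by (simp add: dist_real_def mspace_phase_space)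
    qed
  next
    fix e :: real assume e: "e > 0" and *: "\<forall>e>0. \<forall>\<^sub>F n in sequentially. \<forall>x\<in>{-\<tau>..0}. dist (\<sigma> n x) (l x) < e"
    have "\<forall>\<^sub>F n in sequentially. \<forall>x\<in>{-\<tau>..0}. dist (\<sigma> n x) (l x) < e/2" using * e half_gt_zero by blast
    then show "\<forall>\<^sub>F n in sequentially. mdist (phase_space \<tau>) (\<sigma> n) l < e"
    proof eventually_elim
      case (elim n)
      have "mdist (phase_space \<tau>) (\<sigma> n) l \<le> e/2"
        by (rule mdist_phase_space_le) (use e elim in \<open>auto simp: dist_real_def less_imp_le\<close>)
      then show ?case using e by simp
    qed
  qed
  finally show ?thesis .
qed

lemma constant_in_phase_space:
  assumes "0 < p" "0 \<le> \<tau>"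
  shows "restrict (\<lambda>s. p) {-\<tau>..0} \<in> mspace (phase_space \<tau>)"
proof -
  have "continuous_on {-\<tau>..0} (restrict (\<lambda>s. p) {-\<tau>..0})"
    by (subst continuous_on_cong[OF refl, where g = "\<lambda>s. p"]) auto
  moreover have "0 \<in> {-\<tau>..0}" using assms by simp
  ultimately show ?thesis
    unfolding mspace_phase_space using assms by (auto intro: less_imp_le intro!: bexI[of _ 0])
qed

lemma compactin_mtopology_of_sequentially:
  "compactin (mtopology_of m) S \<longleftrightarrow> S \<subseteq> mspace m \<and>
     (\<forall>\<sigma>::nat \<Rightarrow> _. range \<sigma> \<subseteq> S \<longrightarrow>
        (\<exists>l r. l \<in> S \<and> strict_mono r \<and> limitin (mtopology_of m) (\<sigma> \<circ> r) l sequentially))"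
  unfolding mtopology_of_def
  by (rule Metric_space.compactin_sequentially[OF Metric_space_mspace_mdist])

section \<open>Delayed feedback: comparison, existence and uniqueness\<close>

text \<open>
The single comparison tool for all estimates below: \<open>exp (\<mu> * t) * u t\<close> is nonincreasing. It is
stated for open intervals of differentiability, since a solution of the delay equation need not be
differentiable at time 0.
\<close>

lemma exp_decay:
  fixes u :: "real \<Rightarrow> real"
  assumes "s \<le> t" "continuous_on {s..t} u"
    and D: "\<And>r. s < r \<Longrightarrow> r < t \<Longrightarrow> \<exists>D. (u has_real_derivative D) (at r) \<and> D + \<mu> * u r \<le> 0"
  shows "u t \<le> exp (- \<mu> * (t - s)) * u s"
proof -
  have "- (exp (\<mu> * s) * u s) \<le> - (exp (\<mu> * t) * u t)"
  proof (rule DERIV_nonneg_imp_increasing_open[OF \<open>s \<le> t\<close>])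
    fix r assume r: "s < r" "r < t"
    then obtain D where D: "(u has_real_derivative D) (at r)" "D + \<mu> * u r \<le> 0"
      using assms(3) by blast
    have "((\<lambda>r. - (exp (\<mu> * r) * u r)) has_real_derivative - (exp (\<mu> * r) * (D + \<mu> * u r))) (at r)"
      by (auto intro!: derivative_eq_intros D simp: algebra_simps)
    moreover have "0 \<le> - (exp (\<mu> * r) * (D + \<mu> * u r))"
      using D(2) by (simp add: mult_nonneg_nonpos)
    ultimately show "\<exists>y. ((\<lambda>r. - (exp (\<mu> * r) * u r)) has_real_derivative y) (at r) \<and> 0 \<le> y"
      by blast
  qed (intro continuous_intros assms)
  then have "exp (\<mu> * t) * u t \<le> exp (\<mu> * s) * u s" by simp
  then have "exp (- \<mu> * t) * (exp (\<mu> * t) * u t) \<le> exp (- \<mu> * t) * (exp (\<mu> * s) * u s)"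
    by (rule mult_left_mono) simp
  moreover have "exp (- \<mu> * t) * exp (\<mu> * t) = 1" "exp (- \<mu> * t) * exp (\<mu> * s) = exp (- \<mu> * (t - s))"
    by (simp_all add: exp_add[symmetric] right_diff_distrib)
  ultimately show ?thesis
    by (simp only: mult.assoc[symmetric])
qed

text \<open>
What holds on an initial interval of length \<open>\<tau>\<close> propagates if its truth at \<open>t\<close> depends only on
times up to \<open>t - \<tau>\<close>; the intervals \<open>{..T + n * \<tau>}\<close> exhaust the time axis.
\<close>

lemma method_of_steps:
  fixes \<tau> T :: real
  assumes "\<tau> > 0"
    and init: "\<And>t. T - \<tau> \<le> t \<Longrightarrow> t \<le> T \<Longrightarrow> P t"
    and step: "\<And>t. T < t \<Longrightarrow> (\<And>r. T - \<tau> \<le> r \<Longrightarrow> r \<le> t - \<tau> \<Longrightarrow> P r) \<Longrightarrow> P t"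
    and "T - \<tau> \<le> t"
  shows "P t"
proof -
  have "\<forall>t. T - \<tau> \<le> t \<and> t \<le> T + real n * \<tau> \<longrightarrow> P t" for n
  proof (induction n)
    case 0
    then show ?case using init by simp
  next
    case (Suc n)
    show ?case
    proof (intro allI impI)
      fix t assume t: "T - \<tau> \<le> t \<and> t \<le> T + real (Suc n) * \<tau>"
      show "P t"
      proof (cases "t \<le> T")
        case True
        then show ?thesis using init t by simp
      next
        case False
        show ?thesis
        proof (rule step)
          fix r assume "T - \<tau> \<le> r" "r \<le> t - \<tau>"
          moreover from this t have "r \<le> T + real n * \<tau>" by (simp add: algebra_simps)
          ultimately show "P r" using Suc by blast
        qed (use False in simp)
      qed
    qed
  qed
  moreover obtain n where "(t - T) / \<tau> \<le> real n" using real_arch_simple by blast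
  then have "t \<le> T + real n * \<tau>" using \<open>\<tau> > 0\<close> by (simp add: field_simps)
  ultimately show ?thesis using assms(4) by blast
qed

locale delay_equation =
  fixes \<mu> \<tau> :: real and f :: "real \<Rightarrow> real"
  assumes mu_pos: "\<mu> > 0" and tau_pos: "\<tau> > 0"
    and f_nonneg: "\<And>x. x \<ge> 0 \<Longrightarrow> f x \<ge> 0"
    and f_cont: "continuous_on {0..} f"
begin

text \<open>
The starting time is a parameter, because solutions are translated to start further and further
in the past.
\<close>

definition solves_after :: "real \<Rightarrow> (real \<Rightarrow> real) \<Rightarrow> bool" where
  "solves_after T x \<longleftrightarrow> continuous_on {T - \<tau>..} x \<and>
     (\<forall>t>T. (x has_real_derivative (- \<mu> * x t + f (x (t - \<tau>)))) (at t))"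

lemma solves_after_continuous_on: "solves_after T x \<Longrightarrow> S \<subseteq> {T - \<tau>..} \<Longrightarrow> continuous_on S x"
  unfolding solves_after_def using continuous_on_subset by blast

lemma solves_after_shift:
  assumes "solves_after T x"
  shows "solves_after (T - h) (\<lambda>t. x (t + h))"
  unfolding solves_after_def
proof (intro conjI allI impI)
  show "continuous_on {T - h - \<tau>..} (\<lambda>t. x (t + h))"
    by (rule continuous_on_compose2[of "{T - \<tau>..}" x])
       (use assms in \<open>auto simp: solves_after_def intro!: continuous_intros\<close>)
  fix t assume "T - h < t"
  then have "(x has_real_derivative (- \<mu> * x (t + h) + f (x (t + h - \<tau>)))) (at (t + h))"
    using assms by (auto simp: solves_after_def)
  then have "((\<lambda>t. x (t + h)) has_real_derivative (- \<mu> * x (t + h) + f (x (t + h - \<tau>)))) (at t)"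
    by (simp add: DERIV_shift)
  then show "((\<lambda>t. x (t + h)) has_real_derivative (- \<mu> * x (t + h) + f (x (t - \<tau> + h)))) (at t)"
    by (simp add: algebra_simps)
qed

lemma solves_after_mono: "solves_after T x \<Longrightarrow> T \<le> T' \<Longrightarrow> solves_after T' x"
  unfolding solves_after_def by (auto intro: continuous_on_subset)

text \<open>
While the forcing \<open>f (x (r - \<tau>)) / \<mu>\<close> stays below \<open>c\<close>, the excess of \<open>x\<close> over \<open>c\<close> decays
exponentially; \<open>relax_lower\<close> is the same from below.
\<close>

lemma relax_upper:
  assumes x: "solves_after T x" and "T \<le> s" "s \<le> t"
    and c: "\<And>r. s < r \<Longrightarrow> r < t \<Longrightarrow> f (x (r - \<tau>)) \<le> \<mu> * c"
  shows "x t - c \<le> exp (- \<mu> * (t - s)) * (x s - c)"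
proof (rule exp_decay[of s t "\<lambda>t. x t - c"])
  show "continuous_on {s..t} (\<lambda>t. x t - c)"
    using assms(2) tau_pos by (intro continuous_on_diff continuous_on_const solves_after_continuous_on[OF x]) auto
  fix r assume r: "s < r" "r < t"
  then have "(x has_real_derivative (- \<mu> * x r + f (x (r - \<tau>)))) (at r)"
    using assms by (auto simp: solves_after_def)
  then have "((\<lambda>t. x t - c) has_real_derivative (- \<mu> * x r + f (x (r - \<tau>)))) (at r)"
    by (auto intro!: derivative_eq_intros)
  moreover have "- \<mu> * x r + f (x (r - \<tau>)) + \<mu> * (x r - c) \<le> 0"
    using c[OF r] by (simp add: algebra_simps)
  ultimately show "\<exists>D. ((\<lambda>t. x t - c) has_real_derivative D) (at r) \<and> D + \<mu> * (x r - c) \<le> 0"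
    by blast
qed (fact)

lemma relax_lower:
  assumes x: "solves_after T x" and "T \<le> s" "s \<le> t"
    and c: "\<And>r. s < r \<Longrightarrow> r < t \<Longrightarrow> \<mu> * c \<le> f (x (r - \<tau>))"
  shows "exp (- \<mu> * (t - s)) * (x s - c) \<le> x t - c"
proof -
  have "c - x t \<le> exp (- \<mu> * (t - s)) * (c - x s)"
  proof (rule exp_decay[of s t "\<lambda>t. c - x t"])
    show "continuous_on {s..t} (\<lambda>t. c - x t)"
      using assms(2) tau_pos by (intro continuous_on_diff continuous_on_const solves_after_continuous_on[OF x]) auto
    fix r assume r: "s < r" "r < t"
    then have "(x has_real_derivative (- \<mu> * x r + f (x (r - \<tau>)))) (at r)"
      using assms by (auto simp: solves_after_def)
    then have "((\<lambda>t. c - x t) has_real_derivative - (- \<mu> * x r + f (x (r - \<tau>)))) (at r)"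
      by (auto intro!: derivative_eq_intros)
    moreover have "- (- \<mu> * x r + f (x (r - \<tau>))) + \<mu> * (c - x r) \<le> 0"
      using c[OF r] by (simp add: algebra_simps)
    ultimately show "\<exists>D. ((\<lambda>t. c - x t) has_real_derivative D) (at r) \<and> D + \<mu> * (c - x r) \<le> 0"
      by blast
  qed (fact)
  then show ?thesis by (simp add: algebra_simps)
qed

lemma invariant_interval_steps:
  assumes x: "solves_after T x"
    and init: "\<And>s. s \<in> {T - \<tau>..T} \<Longrightarrow> x s \<in> {a..b}"
    and ab: "\<And>y. y \<in> {a..b} \<Longrightarrow> f y \<in> {\<mu> * a..\<mu> * b}"
    and t: "T - \<tau> \<le> t"
  shows "x t \<in> {a..b}"
proof (rule method_of_steps[of \<tau> T "\<lambda>t. x t \<in> {a..b}"])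
  fix t assume t: "T < t" and IH: "\<And>r. T - \<tau> \<le> r \<Longrightarrow> r \<le> t - \<tau> \<Longrightarrow> x r \<in> {a..b}"
  have F: "f (x (r - \<tau>)) \<in> {\<mu> * a..\<mu> * b}" if "T < r" "r < t" for r
    using ab IH that by simp
  have i: "x T \<in> {a..b}" using init tau_pos by simp
  have "x t - b \<le> exp (- \<mu> * (t - T)) * (x T - b)"
    by (rule relax_upper[OF x]) (use t F in auto)
  also have "\<dots> \<le> 0" using i by (simp add: mult_nonneg_nonpos)
  finally have "x t \<le> b" by simp
  have "0 \<le> exp (- \<mu> * (t - T)) * (x T - a)" using i by simp
  also have "\<dots> \<le> x t - a"
    by (rule relax_lower[OF x]) (use t F in auto)
  finally show "x t \<in> {a..b}" using \<open>x t \<le> b\<close> by simp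
qed (use tau_pos init t in auto)

lemma solution_unique:
  assumes x: "solves_after T x" and y: "solves_after T y"
    and init: "\<And>s. s \<in> {T - \<tau>..T} \<Longrightarrow> x s = y s" and t: "T - \<tau> \<le> t"
  shows "x t = y t"
proof (rule method_of_steps[of \<tau> T "\<lambda>t. x t = y t"])
  fix t assume t: "T < t" and IH: "\<And>r. T - \<tau> \<le> r \<Longrightarrow> r \<le> t - \<tau> \<Longrightarrow> x r = y r"
  have *: "u t - v t \<le> exp (- \<mu> * (t - T)) * (u T - v T)"
    if "(u = x \<and> v = y) \<or> (u = y \<and> v = x)" for u v
  proof (rule exp_decay[of T t "\<lambda>t. u t - v t"])
    have uv: "solves_after T u" "solves_after T v" using x y that by auto
    then show "continuous_on {T..t} (\<lambda>t. u t - v t)"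
      using tau_pos by (intro continuous_on_diff solves_after_continuous_on[OF uv(1)] solves_after_continuous_on[OF uv(2)]) auto
    fix r assume r: "T < r" "r < t"
    have "(u has_real_derivative (- \<mu> * u r + f (u (r - \<tau>)))) (at r)"
         "(v has_real_derivative (- \<mu> * v r + f (v (r - \<tau>)))) (at r)"
      using uv r by (auto simp: solves_after_def)
    moreover have "u (r - \<tau>) = v (r - \<tau>)" using IH[of "r - \<tau>"] that r by auto
    ultimately show "\<exists>D. ((\<lambda>t. u t - v t) has_real_derivative D) (at r) \<and> D + \<mu> * (u r - v r) \<le> 0"
      by (intro exI[of _ "- \<mu> * (u r - v r)"]) (auto intro!: derivative_eq_intros simp: algebra_simps)
  qed (use t in simp)
  have "x T = y T" using init tau_pos by simp
  then show "x t = y t" using *[of x y] *[of y x] by simp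
qed (use tau_pos init t in auto)

text \<open>
On \<open>{0..n * \<tau>}\<close> the variation-of-constants operator \<open>G\<close> reads its argument only up to time
\<open>(n - 1) * \<tau>\<close>. Hence its iterates become stationary on every bounded interval, and the solution is
their eventual value. The nonlinearity is first extended to negative arguments in a continuous
way, which nonnegativity of the solution makes harmless.
\<close>

lemma solution_exists:
  assumes c: "continuous_on {-\<tau>..0} \<phi>" and nn: "\<And>s. s \<in> {-\<tau>..0} \<Longrightarrow> 0 \<le> \<phi> s"
  shows "\<exists>x. solves_after 0 x \<and> (\<forall>s\<in>{-\<tau>..0}. x s = \<phi> s)"
proof -
  define F where "F y = f (max 0 y)" for y
  have F_cont: "continuous_on UNIV F"
    unfolding F_def by (rule continuous_on_compose2[OF f_cont]) (auto intro!: continuous_intros)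
  define \<psi> where "\<psi> t = \<phi> (max (-\<tau>) (min 0 t))" for t
  have \<psi>_cont: "continuous_on UNIV \<psi>"
    unfolding \<psi>_def by (rule continuous_on_compose2[OF c]) (use tau_pos in \<open>auto intro!: continuous_intros\<close>)
  define G where "G u t = exp (- \<mu> * t) * (\<phi> 0 + integral {0..t} (\<lambda>s. exp (\<mu> * s) * F (u (s - \<tau>))))" for u :: "real \<Rightarrow> real" and t
  define X where "X = rec_nat \<psi> (\<lambda>_ u t. if t \<le> 0 then \<psi> t else G u t)"
  have X0: "X 0 = \<psi>" by (simp add: X_def)
  have XS: "X (Suc n) = (\<lambda>t. if t \<le> 0 then \<psi> t else G (X n) t)" for n
    by (simp only: X_def nat.rec)
  have integrand: "continuous_on S (\<lambda>s. exp (\<mu> * s) * F (u (s - \<tau>)))" if "continuous_on UNIV u" for u S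
  proof -
    have "continuous_on UNIV (\<lambda>s. u (s - \<tau>))"
      by (rule continuous_on_compose2[OF that]) (auto intro!: continuous_intros)
    then have "continuous_on UNIV (\<lambda>s. F (u (s - \<tau>)))"
      by (rule continuous_on_compose2[OF F_cont]) auto
    then have "continuous_on UNIV (\<lambda>s. exp (\<mu> * s) * F (u (s - \<tau>)))"
      by (intro continuous_intros)
    then show ?thesis by (rule continuous_on_subset) simp
  qed
  have G_deriv: "(G u has_real_derivative (- \<mu> * G u t + F (u (t - \<tau>)))) (at t within {0..b})"
    if u: "continuous_on UNIV u" and t: "t \<in> {0..b}" for u t b
  proof -
    have "((\<lambda>t. integral {0..t} (\<lambda>s. exp (\<mu> * s) * F (u (s - \<tau>)))) has_real_derivative
        exp (\<mu> * t) * F (u (t - \<tau>))) (at t within {0..b})"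
      by (rule integral_has_real_derivative[OF integrand[OF u] t])
    moreover have "exp (- (\<mu> * t)) * (exp (\<mu> * t) * y) = y" for y
      by (simp add: mult.assoc[symmetric] exp_add[symmetric])
    ultimately show ?thesis
      unfolding G_def by (auto intro!: derivative_eq_intros simp: algebra_simps)
  qed
  have G0: "G u 0 = \<psi> 0" for u using tau_pos by (simp add: G_def \<psi>_def)
  have G_cont: "continuous_on {0..} (G u)" if u: "continuous_on UNIV u" for u
    unfolding continuous_on_eq_continuous_within
  proof
    fix t :: real assume t: "t \<in> {0..}"
    have "isCont (\<lambda>s. G u (max 0 s)) t"
    proof -
      have "continuous_on {0..t+1} (G u)"
        by (rule DERIV_continuous_on[OF G_deriv[OF u]])
      then have "continuous_on {..<t+1} (\<lambda>s. G u (max 0 s))"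
        by (rule continuous_on_compose2) (use t in \<open>auto intro!: continuous_intros\<close>)
      then show ?thesis by (simp add: continuous_on_eq_continuous_at)
    qed
    then have "continuous (at t within {0..}) (\<lambda>s. G u (max 0 s))"
      using continuous_at_imp_continuous_within by blast
    then show "continuous (at t within {0..}) (G u)"
      by (rule continuous_transform_within[where \<delta>=1]) (use t in auto)
  qed
  have X_cont: "continuous_on UNIV (X n)" for n
  proof (induction n)
    case 0
    then show ?case by (simp add: X0 \<psi>_cont)
  next
    case (Suc n)
    have "continuous_on ({..0} \<union> {0..}) (\<lambda>t. if t \<le> 0 then \<psi> t else G (X n) t)"
      by (rule continuous_on_If[where P = "\<lambda>t. t \<le> 0"])
         (use G_cont[OF Suc] continuous_on_subset[OF \<psi>_cont] G0 in \<open>auto\<close>)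
    moreover have "{..0} \<union> {0..} = (UNIV :: real set)" by auto
    ultimately show ?case unfolding XS by simp
  qed
  have X_init: "X n t = \<psi> t" if "t \<le> 0" for n t
    by (cases n) (use that in \<open>simp_all add: X0 XS\<close>)
  have X_step: "X (Suc n) t = X n t" if "t \<le> real n * \<tau>" for n t
    using that
  proof (induction n arbitrary: t)
    case 0
    then show ?case by (simp add: X0 XS)
  next
    case (Suc n)
    have "integral {0..t} (\<lambda>s. exp (\<mu> * s) * F (X (Suc n) (s - \<tau>))) =
          integral {0..t} (\<lambda>s. exp (\<mu> * s) * F (X n (s - \<tau>)))"
    proof (rule integral_cong)
      fix s assume "s \<in> {0..t}"
      then have "s - \<tau> \<le> real n * \<tau>" using Suc.prems by (simp add: algebra_simps)
      then show "exp (\<mu> * s) * F (X (Suc n) (s - \<tau>)) = exp (\<mu> * s) * F (X n (s - \<tau>))"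
        using Suc.IH by simp
    qed
    then show ?case unfolding XS[of "Suc n"] XS[of n] G_def by simp
  qed
  \<comment> \<open>iterate \<open>n\<close> has reached its final value on \<open>{..n * \<tau>}\<close>\<close>
  have X_stable: "X (n + k) t = X n t" if "t \<le> real n * \<tau>" for n k t
  proof (induction k)
    case (Suc k)
    have "real n * \<tau> \<le> real (n + k) * \<tau>" using tau_pos by simp
    then have "t \<le> real (n + k) * \<tau>" using that by linarith
    then show ?case using X_step[of t "n + k"] Suc by simp
  qed simp
  define N where "N t = (SOME n. t \<le> real n * \<tau>)" for t
  have N: "t \<le> real (N t) * \<tau>" for t
  proof -
    obtain n where "t / \<tau> \<le> real n" using real_arch_simple by blast
    then have "t \<le> real n * \<tau>" using tau_pos by (simp add: field_simps)
    then show ?thesis unfolding N_def by (rule someI)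
  qed
  define x where "x t = X (N t) t" for t
  have x_eq: "x t = X n t" if "t \<le> real n * \<tau>" for n t
    using X_stable[OF that, of "N t"] X_stable[OF N, of t n] by (simp add: x_def add.commute)
  have x_init: "x t = \<psi> t" if "t \<le> 0" for t
    using X_init that by (simp add: x_def)
  have x_locally: "\<forall>\<^sub>F s in nhds t. x s = X n s" if "t < real n * \<tau>" for t n
    using eventually_nhds_in_open[OF open_lessThan, of t "real n * \<tau>"] that
    by (auto elim!: eventually_mono intro: x_eq)
  have less_Suc: "t < real (Suc (N t)) * \<tau>" for t
    using N[of t] tau_pos by (simp add: algebra_simps)
  have x_cont: "continuous_on UNIV x"
    unfolding continuous_on_eq_continuous_at[OF open_UNIV]
  proof
    fix t
    have "isCont (X (Suc (N t))) t" using X_cont continuous_on_eq_continuous_at[OF open_UNIV] by blast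
    then show "isCont x t" using isCont_cong[OF x_locally[OF less_Suc]] by simp
  qed
  have x_deriv: "(x has_real_derivative (- \<mu> * x t + F (x (t - \<tau>)))) (at t)" if "t > 0" for t
  proof -
    define n where "n = N t"
    have n: "t \<le> real n * \<tau>" "t < real (Suc n) * \<tau>" using N less_Suc by (auto simp: n_def)
    have "(G (X n) has_real_derivative (- \<mu> * G (X n) t + F (X n (t - \<tau>)))) (at t)"
      using G_deriv[OF X_cont[of n], of t "t + 1"] that
      by (simp add: at_within_Icc_at)
    moreover have "\<forall>\<^sub>F s in nhds t. X (Suc n) s = G (X n) s"
      using eventually_nhds_in_open[OF open_greaterThan, of t 0] that
      by (auto elim!: eventually_mono simp: XS)
    then have *: "\<forall>\<^sub>F s in nhds t. x s = G (X n) s"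
      using x_locally[OF n(2)] by eventually_elim simp
    moreover have "x t = G (X n) t" using * by (rule eventually_nhds_x_imp_x)
    moreover have "x (t - \<tau>) = X n (t - \<tau>)" using n tau_pos by (intro x_eq) simp
    ultimately show ?thesis by (simp add: DERIV_cong_ev[OF refl *])
  qed
  have nonneg: "0 \<le> x t" if "-\<tau> \<le> t" for t
  proof (cases "t \<le> 0")
    case True
    then show ?thesis using x_init nn that tau_pos by (simp add: \<psi>_def max_def min_def)
  next
    case False
    have F0: "0 \<le> F y" for y by (simp add: F_def f_nonneg)
    have "0 \<le> \<phi> 0" using nn tau_pos by simp
    moreover have "0 - x t \<le> exp (- \<mu> * (t - 0)) * (0 - x 0)"
    proof (rule exp_decay[of 0 t "\<lambda>t. 0 - x t"])
      show "continuous_on {0..t} (\<lambda>t. 0 - x t)"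
        by (intro continuous_intros continuous_on_subset[OF x_cont]) auto
      fix r assume r: "0 < r" "r < t"
      show "\<exists>D. ((\<lambda>t. 0 - x t) has_real_derivative D) (at r) \<and> D + \<mu> * (0 - x r) \<le> 0"
        by (rule exI[of _ "- (- \<mu> * x r + F (x (r - \<tau>)))"])
           (use x_deriv[OF r(1)] F0 in \<open>auto intro!: derivative_eq_intros\<close>)
    qed (use False in simp)
    moreover have "x 0 = \<phi> 0" using x_init[of 0] tau_pos by (simp add: \<psi>_def)
    ultimately show ?thesis by (smt (verit) exp_ge_zero mult_nonneg_nonpos)
  qed
  have "solves_after 0 x"
    unfolding solves_after_def
  proof (intro conjI allI impI)
    show "continuous_on {0 - \<tau>..} x" using x_cont by (rule continuous_on_subset) simp
    fix t :: real assume "0 < t"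
    then show "(x has_real_derivative (- \<mu> * x t + f (x (t - \<tau>)))) (at t)"
      using x_deriv[of t] nonneg[of "t - \<tau>"] by (simp add: F_def max_def)
  qed
  moreover have "\<forall>s\<in>{-\<tau>..0}. x s = \<phi> s"
    using x_init by (auto simp: \<psi>_def max_def min_def)
  ultimately show ?thesis by blast
qed

lemma dde_solution_props:
  assumes "\<phi> \<in> mspace (phase_space \<tau>)"
  shows "solves_after 0 (dde_solution \<mu> f \<tau> \<phi>)"
    and "\<And>s. s \<in> {-\<tau>..0} \<Longrightarrow> dde_solution \<mu> f \<tau> \<phi> s = \<phi> s"
proof -
  have iff: "is_dde_solution \<mu> f \<tau> \<phi> x \<longleftrightarrow>
    x \<in> extensional {-\<tau>..} \<and> solves_after 0 x \<and> (\<forall>s\<in>{-\<tau>..0}. x s = \<phi> s)" for x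
    by (auto simp: is_dde_solution_def solves_after_def)
  obtain x where x: "solves_after 0 x" "\<forall>s\<in>{-\<tau>..0}. x s = \<phi> s"
    using solution_exists assms unfolding mspace_phase_space by blast
  have "solves_after 0 (restrict x {-\<tau>..})"
    unfolding solves_after_def
  proof (intro conjI allI impI)
    show "continuous_on {0 - \<tau>..} (restrict x {- \<tau>..})"
      using solves_after_continuous_on[OF x(1), of "{0 - \<tau>..}"]
      by (subst continuous_on_cong[OF refl, where g = x]) auto
    fix t :: real assume t: "0 < t"
    have "\<forall>\<^sub>F s in nhds t. restrict x {-\<tau>..} s = x s"
      using eventually_nhds_in_open[OF open_greaterThan, of t 0] t tau_pos
      by (auto elim!: eventually_mono)
    then show "(restrict x {- \<tau>..} has_real_derivative
          (- \<mu> * restrict x {- \<tau>..} t + f (restrict x {- \<tau>..} (t - \<tau>)))) (at t)"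
      using x(1) t tau_pos by (subst DERIV_cong_ev[OF refl _ refl]) (auto simp: solves_after_def)
  qed
  then have ex: "is_dde_solution \<mu> f \<tau> \<phi> (restrict x {-\<tau>..})" using x by (simp add: iff)
  have uniq: "y = restrict x {-\<tau>..}" if "is_dde_solution \<mu> f \<tau> \<phi> y" for y
  proof (rule extensionalityI)
    show "y \<in> extensional {-\<tau>..}" "restrict x {-\<tau>..} \<in> extensional {-\<tau>..}"
      using that ex by (auto simp: iff)
    fix t assume "t \<in> {-\<tau>..}"
    then show "y t = restrict x {-\<tau>..} t"
      using solution_unique[of 0 y "restrict x {-\<tau>..}" t] that ex by (auto simp: iff)
  qed
  have "is_dde_solution \<mu> f \<tau> \<phi> (dde_solution \<mu> f \<tau> \<phi>)"
    unfolding dde_solution_def by (rule theI[where a = "restrict x {-\<tau>..}"]) (fact ex, fact uniq)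
  then show "solves_after 0 (dde_solution \<mu> f \<tau> \<phi>)"
    and "\<And>s. s \<in> {-\<tau>..0} \<Longrightarrow> dde_solution \<mu> f \<tau> \<phi> s = \<phi> s"
    by (auto simp: iff)
qed

lemma dde_solution_eqI:
  assumes "solves_after 0 y" "restrict y {-\<tau>..0} \<in> mspace (phase_space \<tau>)" "-\<tau> \<le> t"
  shows "dde_solution \<mu> f \<tau> (restrict y {-\<tau>..0}) t = y t"
  by (rule solution_unique[OF dde_solution_props(1)[OF assms(2)] assms(1)])
     (use dde_solution_props(2)[OF assms(2)] assms(3) in auto)

lemma semiflow_continuous:
  assumes \<phi>: "\<phi> \<in> mspace (phase_space \<tau>)" and "0 \<le> t"
  shows "continuous_on {-\<tau>..0} (semiflow \<mu> f \<tau> t \<phi>)" "semiflow \<mu> f \<tau> t \<phi> \<in> extensional {-\<tau>..0}"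
proof -
  have "continuous_on {-\<tau>..0} (\<lambda>s. dde_solution \<mu> f \<tau> \<phi> (t + s))"
    by (rule continuous_on_compose2[OF solves_after_continuous_on[OF dde_solution_props(1)[OF \<phi>], of "{-\<tau>..}"]])
       (use \<open>0 \<le> t\<close> in \<open>auto intro!: continuous_intros\<close>)
  then show "continuous_on {-\<tau>..0} (semiflow \<mu> f \<tau> t \<phi>)"
    by (subst continuous_on_cong[OF refl, where g = "\<lambda>s. dde_solution \<mu> f \<tau> \<phi> (t + s)"]) (auto simp: semiflow_def)
qed (simp add: semiflow_def)

lemma near_point_of_semiflow:
  assumes \<phi>: "\<phi> \<in> mspace (phase_space \<tau>)" and "0 \<le> t" and \<psi>: "\<psi> \<in> mspace (phase_space \<tau>)"
    and d: "mdist (phase_space \<tau>) (semiflow \<mu> f \<tau> t \<phi>) \<psi> < e"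
  shows "\<bar>dde_solution \<mu> f \<tau> \<phi> t - \<psi> 0\<bar> < e"
  using mdist_phase_space_less[OF semiflow_continuous(2,1)[OF \<phi> \<open>0 \<le> t\<close>] _ _ d, of 0] \<psi> tau_pos
  by (auto simp: mspace_phase_space semiflow_def)

end

section \<open>Unimodal maps\<close>

text \<open>
What the dynamics uses of \<open>g\<close> apart from its Schwarzian derivative. The concavity on \<open>{0..x0}\<close> enters
only through \<open>x < g x\<close> for \<open>0 < x < K\<close>.
\<close>

locale unimodal_map =
  fixes g :: "real \<Rightarrow> real" and x0 K :: real
  assumes g_cont: "continuous_on {0..} g"
    and x0_pos: "0 < x0" and x0_less_K: "x0 < K"
    and g_increasing: "\<And>x y. 0 \<le> x \<Longrightarrow> x < y \<Longrightarrow> y \<le> x0 \<Longrightarrow> g x < g y"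
    and g_decreasing: "\<And>x y. x0 \<le> x \<Longrightarrow> x < y \<Longrightarrow> g y < g x"
    and g_nonneg: "\<And>x. 0 \<le> x \<Longrightarrow> 0 \<le> g x"
    and g_K: "g K = K"
    and g_above: "\<And>x. 0 < x \<Longrightarrow> x < K \<Longrightarrow> x < g x"
    and g_g_x0: "x0 < g (g x0)"
begin

definition "\<beta> = g x0"
definition "\<alpha> = g \<beta>"

lemma g_decreasing_le: "x0 \<le> x \<Longrightarrow> x \<le> y \<Longrightarrow> g y \<le> g x"
  using g_decreasing by (cases "x = y") (auto simp: less_imp_le)

lemma g_increasing_le: "0 \<le> x \<Longrightarrow> x \<le> y \<Longrightarrow> y \<le> x0 \<Longrightarrow> g x \<le> g y"
  using g_increasing by (cases "x = y") (auto simp: less_imp_le)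

lemma g_pos: "0 < x \<Longrightarrow> 0 < g x"
  using g_above[of x] g_decreasing[of x "x+1"] g_nonneg[of "x+1"] x0_less_K x0_pos
  by (cases "x < K") auto

lemma g_le_beta: "0 \<le> x \<Longrightarrow> g x \<le> \<beta>"
  unfolding \<beta>_def using g_increasing_le[of x x0] g_decreasing_le[of x0 x] by (cases "x \<le> x0") auto

lemma g_min_endpoints: "0 \<le> m \<Longrightarrow> m \<le> x \<Longrightarrow> x \<le> M \<Longrightarrow> min (g m) (g M) \<le> g x"
  using g_increasing_le[of m x] g_decreasing_le[of x M] by (cases "x \<le> x0") auto

lemma order: "x0 < \<alpha>" "\<alpha> < K" "K < \<beta>"
proof -
  show "x0 < \<alpha>" using g_g_x0 by (simp add: \<alpha>_def \<beta>_def)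
  show "K < \<beta>" using g_decreasing[of x0 K] x0_less_K g_K by (simp add: \<beta>_def)
  then show "\<alpha> < K" using g_decreasing[of K \<beta>] x0_less_K g_K by (simp add: \<alpha>_def)
qed

lemma g_core: "x \<in> {\<alpha>..\<beta>} \<Longrightarrow> g x \<in> {\<alpha>..\<beta>}"
  using g_le_beta[of x] g_decreasing_le[of x \<beta>] order x0_pos by (auto simp: \<alpha>_def)

lemma g_core_interior: "x \<in> {\<alpha><..<\<beta>} \<Longrightarrow> g x \<in> {\<alpha><..<\<beta>}"
  using g_le_beta[of \<alpha>] g_decreasing[of x \<beta>] g_decreasing[of \<alpha> x] order x0_pos by (auto simp: \<alpha>_def)

lemma g_g_continuous_on: "S \<subseteq> {0..} \<Longrightarrow> continuous_on S (\<lambda>x. g (g x))"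
  by (rule continuous_on_compose2[OF g_cont continuous_on_subset[OF g_cont]]) (auto intro: g_nonneg)

text \<open>
\<open>g\<close> reverses the order on \<open>{\<alpha>..\<beta>}\<close> and commutes with its second iterate, so it carries the sign
of \<open>g (g x) - x\<close> on the left of \<open>a\<close> to the opposite sign on the right of \<open>b = g a\<close>.
\<close>

lemma mirror_below:
  assumes ab: "\<alpha> \<le> a" "a \<le> K" "b = g a"
    and below: "\<And>x. \<alpha> \<le> x \<Longrightarrow> x < a \<Longrightarrow> x < g (g x)" and "g b = a"
    and x: "b < x" "x \<le> \<beta>"
  shows "g (g x) < x"
proof -
  have "K \<le> b" using g_decreasing_le[of a K] ab order g_K by simp
  then have "g x < a" "\<alpha> \<le> g x" using g_decreasing[of b x] g_core[of x] x order \<open>g b = a\<close> by auto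
  then have "g x < g (g (g x))" using below by blast
  then show ?thesis
    using g_decreasing_le[of x "g (g x)"] x \<open>K \<le> b\<close> order by force
qed

text \<open>
The one-dimensional half of the argument; \<open>m\<close> and \<open>M\<close> will be the infimum and the supremum of an
entire solution. Since \<open>g m > m\<close> below \<open>K\<close>, the first inequality can only come from \<open>g M \<le> m\<close>, which
puts \<open>M\<close> on the decreasing branch and yields \<open>\<alpha> \<le> m\<close>. There both inequalities can be combined into
\<open>g (g m) \<le> m\<close> and \<open>M \<le> g (g M)\<close>.
\<close>

lemma core_bounds:
  assumes ab: "\<alpha> \<le> a" "a \<le> K" "b = g a" "g b = a"
    and below: "\<And>x. \<alpha> \<le> x \<Longrightarrow> x < a \<Longrightarrow> x < g (g x)"
    and m: "0 < m" "m \<le> M" "M \<le> \<beta>" and mM: "min (g m) (g M) \<le> m"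
    and M: "x0 \<le> m \<Longrightarrow> M \<le> g m"
  shows "a \<le> m" "M \<le> b"
proof -
  have "\<alpha> \<le> m"
  proof (cases "m < K")
    case True
    then have "g M \<le> m" using mM g_above[of m] m(1) by auto
    have "x0 < M"
    proof (rule ccontr)
      assume "\<not> x0 < M"
      then have "g m \<le> g M" using g_increasing_le[of m M] m by auto
      then show False using g_above[of m] m(1) True \<open>g M \<le> m\<close> by auto
    qed
    then have "\<alpha> \<le> g M" using g_decreasing_le[of M \<beta>] m by (simp add: \<alpha>_def)
    then show ?thesis using \<open>g M \<le> m\<close> by simp
  qed (use order in simp)
  then have m': "x0 < m" using order by simp
  have Mg: "M \<le> g m" using M m' by simp
  have "g M \<le> g m" using g_decreasing_le[of m M] m m' by simp
  then have gM: "g M \<le> m" using mM by simp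
  have "\<alpha> \<le> g M" using g_decreasing_le[of M \<beta>] m m' by (simp add: \<alpha>_def)
  have "g (g m) \<le> g M" using g_decreasing_le[of M "g m"] Mg m m' by simp
  then have h: "g (g m) \<le> m" using gM by simp
  show "a \<le> m" using below[of m] h \<open>\<alpha> \<le> m\<close> by force
  have "g m \<le> g (g M)" using g_decreasing_le[of "g M" m] gM \<open>\<alpha> \<le> g M\<close> order by simp
  then have "M \<le> g (g M)" using Mg by simp
  then show "M \<le> b" using mirror_below[OF ab(1-3) below ab(4), of M] m by force
qed

end

section \<open>Maps with negative Schwarzian derivative\<close>

lemma decrease_right_of_critical_point:
  fixes F F1 :: "real \<Rightarrow> real"
  assumes d1: "\<And>x. x \<in> {p<..<q} \<Longrightarrow> (F has_real_derivative F1 x) (at x)"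
    and d2: "(F1 has_real_derivative l) (at m)" and m: "p < m" "m < q"
    and crit: "F1 m = 0" and l: "l < 0"
  shows "\<exists>x\<in>{m<..<q}. F x < F m"
proof -
  obtain d where d: "d > 0" "\<And>h. 0 < h \<Longrightarrow> h < d \<Longrightarrow> F1 (m + h) < F1 m"
    using DERIV_neg_dec_right[OF d2 l] by blast
  define e where "e = min (d/2) ((q - m)/2)"
  have e: "0 < e" "e < d" "m + e < q" using d m by (auto simp: e_def min_def field_simps)
  have "F (m + e) < F m"
  proof (rule DERIV_neg_imp_decreasing_open[of m "m + e" F])
    show "continuous_on {m..m+e} F"
      by (rule DERIV_continuous_on, rule has_field_derivative_at_within, rule d1) (use m e in auto)
    fix x assume x: "m < x" "x < m + e"
    then have "F1 x < 0" using d(2)[of "x - m"] e crit by simp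
    then show "\<exists>y. (F has_real_derivative y) (at x) \<and> y < 0"
      using d1[of x] x m e by auto
  qed (use e in simp)
  then show ?thesis using e by (intro bexI[of _ "m + e"]) auto
qed

text \<open>
This is the chain rule \<open>S (G \<circ> g) = (S G \<circ> g) * g'\<^sup>2 + S g\<close> for Schwarzian derivatives, at a point
where the second derivative of \<open>G \<circ> g\<close> vanishes. Capital letters are the derivatives of the outer
map, small letters those of the inner map, and the conclusion is about the third derivative of the
composition. With \<open>R = A2 / A1\<close> and \<open>r = a2 / a1\<close> the assumption on the second derivative says
\<open>R * a1 = - r\<close>, and then the quadratic terms cancel.
\<close>

lemma schwarzian_composition_negative:
  fixes A1 A2 A3 a1 a2 a3 :: real
  assumes "A1 < 0" "a1 < 0"
    and S: "A3 / A1 - 3/2 * (A2 / A1)\<^sup>2 < 0" "a3 / a1 - 3/2 * (a2 / a1)\<^sup>2 < 0"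
    and crit: "A2 * a1\<^sup>2 + A1 * a2 = 0"
  shows "A3 * a1 ^ 3 + 3 * A2 * a1 * a2 + A1 * a3 < 0"
proof -
  define R r where "R = A2 / A1" and "r = a2 / a1"
  have "R * a1 = - r"
  proof -
    have "(R * a1 + r) * (A1 * a1) = A2 * a1\<^sup>2 + A1 * a2"
      using assms(1,2) by (simp add: R_def r_def field_simps power2_eq_square)
    then show ?thesis using crit assms(1,2) by simp
  qed
  then have Ra: "R * a1 * r = - r\<^sup>2" "(R * a1)\<^sup>2 = r\<^sup>2" by (simp_all add: power2_eq_square)
  have "A3 / A1 * a1\<^sup>2 < 3/2 * R\<^sup>2 * a1\<^sup>2"
    using S(1) assms(2) by (intro mult_strict_right_mono) (auto simp: R_def)
  also have "\<dots> = 3/2 * r\<^sup>2" using Ra(2) by (simp add: power_mult_distrib)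
  finally have "A3 / A1 * a1\<^sup>2 + 3 * (R * a1 * r) + a3 / a1 < 0"
    using S(2) Ra(1) unfolding r_def by linarith
  moreover have "A1 * a1 > 0" using assms(1,2) by (simp add: mult_neg_neg)
  ultimately have "A1 * a1 * (A3 / A1 * a1\<^sup>2 + 3 * (R * a1 * r) + a3 / a1) < 0"
    by (simp add: mult_pos_neg)
  also have "A1 * a1 * (A3 / A1 * a1\<^sup>2 + 3 * (R * a1 * r) + a3 / a1) =
      A3 * a1 ^ 3 + 3 * A2 * a1 * a2 + A1 * a3"
    using assms(1,2) by (simp add: R_def r_def field_simps power2_eq_square power3_eq_cube)
  finally show ?thesis .
qed

text \<open>
The derivatives are explicit functions on the open interval only, where one-sided and two-sided
derivatives agree.
\<close>

locale singer_map = unimodal_map +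
  fixes g1 g2 g3 :: "real \<Rightarrow> real"
  assumes g1: "\<And>x. x \<in> {\<alpha><..<\<beta>} \<Longrightarrow> (g has_real_derivative g1 x) (at x)"
    and g2: "\<And>x. x \<in> {\<alpha><..<\<beta>} \<Longrightarrow> (g1 has_real_derivative g2 x) (at x)"
    and g3: "\<And>x. x \<in> {\<alpha><..<\<beta>} \<Longrightarrow> (g2 has_real_derivative g3 x) (at x)"
    and g1_neg: "\<And>x. x \<in> {\<alpha><..<\<beta>} \<Longrightarrow> g1 x < 0"
    and schwarzian: "\<And>x. x \<in> {\<alpha><..<\<beta>} \<Longrightarrow> g3 x / g1 x - 3/2 * (g2 x / g1 x)\<^sup>2 < 0"
begin

definition "h x = g (g x)"
definition "h1 x = g1 (g x) * g1 x"
definition "h2 x = g2 (g x) * (g1 x)\<^sup>2 + g1 (g x) * g2 x"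
definition "h3 x = g3 (g x) * g1 x ^ 3 + 3 * g2 (g x) * g1 x * g2 x + g1 (g x) * g3 x"

lemma h_derivs:
  assumes x: "x \<in> {\<alpha><..<\<beta>}"
  shows "(h has_real_derivative h1 x) (at x)" "(h1 has_real_derivative h2 x) (at x)"
    "(h2 has_real_derivative h3 x) (at x)"
proof -
  note gx = g_core_interior[OF x]
  note c = DERIV_chain2[OF g1[OF gx] g1[OF x]] DERIV_chain2[OF g2[OF gx] g1[OF x]]
    DERIV_chain2[OF g3[OF gx] g1[OF x]]
  show "(h has_real_derivative h1 x) (at x)"
    unfolding h_def[abs_def] h1_def by (rule c)
  show "(h1 has_real_derivative h2 x) (at x)"
    unfolding h1_def[abs_def] h2_def
    by (rule derivative_eq_intros c g2[OF x])+ (simp add: power2_eq_square algebra_simps)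
  show "(h2 has_real_derivative h3 x) (at x)"
    unfolding h2_def[abs_def] h3_def
    by (rule derivative_eq_intros c g2[OF x] g3[OF x] refl)+ (simp add: power2_eq_square power3_eq_cube algebra_simps)
qed

text \<open>
At an interior minimum of \<open>h'\<close> the second derivative of \<open>h\<close> vanishes, and then the negative
Schwarzian derivative makes the third derivative negative, so \<open>h'\<close> would decrease to the right of
the minimum.
\<close>

lemma h1_no_local_min:
  assumes p: "\<alpha> < p" "p < \<xi>" "\<xi> < q" "q < \<beta>"
  shows "\<not> (h1 \<xi> \<le> h1 p \<and> h1 \<xi> \<le> h1 q)"
proof
  assume le: "h1 \<xi> \<le> h1 p \<and> h1 \<xi> \<le> h1 q"
  have "continuous_on {p..q} h1"
    by (rule DERIV_continuous_on, rule has_field_derivative_at_within, rule h_derivs) (use p in auto)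
  then obtain c where c: "c \<in> {p..q}" "\<And>x. x \<in> {p..q} \<Longrightarrow> h1 c \<le> h1 x"
    using continuous_attains_inf[of "{p..q}" h1] p by auto
  obtain m where m: "p < m" "m < q" "\<And>x. x \<in> {p..q} \<Longrightarrow> h1 m \<le> h1 x"
  proof (cases "c = p \<or> c = q")
    case True
    have "h1 \<xi> \<le> h1 c" using True le by auto
    then show ?thesis using that[of \<xi>] c p by (meson order_trans)
  next
    case False
    then show ?thesis using that[of c] c by auto
  qed
  have mi: "m \<in> {\<alpha><..<\<beta>}" using m p by auto
  have "h2 m = 0"
  proof (rule DERIV_local_min[OF h_derivs(2)[OF mi], of "min (m - p) (q - m)"])
    show "\<forall>y. \<bar>m - y\<bar> < min (m - p) (q - m) \<longrightarrow> h1 m \<le> h1 y"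
      by (intro allI impI m(3)) auto
  qed (use m in auto)
  moreover have "h3 m < 0"
    unfolding h3_def
    by (rule schwarzian_composition_negative)
       (use calculation g1_neg[OF mi] g1_neg[OF g_core_interior[OF mi]] schwarzian[OF mi]
         schwarzian[OF g_core_interior[OF mi]] in \<open>simp_all add: h2_def\<close>)
  ultimately obtain x where "x \<in> {m<..<q}" "h1 x < h1 m"
    using decrease_right_of_critical_point[of p q h1 h2 "h3 m" m] h_derivs m p by auto
  then show False using m(3)[of x] m(1,2) by simp
qed

lemma h_slope_one_between_fixpoints:
  assumes "\<alpha> \<le> p" "p < q" "q \<le> \<beta>" "h p = p" "h q = q"
  shows "\<exists>\<xi>. p < \<xi> \<and> \<xi> < q \<and> h1 \<xi> = 1"
proof -
  have "continuous_on {p..q} h"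
    unfolding h_def[abs_def] using assms order x0_pos by (intro g_g_continuous_on) auto
  moreover have "(h has_real_derivative h1 x) (at x)" if "p < x" "x < q" for x
    using h_derivs(1)[of x] that assms by simp
  ultimately obtain l z where "p < z" "z < q" "(h has_real_derivative l) (at z)" "h q - h p = (q - p) * l"
    using MVT[of p q h] assms(2) by (metis real_differentiable_def)
  moreover have "l = h1 z"
    using DERIV_unique[OF calculation(3) h_derivs(1)[of z]] assms calculation by simp
  ultimately show ?thesis using assms by (intro exI[of _ z]) auto
qed

text \<open>
The mean value theorem provides slope 1 on both sides of the middle fixed point, and a slope of at
most 1 in between would produce a local minimum of \<open>h'\<close>.
\<close>

lemma middle_fixpoint_repelling:
  assumes "\<alpha> \<le> p" "p < q" "q < r" "r \<le> \<beta>" "h p = p" "h q = q" "h r = r"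
  shows "1 < h1 q"
proof -
  obtain \<xi> \<eta> where "p < \<xi>" "\<xi> < q" "h1 \<xi> = 1" "q < \<eta>" "\<eta> < r" "h1 \<eta> = 1"
    using h_slope_one_between_fixpoints[of p q] h_slope_one_between_fixpoints[of q r] assms by auto
  then show ?thesis using h1_no_local_min[of \<xi> q \<eta>] assms by force
qed

text \<open>
Of four fixed points the two inner ones are repelling, and between them there is a point of slope
1, again a local minimum of \<open>h'\<close>.
\<close>

lemma at_most_three_fixpoints:
  assumes "\<alpha> \<le> p" "p < q" "q < r" "r < s" "s \<le> \<beta>" "h p = p" "h q = q" "h r = r" "h s = s"
  shows False
proof -
  have "1 < h1 q" "1 < h1 r"
    using middle_fixpoint_repelling[of p q r] middle_fixpoint_repelling[of q r s] assms by auto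
  moreover obtain \<xi> where "q < \<xi>" "\<xi> < r" "h1 \<xi> = 1"
    using h_slope_one_between_fixpoints[of q r] assms by auto
  ultimately show False using h1_no_local_min[of q \<xi> r] assms by auto
qed

text \<open>
The orbit of a fixed point of \<open>h\<close> below \<open>K\<close> is a 2-cycle around \<open>K\<close>.
\<close>

lemma h_mirror_fixpoint:
  assumes "\<alpha> \<le> p" "p < K" "h p = p"
  shows "K < g p" "g p \<le> \<beta>" "h (g p) = g p"
  using assms g_decreasing[of p K] g_le_beta[of p] order g_K x0_pos by (auto simp: h_def)

lemma h_K: "h K = K" "h1 K = (g1 K)\<^sup>2"
  by (simp_all add: h_def h1_def g_K power2_eq_square)

lemma h_alpha: "\<alpha> \<le> h \<alpha>"
  using g_core[of \<alpha>] g_core[of "g \<alpha>"] order by (simp add: h_def)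

lemma h_ivt:
  assumes "\<alpha> \<le> p" "p \<le> q" "q \<le> \<beta>" "(h p - p) * (h q - q) \<le> 0"
  shows "\<exists>x. p \<le> x \<and> x \<le> q \<and> h x = x"
proof -
  have c: "continuous_on {p..q} (\<lambda>x. h x - x)"
    unfolding h_def[abs_def] using assms order x0_pos by (intro continuous_intros g_g_continuous_on) auto
  have "(h p - p \<le> 0 \<and> 0 \<le> h q - q) \<or> (h q - q \<le> 0 \<and> 0 \<le> h p - p)"
    using assms(4) by (auto simp: mult_le_0_iff)
  then show ?thesis
    using IVT'[of "\<lambda>x. h x - x" p 0 q, OF _ _ assms(2) c] IVT2'[of "\<lambda>x. h x - x" q 0 p, OF _ _ assms(2) c]
    by force
qed

text \<open>
A fixed point of \<open>h\<close> to the left of \<open>K\<close> has a partner to the right of \<open>K\<close>, which would make \<open>K\<close>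
repelling. Hence \<open>h\<close> has no fixed point there, and the sign of \<open>h x - x\<close> is the one at \<open>\<alpha>\<close>.
\<close>

lemma stable_core:
  assumes "\<bar>g1 K\<bar> \<le> 1" and x: "\<alpha> \<le> x" "x < K"
  shows "x < g (g x)"
proof (rule ccontr)
  assume "\<not> x < g (g x)"
  then obtain p where p: "\<alpha> \<le> p" "p \<le> x" "h p = p"
    using h_ivt[of \<alpha> x] x order h_alpha by (auto simp: mult_nonneg_nonpos h_def)
  have "1 < h1 K"
    using middle_fixpoint_repelling[of p K "g p"] h_mirror_fixpoint[of p] p x h_K by auto
  moreover have "h1 K \<le> 1" using assms(1) by (simp add: h_K abs_square_le_1)
  ultimately show False by simp
qed

text \<open>
Since \<open>h' K = (g' K)\<^sup>2 > 1\<close>, the graph of \<open>h\<close> lies below the diagonal immediately to the left of \<open>K\<close>,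
while \<open>\<alpha> \<le> h \<alpha>\<close>; so there is a fixed point \<open>a\<close> in between. A second one, together with \<open>K\<close> and
its mirror image, would be one of four fixed points.
\<close>

lemma unstable_core:
  assumes "1 < \<bar>g1 K\<bar>"
  obtains a where "\<alpha> \<le> a" "a < K" "g (g a) = a"
    "\<And>x. \<alpha> \<le> x \<Longrightarrow> x < a \<Longrightarrow> x < g (g x)"
    "\<And>x. a < x \<Longrightarrow> x < K \<Longrightarrow> g (g x) < x"
    "\<And>x. \<alpha> \<le> x \<Longrightarrow> x < K \<Longrightarrow> g (g x) = x \<Longrightarrow> x = a"
proof -
  have "1 < h1 K" using assms by (metis h_K(2) one_less_power power2_abs zero_less_numeral)
  moreover have "((\<lambda>x. h x - x) has_real_derivative (h1 K - 1)) (at K)"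
    using h_derivs(1)[of K] order by (auto intro!: derivative_eq_intros)
  ultimately obtain d where d: "d > 0" "\<And>e. 0 < e \<Longrightarrow> e < d \<Longrightarrow> h (K - e) - (K - e) < h K - K"
    using DERIV_pos_inc_left[of "\<lambda>x. h x - x" "h1 K - 1" K] by auto
  have near: "\<exists>z. x < z \<and> z < K \<and> h z < z" if "x < K" for x
  proof -
    define e where "e = min (d/2) ((K - x)/2)"
    have "0 < e" "e < d" "x < K - e" using d that by (auto simp: e_def min_def field_simps)
    then show ?thesis using d(2)[of e] h_K by (intro exI[of _ "K - e"]) auto
  qed
  have unique: "p = q" if "\<alpha> \<le> p" "p < K" "h p = p" "\<alpha> \<le> q" "q < K" "h q = q" for p q
  proof (rule ccontr)
    assume "p \<noteq> q"
    then consider "p < q" | "q < p" by linarith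
    then show False
      using at_most_three_fixpoints[of p q K "g q"] at_most_three_fixpoints[of q p K "g p"]
        h_mirror_fixpoint[of p] h_mirror_fixpoint[of q] that h_K by cases auto
  qed
  obtain z where z: "\<alpha> < z" "z < K" "h z < z" using near order by blast
  then obtain a where a: "\<alpha> \<le> a" "a \<le> z" "h a = a"
    using h_ivt[of \<alpha> z] h_alpha order by (auto simp: mult_nonneg_nonpos)
  show thesis
  proof (rule that[of a])
    show "\<alpha> \<le> a" "a < K" "g (g a) = a" using a z by (auto simp: h_def)
    show "x = a" if "\<alpha> \<le> x" "x < K" "g (g x) = x" for x
      using unique[of x a] that a z by (simp add: h_def)
    show "x < g (g x)" if x: "\<alpha> \<le> x" "x < a" for x
    proof (rule ccontr)
      assume "\<not> x < g (g x)"
      then obtain p where "\<alpha> \<le> p" "p \<le> x" "h p = p"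
        using h_ivt[of \<alpha> x] x a z order h_alpha by (auto simp: mult_nonneg_nonpos h_def)
      then show False using unique[of p a] a z x by auto
    qed
    show "g (g x) < x" if x: "a < x" "x < K" for x
    proof (rule ccontr)
      assume "\<not> g (g x) < x"
      moreover obtain w where w: "x < w" "w < K" "h w < w" using near x by blast
      ultimately obtain p where "x \<le> p" "p \<le> w" "h p = p"
        using h_ivt[of x w] x a z order by (auto simp: mult_nonneg_nonpos h_def)
      then show False using unique[of p a] a z x w by auto
    qed
  qed
qed

lemma two_cycle_unique:
  assumes a: "\<And>x. \<alpha> \<le> x \<Longrightarrow> x < K \<Longrightarrow> g (g x) = x \<Longrightarrow> x = a"
    and C: "is_2cycle g C" "C \<subseteq> {\<alpha>..\<beta>}"
  shows "C = {a, g a}"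
proof -
  obtain p q where pq: "C = {p, q}" "p \<noteq> q" "g p = q" "g q = p"
    using C(1) unfolding is_2cycle_def by blast
  have *: "C = {a, g a}" if "C = {p, q}" "p < q" "g p = q" "g q = p" for p q
  proof -
    have "\<alpha> \<le> p" using C(2) that by simp
    have "p < K"
    proof (rule ccontr)
      assume "\<not> p < K"
      then have "g p \<le> K" using g_decreasing_le[of K p] x0_less_K g_K by simp
      then show False using that \<open>\<not> p < K\<close> by simp
    qed
    then have "p = a" using a[of p] \<open>\<alpha> \<le> p\<close> that by simp
    then show ?thesis using that by simp
  qed
  show ?thesis
    using *[of p q] *[of q p] pq by (cases "p < q") (auto simp: insert_commute)
qed

end

section \<open>Entire solutions and compactness\<close>

text \<open>
A finite net of mesh \<open>d\<close> reduces uniform convergence on an interval to convergence at finitely many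
points.
\<close>

lemma equi_lipschitz_uniform_limit:
  fixes z :: "nat \<Rightarrow> real \<Rightarrow> real"
  assumes lip: "\<And>n s t. \<bar>z n s - z n t\<bar> \<le> L * \<bar>s - t\<bar>"
    and lipy: "\<And>s t. \<bar>y s - y t\<bar> \<le> L * \<bar>s - t\<bar>"
    and lim: "\<And>t. (\<lambda>n. z n t) \<longlonglongrightarrow> y t"
  shows "uniform_limit {a..b} z y sequentially"
  unfolding uniform_limit_iff
proof (intro allI impI)
  fix e :: real assume "e > 0"
  have "L \<ge> 0" using lipy[of 0 1] by (simp add: abs_le_iff)
  define d where "d = e / (3 * (L + 1))"
  have d: "d > 0" "L * d \<le> e / 3"
    using \<open>e > 0\<close> \<open>L \<ge> 0\<close> by (auto simp: d_def field_simps)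
  have "{a..b} \<subseteq> (\<Union>c\<in>{a..b}. ball c d)" using d by auto
  then obtain F where F: "finite F" "{a..b} \<subseteq> (\<Union>c\<in>F. ball c d)"
    using compactE_image[OF compact_Icc, of "{a..b}" "\<lambda>c. ball c d" a b] by (metis open_ball)
  have "\<forall>\<^sub>F n in sequentially. \<forall>c\<in>F. dist (z n c) (y c) < e / 3"
    using F(1) tendstoD[OF lim, of "e/3"] \<open>e > 0\<close> by (simp add: eventually_ball_finite)
  then show "\<forall>\<^sub>F n in sequentially. \<forall>t\<in>{a..b}. dist (z n t) (y t) < e"
  proof eventually_elim
    case (elim n)
    show ?case
    proof
      fix t assume "t \<in> {a..b}"
      then obtain c where c: "c \<in> F" "\<bar>c - t\<bar> < d" using F(2) by (force simp: dist_real_def)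
      have "L * \<bar>c - t\<bar> \<le> L * d" using c(2) \<open>L \<ge> 0\<close> by (intro mult_left_mono) auto
      then have "\<bar>z n c - z n t\<bar> \<le> e / 3" "\<bar>y c - y t\<bar> \<le> e / 3"
        using lip[of n c t] lipy[of c t] d(2) by linarith+
      moreover have "\<bar>z n c - y c\<bar> < e / 3" using elim c(1) by (simp add: dist_real_def)
      ultimately show "dist (z n t) (y t) < e" unfolding dist_real_def by linarith
    qed
  qed
qed

text \<open>
The Arzela--Ascoli theorem on the whole line: a diagonal subsequence converges at all rationals,
and the common Lipschitz constant transfers this to the reals.
\<close>

lemma equi_lipschitz_subsequence:
  fixes z :: "nat \<Rightarrow> real \<Rightarrow> real"
  assumes lip: "\<And>n s t. \<bar>z n s - z n t\<bar> \<le> L * \<bar>s - t\<bar>" and bdd: "\<And>n t. \<bar>z n t\<bar> \<le> B"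
  obtains r y where "strict_mono r" "\<And>t. (\<lambda>n. z (r n) t) \<longlonglongrightarrow> y t"
    "\<And>s t. \<bar>y s - y t\<bar> \<le> L * \<bar>s - t\<bar>"
    "\<And>a b. uniform_limit {a..b} (\<lambda>n. z (r n)) y sequentially"
proof -
  obtain r :: "nat \<Rightarrow> nat" where r: "strict_mono r" "\<And>q. q \<in> \<rat> \<Longrightarrow> \<exists>l. (\<lambda>n. z (r n) q) \<longlonglongrightarrow> l"
    using function_convergent_subsequence[OF countable_rat, of z B] bdd by auto
  have "L \<ge> 0" using order_trans[OF abs_ge_zero lip[of 0 0 1]] by simp
  have "Cauchy (\<lambda>n. z (r n) t)" for t
    unfolding Cauchy_def
  proof (intro allI impI)
    fix e :: real assume "e > 0"
    define d where "d = e / (3 * (L + 1))"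
    have d: "d > 0" "L * d \<le> e / 3"
      using \<open>e > 0\<close> \<open>L \<ge> 0\<close> by (auto simp: d_def field_simps)
    obtain q where q: "q \<in> \<rat>" "t < q" "q < t + d" using Rats_dense_in_real[of t "t + d"] d by auto
    have "Cauchy (\<lambda>n. z (r n) q)" using r(2)[OF q(1)] LIMSEQ_imp_Cauchy by blast
    then obtain N where N: "\<And>m n. m \<ge> N \<Longrightarrow> n \<ge> N \<Longrightarrow> dist (z (r m) q) (z (r n) q) < e / 3"
      unfolding Cauchy_def using \<open>e > 0\<close> by (meson divide_pos_pos zero_less_numeral)
    have "L * \<bar>q - t\<bar> \<le> L * d" using q \<open>L \<ge> 0\<close> by (intro mult_left_mono) auto
    then have "\<bar>z n q - z n t\<bar> \<le> e / 3" for n using lip[of n q t] d(2) by linarith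
    note l = this
    have "dist (z (r m) t) (z (r n) t) < e" if "m \<ge> N" "n \<ge> N" for m n
      using N[OF that] l[of "r m"] l[of "r n"] unfolding dist_real_def by linarith
    then show "\<exists>M. \<forall>m\<ge>M. \<forall>n\<ge>M. dist (z (r m) t) (z (r n) t) < e" by blast
  qed
  then have "\<exists>l. (\<lambda>n. z (r n) t) \<longlonglongrightarrow> l" for t
    using Cauchy_convergent convergent_def by blast
  then obtain y where y: "\<And>t. (\<lambda>n. z (r n) t) \<longlonglongrightarrow> y t" by metis
  have lipy: "\<bar>y s - y t\<bar> \<le> L * \<bar>s - t\<bar>" for s t
  proof (rule LIMSEQ_le_const2)
    show "(\<lambda>n. \<bar>z (r n) s - z (r n) t\<bar>) \<longlonglongrightarrow> \<bar>y s - y t\<bar>"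
      by (intro tendsto_intros y)
  qed (use lip in auto)
  show thesis
    by (rule that[OF r(1) y lipy equi_lipschitz_uniform_limit[OF lip lipy y]])
qed

context delay_equation
begin

definition entire_solution :: "(real \<Rightarrow> real) \<Rightarrow> bool" where
  "entire_solution y \<longleftrightarrow> (\<forall>t. (y has_real_derivative (- \<mu> * y t + f (y (t - \<tau>)))) (at t))"

lemma entire_imp_solves_after: "entire_solution y \<Longrightarrow> solves_after T y"
  unfolding entire_solution_def solves_after_def
  using DERIV_isCont continuous_at_imp_continuous_on by blast

lemma entire_solution_shift: "entire_solution y \<Longrightarrow> entire_solution (\<lambda>t. y (t + h))"
  unfolding entire_solution_def
proof
  fix t assume *: "\<forall>t. (y has_real_derivative (- \<mu> * y t + f (y (t - \<tau>)))) (at t)"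
  have "((\<lambda>t. y (t + h)) has_real_derivative (- \<mu> * y (t + h) + f (y (t + h - \<tau>)))) (at t)"
    using *[rule_format, of "t + h"] by (simp add: DERIV_shift)
  then show "((\<lambda>t. y (t + h)) has_real_derivative (- \<mu> * y (t + h) + f (y (t - \<tau> + h)))) (at t)"
    by (simp add: algebra_simps)
qed

text \<open>
The relaxation estimate from time \<open>t - n\<close> to time \<open>t\<close>, with \<open>n \<longlonglongrightarrow> \<infinity>\<close>: the influence of the past
has died out.
\<close>

lemma entire_solution_le:
  assumes y: "entire_solution y" and B: "\<And>t. y t \<le> B" and c: "\<And>t. f (y t) \<le> \<mu> * c"
  shows "y t \<le> c"
proof -
  have "(\<lambda>n. exp (- \<mu> * real n) * (B - c)) \<longlonglongrightarrow> 0" using mu_pos by real_asymp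
  moreover have "y t - c \<le> exp (- \<mu> * real n) * (B - c)" for n
  proof -
    have "y t - c \<le> exp (- \<mu> * (t - (t - real n))) * (y (t - real n) - c)"
      by (rule relax_upper[OF entire_imp_solves_after[OF y, of "t - real n"]]) (use c in auto)
    also have "\<dots> \<le> exp (- \<mu> * (t - (t - real n))) * (B - c)"
      using B by (intro mult_left_mono) auto
    finally show ?thesis by simp
  qed
  ultimately have "y t - c \<le> 0" by (intro LIMSEQ_le_const) auto
  then show ?thesis by simp
qed

lemma entire_solution_ge:
  assumes y: "entire_solution y" and B: "\<And>t. B \<le> y t" and c: "\<And>t. \<mu> * c \<le> f (y t)"
  shows "c \<le> y t"
proof -
  have "(\<lambda>n. exp (- \<mu> * real n) * (B - c)) \<longlonglongrightarrow> 0" using mu_pos by real_asymp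
  moreover have "exp (- \<mu> * real n) * (B - c) \<le> y t - c" for n
  proof -
    have "exp (- \<mu> * (t - (t - real n))) * (B - c) \<le> exp (- \<mu> * (t - (t - real n))) * (y (t - real n) - c)"
      using B by (intro mult_left_mono) auto
    also have "\<dots> \<le> y t - c"
      by (rule relax_lower[OF entire_imp_solves_after[OF y, of "t - real n"]]) (use c in auto)
    finally show ?thesis by simp
  qed
  ultimately have "0 \<le> y t - c" by (intro LIMSEQ_le_const2) auto
  then show ?thesis by simp
qed

lemma solution_lipschitz:
  assumes x: "solves_after T x" and b: "\<And>t. T - \<tau> \<le> t \<Longrightarrow> x t \<in> {0..B}"
    and C: "\<And>y. y \<in> {0..B} \<Longrightarrow> f y \<le> C" and st: "T \<le> s" "T \<le> t"
  shows "\<bar>x s - x t\<bar> \<le> (\<mu> * B + C) * \<bar>s - t\<bar>"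
proof -
  have *: "\<bar>x t - x s\<bar> \<le> (\<mu> * B + C) * (t - s)" if "T \<le> s" "s < t" for s t
  proof -
    have d: "(x has_real_derivative (- \<mu> * x r + f (x (r - \<tau>)))) (at r)" if "s < r" for r
      using x \<open>T \<le> s\<close> that by (auto simp: solves_after_def)
    have "continuous_on {s..t} x"
      by (rule solves_after_continuous_on[OF x]) (use \<open>T \<le> s\<close> tau_pos in auto)
    then obtain l r where r: "s < r" "r < t" "(x has_real_derivative l) (at r)" "x t - x s = (t - s) * l"
      using MVT[OF \<open>s < t\<close>, of x] d by (metis real_differentiable_def)
    then have "l = - \<mu> * x r + f (x (r - \<tau>))" using DERIV_unique d by blast
    moreover have "0 \<le> \<mu> * x r" "\<mu> * x r \<le> \<mu> * B" using b[of r] r that tau_pos mu_pos by auto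
    moreover have "0 \<le> f (x (r - \<tau>))" "f (x (r - \<tau>)) \<le> C"
      using b[of "r - \<tau>"] r that C f_nonneg by auto
    ultimately have "\<bar>l\<bar> \<le> \<mu> * B + C" by simp
    then show ?thesis using r \<open>s < t\<close> by (simp add: abs_mult mult.commute mult_left_mono)
  qed
  show ?thesis using *[of s t] *[of t s] st by (cases s t rule: linorder_cases) (auto simp: abs_minus_commute)
qed

lemma solution_integral:
  assumes x: "solves_after T x" and st: "T \<le> s" "s \<le> t" and nn: "\<And>r. T - \<tau> \<le> r \<Longrightarrow> 0 \<le> x r"
  shows "((\<lambda>r. - \<mu> * x r + f (x (r - \<tau>))) has_integral (x t - x s)) {s..t}"
proof (rule fundamental_theorem_of_calculus_interior)
  show "continuous_on {s..t} x"
    by (rule solves_after_continuous_on[OF x]) (use st tau_pos in auto)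
  fix r assume "r \<in> {s<..<t}"
  then show "(x has_vector_derivative - \<mu> * x r + f (x (r - \<tau>))) (at r)"
    using x st by (auto simp: solves_after_def has_real_derivative_iff_has_vector_derivative)
qed (fact)

text \<open>
The source of all compactness. The solutions are frozen before their starting times \<open>T n\<close>, which
makes them equi-Lipschitz on the whole line. The limit satisfies the integral form of the equation
by dominated convergence, for which pointwise convergence suffices.
\<close>

lemma solutions_converge_to_entire:
  assumes x: "\<And>n. solves_after (T n) (x n)" and T: "filterlim T at_bot sequentially"
    and b: "\<And>n t. T n - \<tau> \<le> t \<Longrightarrow> x n t \<in> {\<delta>..B}" and "0 \<le> \<delta>"
  obtains r y where "strict_mono (r :: nat \<Rightarrow> nat)" "entire_solution y" "\<And>t. y t \<in> {\<delta>..B}"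
    "uniform_limit {-\<tau>..0} (\<lambda>n. x (r n)) y sequentially"
proof -
  have b0: "x n t \<in> {0..B}" if "T n - \<tau> \<le> t" for n t using b[OF that] \<open>0 \<le> \<delta>\<close> by simp
  have "compact (f ` {0..B})"
    by (intro compact_continuous_image continuous_on_subset[OF f_cont]) auto
  then have "bdd_above (f ` {0..B})" by (intro bounded_imp_bdd_above compact_imp_bounded)
  then obtain C where C: "\<And>y. y \<in> {0..B} \<Longrightarrow> f y \<le> C" unfolding bdd_above_def by blast
  have B: "0 \<le> B" using b0[of 0 "T 0"] tau_pos by auto
  have "0 \<le> C" using C[of 0] f_nonneg[of 0] B by auto
  define L where "L = \<mu> * B + C"
  have L: "0 \<le> L" using mu_pos B \<open>0 \<le> C\<close> by (simp add: L_def)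
  define z where "z n t = x n (max (T n) t)" for n t
  have lip: "\<bar>z n s - z n t\<bar> \<le> L * \<bar>s - t\<bar>" for n s t
  proof -
    have "\<bar>z n s - z n t\<bar> \<le> L * \<bar>max (T n) s - max (T n) t\<bar>"
      unfolding z_def L_def by (rule solution_lipschitz[OF x b0 C]) auto
    also have "\<dots> \<le> L * \<bar>s - t\<bar>" using L by (intro mult_left_mono) auto
    finally show ?thesis .
  qed
  have z_bdd: "z n t \<in> {\<delta>..B}" for n t
    unfolding z_def by (rule b) (use tau_pos in auto)
  then have z_abs: "\<bar>z n t\<bar> \<le> B" for n t using \<open>0 \<le> \<delta>\<close> by (metis abs_of_nonneg atLeastAtMost_iff order_trans)
  obtain r y where r: "strict_mono r" and zy: "\<And>t. (\<lambda>n. z (r n) t) \<longlonglongrightarrow> y t"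
    and lipy: "\<And>s t. \<bar>y s - y t\<bar> \<le> L * \<bar>s - t\<bar>"
    and unif: "\<And>a b. uniform_limit {a..b} (\<lambda>n. z (r n)) y sequentially"
    using equi_lipschitz_subsequence[of z L B, OF lip z_abs] by blast
  have early: "\<forall>\<^sub>F n in sequentially. T (r n) \<le> t" for t
  proof -
    have "filterlim (\<lambda>n. T (r n)) at_bot sequentially"
      using filterlim_compose[OF T filterlim_subseq[OF r]] by (simp add: comp_def)
    then show ?thesis by (simp add: filterlim_at_bot)
  qed
  have y_bdd: "y t \<in> {\<delta>..B}" for t
  proof -
    have "closed {\<delta>..B}" by simp
    then show ?thesis by (rule Lim_in_closed_set[OF _ _ _ zy]) (use z_bdd in auto)
  qed
  have y_nonneg: "0 \<le> y t" for t using y_bdd[of t] \<open>0 \<le> \<delta>\<close> by simp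
  have y_cont: "continuous_on S y" for S
  proof (rule continuous_on_subset)
    show "continuous_on UNIV y"
      by (rule lipschitz_on_continuous_on[of L]) (use L lipy in \<open>auto intro!: lipschitz_onI simp: dist_real_def\<close>)
  qed simp
  have rhs_cont: "continuous_on S (\<lambda>r. - \<mu> * y r + f (y (r - \<tau>)))" for S
  proof -
    have "continuous_on S (\<lambda>r. y (r - \<tau>))"
      by (rule continuous_on_compose2[OF y_cont[of UNIV]]) (auto intro!: continuous_intros)
    then have "continuous_on S (\<lambda>r. f (y (r - \<tau>)))"
      by (rule continuous_on_compose2[OF f_cont]) (use y_nonneg in auto)
    then show ?thesis by (intro continuous_intros y_cont)
  qed
  have y_int: "integral {s..t} (\<lambda>r. - \<mu> * y r + f (y (r - \<tau>))) = y t - y s" if "s \<le> t" for s t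
  proof -
    \<comment> \<open>from index \<open>N\<close> on, the freezing does not affect \<open>{s - \<tau>..t}\<close>\<close>
    obtain N where N: "\<And>n. n \<ge> N \<Longrightarrow> T (r n) \<le> s - \<tau>"
      using early[of "s - \<tau>"] by (auto simp: eventually_sequentially)
    define w where "w k = z (r (k + N))" for k
    have wx: "w k t = x (r (k + N)) t" if "s - \<tau> \<le> t" for k t
      using N[of "k + N"] that by (simp add: w_def z_def max_def)
    have hi: "((\<lambda>u. - \<mu> * w k u + f (w k (u - \<tau>))) has_integral (w k t - w k s)) {s..t}" for k
    proof -
      have "((\<lambda>u. - \<mu> * x (r (k + N)) u + f (x (r (k + N)) (u - \<tau>))) has_integral
          (x (r (k + N)) t - x (r (k + N)) s)) {s..t}"
        by (rule solution_integral[OF x]) (use N[of "k + N"] that tau_pos b0 in auto)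
      then have "((\<lambda>u. - \<mu> * w k u + f (w k (u - \<tau>))) has_integral
          (x (r (k + N)) t - x (r (k + N)) s)) {s..t}"
      proof (rule has_integral_eq[rotated])
        fix u assume "u \<in> {s..t}"
        then have "s - \<tau> \<le> u" "s - \<tau> \<le> u - \<tau>" using tau_pos by auto
        then show "- \<mu> * x (r (k + N)) u + f (x (r (k + N)) (u - \<tau>)) = - \<mu> * w k u + f (w k (u - \<tau>))"
          by (simp only: wx)
      qed
      moreover have "s - \<tau> \<le> s" "s - \<tau> \<le> t" using that tau_pos by auto
      ultimately show ?thesis by (simp only: wx)
    qed
    have wy: "(\<lambda>k. w k t) \<longlonglongrightarrow> y t" for t
      unfolding w_def using LIMSEQ_ignore_initial_segment[OF zy] .
    have w_bdd: "w k t \<in> {0..B}" for k t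
      using z_bdd[of "r (k + N)" t] \<open>0 \<le> \<delta>\<close> by (simp add: w_def)
    have "(\<lambda>k. integral {s..t} (\<lambda>u. - \<mu> * w k u + f (w k (u - \<tau>)))) \<longlonglongrightarrow>
       integral {s..t} (\<lambda>r. - \<mu> * y r + f (y (r - \<tau>)))"
    proof (rule dominated_convergence(2)[where h = "\<lambda>_. L"])
      show "(\<lambda>u. - \<mu> * w k u + f (w k (u - \<tau>))) integrable_on {s..t}" for k
        using hi by blast
      show "norm (- \<mu> * w k u + f (w k (u - \<tau>))) \<le> L" for k u
      proof -
        have "0 \<le> \<mu> * w k u" "\<mu> * w k u \<le> \<mu> * B" using w_bdd[of k u] mu_pos by auto
        moreover have "0 \<le> f (w k (u - \<tau>))" "f (w k (u - \<tau>)) \<le> C"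
          using w_bdd[of k "u - \<tau>"] C f_nonneg by auto
        ultimately show ?thesis by (simp add: L_def)
      qed
      show "(\<lambda>k. - \<mu> * w k u + f (w k (u - \<tau>))) \<longlonglongrightarrow> - \<mu> * y u + f (y (u - \<tau>))" for u
      proof (intro tendsto_intros wy)
        show "(\<lambda>k. f (w k (u - \<tau>))) \<longlonglongrightarrow> f (y (u - \<tau>))"
          by (rule continuous_on_tendsto_compose[OF f_cont wy])
             (use y_bdd[of "u - \<tau>"] \<open>0 \<le> \<delta>\<close> w_bdd in \<open>auto\<close>)
      qed
    qed auto
    moreover have "(\<lambda>k. integral {s..t} (\<lambda>u. - \<mu> * w k u + f (w k (u - \<tau>)))) \<longlonglongrightarrow> y t - y s"
      using integral_unique[OF hi] tendsto_diff[OF wy wy] by simp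
    ultimately show ?thesis by (rule LIMSEQ_unique)
  qed
  have "entire_solution y"
    unfolding entire_solution_def
  proof
    fix t
    have "((\<lambda>u. integral {t - 1..u} (\<lambda>r. - \<mu> * y r + f (y (r - \<tau>)))) has_real_derivative
        - \<mu> * y t + f (y (t - \<tau>))) (at t within {t - 1..t + 1})"
      by (rule integral_has_real_derivative[OF rhs_cont]) auto
    then have "((\<lambda>u. y (t - 1) + integral {t - 1..u} (\<lambda>r. - \<mu> * y r + f (y (r - \<tau>)))) has_real_derivative
        - \<mu> * y t + f (y (t - \<tau>))) (at t)"
      by (auto intro!: derivative_eq_intros simp: at_within_Icc_at)
    moreover have ev: "\<forall>\<^sub>F u in nhds t. y (t - 1) + integral {t - 1..u} (\<lambda>r. - \<mu> * y r + f (y (r - \<tau>))) = y u"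
    proof (rule eventually_mono)
      show "\<forall>\<^sub>F u in nhds t. u \<in> {t - 1<..}" by (rule eventually_nhds_in_open) auto
      fix u assume "u \<in> {t - 1<..}"
      then have "t - 1 \<le> u" by simp
      from y_int[OF this] show "y (t - 1) + integral {t - 1..u} (\<lambda>r. - \<mu> * y r + f (y (r - \<tau>))) = y u"
        by linarith
    qed
    ultimately show "(y has_real_derivative - \<mu> * y t + f (y (t - \<tau>))) (at t)"
      by (simp only: DERIV_cong_ev[OF refl ev refl])
  qed
  moreover have "uniform_limit {-\<tau>..0} (\<lambda>n. x (r n)) y sequentially"
  proof (rule uniform_limit_cong[THEN iffD1, OF _ _ unif])
    show "\<forall>\<^sub>F n in sequentially. \<forall>t\<in>{-\<tau>..0}. z (r n) t = x (r n) t"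
      using early[of "-\<tau>"] by eventually_elim (simp add: z_def max_def)
  qed auto
  ultimately show thesis using that r y_bdd by blast
qed

end

section \<open>The global attractor\<close>

text \<open>
Here \<open>b = g a\<close> and \<open>a = g b\<close>, which includes the possibility \<open>a = b = K\<close>. In this way the stable and
the unstable case are treated at once.
\<close>

locale unimodal_delay_equation = delay_equation \<mu> \<tau> f + unimodal_map "\<lambda>x. f x / \<mu>" x0 K
  for \<mu> \<tau> f x0 K +
  fixes a b :: real
  assumes a_bounds: "\<alpha> \<le> a" "a \<le> K"
    and cycle: "f a / \<mu> = b" "f b / \<mu> = a"
    and below_a: "\<And>x. \<alpha> \<le> x \<Longrightarrow> x < a \<Longrightarrow> x < f (f x / \<mu>) / \<mu>"
begin

abbreviation "g \<equiv> \<lambda>x. f x / \<mu>"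

lemma f_ge: "c \<le> g x \<Longrightarrow> \<mu> * c \<le> f x" and f_le: "g x \<le> c \<Longrightarrow> f x \<le> \<mu> * c"
  using mu_pos by (simp_all add: field_simps)

lemma a_b: "x0 < a" "0 < a" "a \<le> b" "K \<le> b" "b \<le> \<beta>"
proof -
  show "x0 < a" "0 < a" using order a_bounds x0_pos by auto
  show "K \<le> b" using g_decreasing_le[of a K] a_bounds order g_K cycle by simp
  then show "a \<le> b" using a_bounds by simp
  show "b \<le> \<beta>" using g_le_beta[of a] cycle \<open>0 < a\<close> by simp
qed

text \<open>
\<open>g\<close> decreases on \<open>{a..b}\<close> and exchanges its endpoints.
\<close>

lemma f_core: "y \<in> {a..b} \<Longrightarrow> f y \<in> {\<mu> * a..\<mu> * b}"
proof -
  assume "y \<in> {a..b}"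
  then have "a \<le> g y" "g y \<le> b"
    using g_decreasing_le[of a y] g_decreasing_le[of y b] a_b cycle by auto
  then show ?thesis using f_ge f_le by auto
qed

lemma entire_solution_in_core:
  assumes y: "entire_solution y" and "0 < \<delta>" and bdd: "\<And>t. y t \<in> {\<delta>..B}"
  shows "y t \<in> {a..b}"
proof -
  define m M where "m = (INF t. y t)" and "M = (SUP t. y t)"
  have below: "bdd_below (range y)" and above: "bdd_above (range y)"
    using bdd by (auto intro!: bdd_belowI2[of _ \<delta>] bdd_aboveI2[of _ _ B])
  have m_le: "m \<le> y t" and le_M: "y t \<le> M" for t
    unfolding m_def M_def using below above by (auto intro: cINF_lower cSUP_upper)
  have "\<delta> \<le> m" unfolding m_def using bdd by (intro cINF_greatest) auto
  then have "0 < m" using \<open>0 < \<delta>\<close> by simp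
  have upper: "M \<le> c" if "\<And>t. g (y t) \<le> c" for c
    unfolding M_def
  proof (rule cSUP_least)
    show "y t \<le> c" for t
    proof (rule entire_solution_le[OF y, of M])
      show "f (y t) \<le> \<mu> * c" for t using f_le that by blast
    qed (rule le_M)
  qed simp
  have lower: "c \<le> m" if "\<And>t. c \<le> g (y t)" for c
    unfolding m_def
  proof (rule cINF_greatest)
    show "c \<le> y t" for t
    proof (rule entire_solution_ge[OF y, of m])
      show "\<mu> * c \<le> f (y t)" for t using f_ge that by blast
    qed (rule m_le)
  qed simp
  have "m \<le> M" using m_le[of 0] le_M[of 0] by simp
  have ypos: "0 \<le> y t" for t using m_le[of t] \<open>0 < m\<close> by simp
  have "M \<le> \<beta>" using g_le_beta ypos by (intro upper) auto
  have "min (g m) (g M) \<le> m"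
    by (rule lower, rule g_min_endpoints) (use \<open>0 < m\<close> m_le le_M in auto)
  moreover have "M \<le> g m" if "x0 \<le> m"
    by (rule upper, rule g_decreasing_le) (use that m_le in auto)
  ultimately have "a \<le> m" "M \<le> b"
    using core_bounds[OF a_bounds cycle(1)[symmetric] cycle(2) below_a \<open>0 < m\<close> \<open>m \<le> M\<close> \<open>M \<le> \<beta>\<close>] by blast+
  then show ?thesis using m_le[of t] le_M[of t] by simp
qed

text \<open>
Nearby initial functions are simultaneously positive on some interval \<open>{u..v}\<close>, which one delay
later pushes all these solutions above a common \<open>\<kappa>\<close>. From then on they lose at most a factor
\<open>exp (- \<mu> * 3 * \<tau>)\<close> until time \<open>2 * \<tau>\<close>. A whole interval of history above a small \<open>\<delta>\<close> is
never left again, because \<open>g \<delta> \<ge> \<delta>\<close> on the left and \<open>g B \<ge> \<delta>\<close> on the right end.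
\<close>

lemma uniform_persistence:
  assumes \<phi>: "\<phi> \<in> mspace (phase_space \<tau>)" and \<Phi>: "\<And>n :: nat. \<Phi> n \<in> mspace (phase_space \<tau>)"
    and lim: "uniform_limit {-\<tau>..0} \<Phi> \<phi> sequentially"
  obtains \<delta> B N where "0 < \<delta>" "\<And>n t. n \<ge> N \<Longrightarrow> \<tau> \<le> t \<Longrightarrow> dde_solution \<mu> f \<tau> (\<Phi> n) t \<in> {\<delta>..B}"
proof -
  have \<phi>_cont: "continuous_on {-\<tau>..0} \<phi>" and \<phi>_nonneg: "\<And>s. s \<in> {-\<tau>..0} \<Longrightarrow> 0 \<le> \<phi> s"
    using \<phi> by (auto simp: mspace_phase_space)
  obtain s0 where s0: "s0 \<in> {-\<tau>..0}" "\<phi> s0 \<noteq> 0" using \<phi> by (auto simp: mspace_phase_space)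
  define \<eta> where "\<eta> = \<phi> s0"
  have "\<eta> > 0" using \<phi>_nonneg[OF s0(1)] s0(2) by (simp add: \<eta>_def)
  have "bdd_above (\<phi> ` {-\<tau>..0})"
    by (intro bounded_imp_bdd_above compact_imp_bounded compact_continuous_image \<phi>_cont) auto
  then obtain B0 where B0: "\<And>s. s \<in> {-\<tau>..0} \<Longrightarrow> \<phi> s \<le> B0" unfolding bdd_above_def by blast
  define B where "B = max \<beta> (B0 + 1)"
  have B: "\<beta> \<le> B" "0 < B" using order x0_pos by (auto simp: B_def)
  obtain d where d: "d > 0" "\<And>s. s \<in> {-\<tau>..0} \<Longrightarrow> dist s s0 < d \<Longrightarrow> dist (\<phi> s) (\<phi> s0) < \<eta>/2"
    using \<phi>_cont s0(1) \<open>\<eta> > 0\<close> unfolding continuous_on_iff by (meson half_gt_zero)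
  obtain u v where uv: "-\<tau> \<le> u" "u < v" "v \<le> 0" "\<And>s. s \<in> {u..v} \<Longrightarrow> \<eta>/2 < \<phi> s"
  proof (cases "s0 < 0")
    case True
    show ?thesis
    proof (rule that[of s0 "min 0 (s0 + d/2)"])
      fix s assume s: "s \<in> {s0..min 0 (s0 + d/2)}"
      then have "dist (\<phi> s) (\<phi> s0) < \<eta>/2" using d s0 by (intro d(2)) (auto simp: dist_real_def)
      then show "\<eta>/2 < \<phi> s" unfolding \<eta>_def dist_real_def by (simp add: abs_if split: if_splits)
    qed (use s0 True d in auto)
  next
    case False
    then have "s0 = 0" using s0 by simp
    show ?thesis
    proof (rule that[of "max (-\<tau>) (-d/2)" 0])
      fix s assume s: "s \<in> {max (-\<tau>) (-d/2)..0}"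
      then have "dist (\<phi> s) (\<phi> s0) < \<eta>/2" using d \<open>s0 = 0\<close> by (intro d(2)) (auto simp: dist_real_def)
      then show "\<eta>/2 < \<phi> s" unfolding \<eta>_def dist_real_def by (simp add: abs_if split: if_splits)
    qed (use d tau_pos in auto)
  qed
  have "0 < min 1 (\<eta>/4)" using \<open>\<eta> > 0\<close> by simp
  then have "\<forall>\<^sub>F n in sequentially. \<forall>s\<in>{-\<tau>..0}. dist (\<Phi> n s) (\<phi> s) < min 1 (\<eta>/4)"
    using lim unfolding uniform_limit_iff by blast
  then obtain N where N: "\<And>n s. n \<ge> N \<Longrightarrow> s \<in> {-\<tau>..0} \<Longrightarrow> dist (\<Phi> n s) (\<phi> s) < min 1 (\<eta>/4)"
    unfolding eventually_sequentially by blast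
  define c where "c = min (g (\<eta>/4)) (g B)"
  have "c > 0" using g_pos[of "\<eta>/4"] g_pos[of B] \<open>\<eta> > 0\<close> B by (simp add: c_def)
  define \<kappa> where "\<kappa> = c * (1 - exp (- \<mu> * (v - u)))"
  have "\<kappa> > 0" using \<open>c > 0\<close> uv mu_pos by (simp add: \<kappa>_def)
  define \<delta>0 where "\<delta>0 = exp (- \<mu> * (3 * \<tau>)) * \<kappa>"
  \<comment> \<open>the minimum with \<open>K\<close> gives \<open>\<delta> \<le> g \<delta>\<close>, the one with \<open>g B\<close> controls the decreasing branch\<close>
  define \<delta> where "\<delta> = min \<delta>0 (min K (g B))"
  have "\<delta>0 > 0" using \<open>\<kappa> > 0\<close> by (simp add: \<delta>0_def)
  then have "\<delta> > 0" using g_pos[of B] B x0_pos x0_less_K by (simp add: \<delta>_def)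
  show thesis
  proof (rule that[OF \<open>\<delta> > 0\<close>])
    fix n t assume n: "n \<ge> N" and t: "\<tau> \<le> t"
    define x where "x = dde_solution \<mu> f \<tau> (\<Phi> n)"
    have x: "solves_after 0 x" and x_init: "\<And>s. s \<in> {-\<tau>..0} \<Longrightarrow> x s = \<Phi> n s"
      using dde_solution_props[OF \<Phi>] by (auto simp: x_def)
    have x_upper: "x t \<in> {0..B}" if "-\<tau> \<le> t" for t
    proof (rule invariant_interval_steps[OF x])
      show "x s \<in> {0..B}" if "s \<in> {0 - \<tau>..0}" for s
      proof -
        have s: "s \<in> {-\<tau>..0}" using that by simp
        have "\<Phi> n s \<le> \<phi> s + 1" using N[OF n s] unfolding dist_real_def by linarith
        moreover have "0 \<le> \<Phi> n s" using \<Phi>[of n] s unfolding mspace_phase_space by blast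
        ultimately show ?thesis using B0[OF s] x_init[OF s] by (simp add: B_def)
      qed
      show "f y \<in> {\<mu> * 0..\<mu> * B}" if "y \<in> {0..B}" for y
      proof -
        have "0 \<le> g y" "g y \<le> B" using that g_nonneg[of y] g_le_beta[of y] B by auto
        then show ?thesis using f_ge[of 0 y] f_le[of y B] by simp
      qed
    qed (use that in auto)
    have "exp (- \<mu> * ((v + \<tau>) - (u + \<tau>))) * (x (u + \<tau>) - c) \<le> x (v + \<tau>) - c"
    proof (rule relax_lower[OF x])
      fix r assume r: "u + \<tau> < r" "r < v + \<tau>"
      then have s: "r - \<tau> \<in> {-\<tau>..0}" "r - \<tau> \<in> {u..v}" using uv by auto
      have "\<eta>/4 \<le> x (r - \<tau>)"
        using N[OF n s(1)] uv(4)[OF s(2)] x_init[OF s(1)] unfolding dist_real_def by linarith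
      then have "c \<le> g (x (r - \<tau>))"
        unfolding c_def using x_upper[of "r - \<tau>"] s \<open>\<eta> > 0\<close> by (intro g_min_endpoints) auto
      then show "\<mu> * c \<le> f (x (r - \<tau>))" by (rule f_ge)
    qed (use uv in auto)
    moreover have "exp (- \<mu> * ((v + \<tau>) - (u + \<tau>))) * (0 - c) \<le> exp (- \<mu> * ((v + \<tau>) - (u + \<tau>))) * (x (u + \<tau>) - c)"
      using x_upper[of "u + \<tau>"] uv tau_pos by (intro mult_left_mono) auto
    ultimately have "\<kappa> \<le> x (v + \<tau>)" by (simp add: \<kappa>_def algebra_simps)
    have x_lower: "\<delta>0 \<le> x t" if t: "t \<in> {\<tau>..2*\<tau>}" for t
    proof -
      have "exp (- \<mu> * (t - (v + \<tau>))) * (x (v + \<tau>) - 0) \<le> x t - 0"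
        by (rule relax_lower[OF x]) (use uv t x_upper tau_pos f_nonneg in auto)
      moreover have "exp (- \<mu> * (3 * \<tau>)) * \<kappa> \<le> exp (- \<mu> * (t - (v + \<tau>))) * x (v + \<tau>)"
      proof (rule mult_mono)
        show "exp (- \<mu> * (3 * \<tau>)) \<le> exp (- \<mu> * (t - (v + \<tau>)))"
          using mu_pos t uv by simp
      qed (use \<open>\<kappa> \<le> x (v + \<tau>)\<close> \<open>\<kappa> > 0\<close> in auto)
      ultimately show ?thesis by (simp add: \<delta>0_def)
    qed
    show "dde_solution \<mu> f \<tau> (\<Phi> n) t \<in> {\<delta>..B}"
      unfolding x_def[symmetric]
    proof (rule invariant_interval_steps[of "2 * \<tau>" x \<delta> B])
      show "solves_after (2 * \<tau>) x" by (rule solves_after_mono[OF x]) (use tau_pos in simp)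
      show "x s \<in> {\<delta>..B}" if "s \<in> {2 * \<tau> - \<tau>..2 * \<tau>}" for s
        using x_lower[of s] x_upper[of s] that tau_pos by (simp add: \<delta>_def)
      show "f y \<in> {\<mu> * \<delta>..\<mu> * B}" if y: "y \<in> {\<delta>..B}" for y
      proof -
        have "\<delta> \<le> K" by (simp add: \<delta>_def)
        then have "\<delta> \<le> g \<delta>" using g_above[of \<delta>] g_K \<open>\<delta> > 0\<close> by (cases "\<delta> = K") auto
        then have "\<delta> \<le> min (g \<delta>) (g B)" by (simp add: \<delta>_def)
        also have "\<dots> \<le> g y" by (rule g_min_endpoints) (use y \<open>\<delta> > 0\<close> in auto)
        finally have "\<delta> \<le> g y" .
        moreover have "g y \<le> B" using g_le_beta[of y] y \<open>\<delta> > 0\<close> B by simp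
        ultimately show ?thesis using f_ge f_le by auto
      qed
    qed (use t in simp)
  qed
qed

definition attractor :: "(real \<Rightarrow> real) set" where
  "attractor = {restrict y {-\<tau>..0} | y. entire_solution y \<and> (\<forall>t. y t \<in> {a..b})}"

lemma restrict_entire_in_phase_space:
  assumes "entire_solution y" "\<And>t. y t \<in> {a..b}"
  shows "restrict y {-\<tau>..0} \<in> mspace (phase_space \<tau>)"
proof -
  have y: "0 < y t" for t using assms(2)[of t] a_b by simp
  have "continuous_on {-\<tau>..0} y"
    using solves_after_continuous_on[OF entire_imp_solves_after[OF assms(1), of 0]] by auto
  then have "continuous_on {-\<tau>..0} (restrict y {-\<tau>..0})"
    by (subst continuous_on_cong[OF refl, where g = y]) auto
  moreover have "0 \<in> {-\<tau>..0}" using tau_pos by simp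
  ultimately show ?thesis
    unfolding mspace_phase_space using y by (auto intro: less_imp_le intro!: bexI[of _ 0] simp: less_imp_neq[symmetric])
qed

lemma attractor_subset: "attractor \<subseteq> mspace (phase_space \<tau>)"
  unfolding attractor_def using restrict_entire_in_phase_space by blast

lemma attractor_bounds: "\<psi> \<in> attractor \<Longrightarrow> s \<in> {-\<tau>..0} \<Longrightarrow> \<psi> s \<in> {a..b}"
  unfolding attractor_def by auto

lemma semiflow_entire:
  assumes "entire_solution y" "\<And>t. y t \<in> {a..b}" "0 \<le> t"
  shows "semiflow \<mu> f \<tau> t (restrict y {-\<tau>..0}) = restrict (\<lambda>s. y (s + t)) {-\<tau>..0}"
  unfolding semiflow_def
proof (rule restrict_ext)
  fix s assume "s \<in> {-\<tau>..0}"
  then show "dde_solution \<mu> f \<tau> (restrict y {-\<tau>..0}) (t + s) = y (s + t)"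
    using dde_solution_eqI[OF entire_imp_solves_after[OF assms(1)] restrict_entire_in_phase_space[OF assms(1,2)], of "t + s"]
      assms(3) by (simp add: add.commute)
qed

lemma attractor_invariant:
  assumes "0 \<le> t"
  shows "semiflow \<mu> f \<tau> t ` attractor = attractor"
proof
  show "semiflow \<mu> f \<tau> t ` attractor \<subseteq> attractor"
  proof
    fix \<psi> assume "\<psi> \<in> semiflow \<mu> f \<tau> t ` attractor"
    then obtain y where y: "entire_solution y" "\<And>t. y t \<in> {a..b}" "\<psi> = semiflow \<mu> f \<tau> t (restrict y {-\<tau>..0})"
      unfolding attractor_def by blast
    then show "\<psi> \<in> attractor"
      unfolding attractor_def using semiflow_entire[OF y(1,2) assms] entire_solution_shift[OF y(1), of t] by blast
  qed
  show "attractor \<subseteq> semiflow \<mu> f \<tau> t ` attractor"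
  proof
    fix \<psi> assume "\<psi> \<in> attractor"
    then obtain y where y: "entire_solution y" "\<And>t. y t \<in> {a..b}" "\<psi> = restrict y {-\<tau>..0}"
      unfolding attractor_def by blast
    define w where "w s = y (s - t)" for s
    have w: "entire_solution w" "\<And>t. w t \<in> {a..b}"
      using entire_solution_shift[OF y(1), of "- t"] y(2) by (auto simp: w_def[abs_def])
    have "semiflow \<mu> f \<tau> t (restrict w {-\<tau>..0}) = \<psi>"
      unfolding semiflow_entire[OF w assms] y(3) by (simp add: w_def)
    moreover have "restrict w {-\<tau>..0} \<in> attractor" unfolding attractor_def using w by blast
    ultimately show "\<psi> \<in> semiflow \<mu> f \<tau> t ` attractor" by blast
  qed
qed

lemma uniform_limit_restrict:
  "uniform_limit S (\<lambda>n. restrict (x n) S) (restrict y S) F \<longleftrightarrow> uniform_limit S x y F"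
  by (rule uniform_limit_cong') auto

lemma attractor_compact: "compactin (mtopology_of (phase_space \<tau>)) attractor"
proof -
  show ?thesis
    unfolding compactin_mtopology_of_sequentially
  proof (intro conjI allI impI attractor_subset)
    fix \<sigma> :: "nat \<Rightarrow> real \<Rightarrow> real" assume \<sigma>: "range \<sigma> \<subseteq> attractor"
    then have "\<forall>n. \<exists>y. entire_solution y \<and> (\<forall>t. y t \<in> {a..b}) \<and> \<sigma> n = restrict y {-\<tau>..0}"
      unfolding attractor_def by blast
    then obtain Y where Y: "\<And>n. entire_solution (Y n)" "\<And>n t. Y n t \<in> {a..b}" "\<And>n. \<sigma> n = restrict (Y n) {-\<tau>..0}"
      by metis
    have "filterlim (\<lambda>n. - real n) at_bot sequentially" by real_asymp
    then obtain r y where ry: "strict_mono (r :: nat \<Rightarrow> nat)" "entire_solution y" "\<And>t. y t \<in> {a..b}"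
      "uniform_limit {-\<tau>..0} (\<lambda>n. Y (r n)) y sequentially"
      using solutions_converge_to_entire[of "\<lambda>n. - real n" Y a b] entire_imp_solves_after[OF Y(1)] Y(2) a_b
      by (metis less_imp_le)
    have "restrict y {-\<tau>..0} \<in> attractor" unfolding attractor_def using ry by blast
    moreover have "range (\<sigma> \<circ> r) \<subseteq> mspace (phase_space \<tau>)" using \<sigma> attractor_subset by auto
    moreover have "uniform_limit {-\<tau>..0} (\<sigma> \<circ> r) (restrict y {-\<tau>..0}) sequentially"
      using ry(4) by (simp add: comp_def Y(3) uniform_limit_restrict)
    ultimately show "\<exists>l r. l \<in> attractor \<and> strict_mono r \<and>
        limitin (mtopology_of (phase_space \<tau>)) (\<sigma> \<circ> r) l sequentially"
      using ry(1) limitin_phase_space attractor_subset by blast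
  qed
qed

text \<open>
Otherwise there are initial functions in \<open>C\<close> whose states at times \<open>t n \<ge> n\<close> keep a distance \<open>e\<close>
from the attractor. Along a subsequence the initial functions converge, so persistence applies, and
the solutions translated by \<open>t n\<close> converge to an entire solution. Its state at time 0 belongs to
the attractor, a contradiction.
\<close>

lemma attractor_attracts:
  assumes C: "compactin (mtopology_of (phase_space \<tau>)) C"
  shows "attracts \<mu> f \<tau> attractor C"
proof (rule ccontr)
  assume "\<not> ?thesis"
  then obtain e where "e > 0" and e: "\<And>t0. 0 \<le> t0 \<Longrightarrow> \<exists>t\<ge>t0. \<exists>\<phi>\<in>C. \<forall>\<psi>\<in>attractor.
      e \<le> mdist (phase_space \<tau>) (semiflow \<mu> f \<tau> t \<phi>) \<psi>"
    unfolding attracts_def by (meson not_le)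
  then have "\<forall>n::nat. \<exists>t \<phi>. real n \<le> t \<and> \<phi> \<in> C \<and> (\<forall>\<psi>\<in>attractor. e \<le> mdist (phase_space \<tau>) (semiflow \<mu> f \<tau> t \<phi>) \<psi>)"
    by (meson of_nat_0_le_iff)
  then obtain t \<Phi> where t: "\<And>n::nat. real n \<le> t n" and \<Phi>: "\<And>n. \<Phi> n \<in> C"
    and far: "\<And>n \<psi>. \<psi> \<in> attractor \<Longrightarrow> e \<le> mdist (phase_space \<tau>) (semiflow \<mu> f \<tau> (t n) (\<Phi> n)) \<psi>"
    by metis
  have CX: "C \<subseteq> mspace (phase_space \<tau>)"
    using C compactin_subset_topspace by fastforce
  obtain \<phi> r where \<phi>: "\<phi> \<in> C" and r: "strict_mono (r :: nat \<Rightarrow> nat)"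
    and lim: "limitin (mtopology_of (phase_space \<tau>)) (\<Phi> \<circ> r) \<phi> sequentially"
    using C \<Phi> unfolding compactin_mtopology_of_sequentially by (metis image_subsetI)
  have X: "\<phi> \<in> mspace (phase_space \<tau>)" "(\<Phi> \<circ> r) n \<in> mspace (phase_space \<tau>)" for n
    using \<phi> \<Phi> CX by auto
  then have "uniform_limit {-\<tau>..0} (\<Phi> \<circ> r) \<phi> sequentially"
    using limitin_phase_space[of \<phi> \<tau> "\<Phi> \<circ> r"] lim by blast
  from uniform_persistence[OF X this] obtain \<delta> B N where \<delta>: "0 < \<delta>"
    and pers: "\<And>n s. n \<ge> N \<Longrightarrow> \<tau> \<le> s \<Longrightarrow> dde_solution \<mu> f \<tau> ((\<Phi> \<circ> r) n) s \<in> {\<delta>..B}"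
    by metis
  define k where "k n = r (n + N)" for n
  define x where "x n s = dde_solution \<mu> f \<tau> (\<Phi> (k n)) (s + t (k n))" for n s
  have k_ge: "n \<le> k n" for n
    using seq_suble[OF r, of "n + N"] by (simp add: k_def)
  have T: "filterlim (\<lambda>n. 2 * \<tau> - t (k n)) at_bot sequentially"
  proof (rule filterlim_at_bot_mono)
    show "filterlim (\<lambda>n. 2 * \<tau> - real n) at_bot sequentially" by real_asymp
    show "\<forall>\<^sub>F n in sequentially. 2 * \<tau> - t (k n) \<le> 2 * \<tau> - real n"
    proof (intro always_eventually allI)
      fix n
      have "real n \<le> real (k n)" using k_ge by simp
      then show "2 * \<tau> - t (k n) \<le> 2 * \<tau> - real n" using t[of "k n"] by simp
    qed
  qed
  have "solves_after (2 * \<tau> - t (k n)) (x n)" for n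
    unfolding x_def[abs_def]
  proof (rule solves_after_shift)
    have "solves_after 0 (dde_solution \<mu> f \<tau> (\<Phi> (k n)))"
      by (rule dde_solution_props) (use \<Phi> CX in blast)
    then show "solves_after (2 * \<tau>) (dde_solution \<mu> f \<tau> (\<Phi> (k n)))"
      by (rule solves_after_mono) (use tau_pos in simp)
  qed
  moreover have "x n s \<in> {\<delta>..B}" if "2 * \<tau> - t (k n) - \<tau> \<le> s" for n s
    using pers[of "n + N" "s + t (k n)"] that by (simp add: x_def k_def)
  ultimately obtain q y where q: "strict_mono (q :: nat \<Rightarrow> nat)" and y: "entire_solution y" "\<And>t. y t \<in> {\<delta>..B}"
    and unif: "uniform_limit {-\<tau>..0} (\<lambda>n. x (q n)) y sequentially"
    using solutions_converge_to_entire[of "\<lambda>n. 2 * \<tau> - t (k n)" x \<delta> B] T \<delta> by (metis less_imp_le)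
  have "y t \<in> {a..b}" for t using entire_solution_in_core[OF y(1) \<delta> y(2)] .
  then have A: "restrict y {-\<tau>..0} \<in> attractor" unfolding attractor_def using y by blast
  obtain n where n: "\<And>s. s \<in> {-\<tau>..0} \<Longrightarrow> dist (x (q n) s) (y s) < e / 2"
    using unif \<open>e > 0\<close> unfolding uniform_limit_iff eventually_sequentially by (meson half_gt_zero order_refl)
  have "mdist (phase_space \<tau>) (semiflow \<mu> f \<tau> (t (k (q n))) (\<Phi> (k (q n)))) (restrict y {-\<tau>..0}) \<le> e / 2"
    by (rule mdist_phase_space_le)
       (use n \<open>e > 0\<close> in \<open>auto simp: semiflow_def x_def dist_real_def add.commute intro: less_imp_le\<close>)
  then show False using far[OF A, of "k (q n)"] \<open>e > 0\<close> by simp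
qed

lemma attractor_is_global_attractor: "is_global_attractor \<mu> f \<tau> attractor"
  unfolding is_global_attractor_def
  using attractor_compact attractor_invariant attractor_attracts by blast

lemma core_contains_global_attractor: "contains_global_attractor \<mu> f \<tau> a b"
  unfolding contains_global_attractor_def
  using attractor_is_global_attractor attractor_bounds by (metis atLeastAtMost_iff)

lemma core_invariant: "invariant_interval \<mu> f \<tau> a b"
  unfolding invariant_interval_def
proof (intro ballI impI allI)
  fix \<phi> t assume \<phi>: "\<phi> \<in> mspace (phase_space \<tau>)" "\<phi> ` {-\<tau>..0} \<subseteq> {a..b}" and "0 \<le> (t :: real)"
  show "dde_solution \<mu> f \<tau> \<phi> t \<in> {a..b}"
    by (rule invariant_interval_steps[OF dde_solution_props(1)[OF \<phi>(1)] _ f_core])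
       (use \<phi> dde_solution_props(2)[OF \<phi>(1)] \<open>0 \<le> t\<close> tau_pos in \<open>auto simp: image_subset_iff\<close>)
qed

lemma core_attracting: "attracting_interval \<mu> f \<tau> a b"
  unfolding attracting_interval_def
proof (intro ballI)
  fix \<phi> assume \<phi>: "\<phi> \<in> mspace (phase_space \<tau>)"
  have ev: "\<forall>\<^sub>F t in at_top. dde_solution \<mu> f \<tau> \<phi> t \<in> {a - e..b + e}" if "e > 0" for e
  proof -
    have "compactin (mtopology_of (phase_space \<tau>)) {\<phi>}" using \<phi> by simp
    then have "attracts \<mu> f \<tau> attractor {\<phi>}" by (rule attractor_attracts)
    then obtain t0 where t0: "t0 \<ge> 0" "\<And>t. t \<ge> t0 \<Longrightarrow> \<exists>\<psi>\<in>attractor. mdist (phase_space \<tau>) (semiflow \<mu> f \<tau> t \<phi>) \<psi> < e"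
      unfolding attracts_def using \<open>e > 0\<close> by auto
    show ?thesis
      unfolding eventually_at_top_linorder
    proof (intro exI allI impI)
      fix t assume "t \<ge> t0"
      then obtain \<psi> where \<psi>: "\<psi> \<in> attractor" "mdist (phase_space \<tau>) (semiflow \<mu> f \<tau> t \<phi>) \<psi> < e"
        using t0 by blast
      have "\<bar>dde_solution \<mu> f \<tau> \<phi> t - \<psi> 0\<bar> < e"
        by (rule near_point_of_semiflow[OF \<phi> _ _ \<psi>(2)]) (use \<psi> attractor_subset t0 \<open>t \<ge> t0\<close> in auto)
      then show "dde_solution \<mu> f \<tau> \<phi> t \<in> {a - e..b + e}"
        using attractor_bounds[OF \<psi>(1), of 0] tau_pos by auto
    qed
  qed
  show "ereal a \<le> Liminf at_top (\<lambda>t. ereal (dde_solution \<mu> f \<tau> \<phi> t)) \<and>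
        Limsup at_top (\<lambda>t. ereal (dde_solution \<mu> f \<tau> \<phi> t)) \<le> ereal b"
  proof
    show "ereal a \<le> Liminf at_top (\<lambda>t. ereal (dde_solution \<mu> f \<tau> \<phi> t))"
    proof (rule ereal_le_epsilon2)
      fix e :: real assume "e > 0"
      have "ereal (a - e) \<le> Liminf at_top (\<lambda>t. ereal (dde_solution \<mu> f \<tau> \<phi> t))"
        by (rule Liminf_bounded) (use ev[OF \<open>e > 0\<close>] in \<open>auto elim: eventually_mono\<close>)
      then show "ereal a \<le> Liminf at_top (\<lambda>t. ereal (dde_solution \<mu> f \<tau> \<phi> t)) + ereal e"
        by (cases "Liminf at_top (\<lambda>t. ereal (dde_solution \<mu> f \<tau> \<phi> t))") auto
    qed
    show "Limsup at_top (\<lambda>t. ereal (dde_solution \<mu> f \<tau> \<phi> t)) \<le> ereal b"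
    proof (rule ereal_le_epsilon2)
      fix e :: real assume "e > 0"
      have "Limsup at_top (\<lambda>t. ereal (dde_solution \<mu> f \<tau> \<phi> t)) \<le> ereal (b + e)"
        by (rule Limsup_bounded) (use ev[OF \<open>e > 0\<close>] in \<open>auto elim: eventually_mono\<close>)
      then show "Limsup at_top (\<lambda>t. ereal (dde_solution \<mu> f \<tau> \<phi> t)) \<le> ereal b + ereal e" by simp
    qed
  qed
qed

lemma constant_attractor:
  assumes "a = K"
  shows "is_global_attractor \<mu> f \<tau> {restrict (\<lambda>s. K) {-\<tau>..0}}"
proof -
  have "b = K" using cycle(1) g_K assms by simp
  have "entire_solution (\<lambda>t. K)"
    unfolding entire_solution_def using g_K mu_pos by (auto simp: field_simps)
  moreover have "y = (\<lambda>t. K)" if "\<forall>t. y t \<in> {a..b}" for y :: "real \<Rightarrow> real"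
    using that assms \<open>b = K\<close> by (intro ext) (metis atLeastAtMost_iff order_antisym)
  ultimately have "attractor = {restrict (\<lambda>s. K) {-\<tau>..0}}"
    unfolding attractor_def using assms \<open>b = K\<close> by auto
  then show ?thesis using attractor_is_global_attractor by simp
qed

end

section \<open>Instability of the equilibrium for large delays\<close>

text \<open>
The conclusion says that \<open>\<rho> + i \<omega>\<close> is a root of the characteristic equation
\<open>z + \<mu> + b * exp (- z * \<tau>) = 0\<close> of the linearisation \<open>y' = - \<mu> y - b y (t - \<tau>)\<close>, written for the real
solution \<open>exp (\<rho> * t) * cos (\<omega> * t)\<close>, and that \<open>2 * \<rho>\<close> exceeds the real root \<open>s\<close> of
\<open>s + \<mu> = b * exp (- s * \<tau>)\<close>, which bounds the growth of all solutions of the linearisation.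
The root is parametrised by \<open>\<theta> = pi - \<omega> * \<tau>\<close>. Comparing arguments gives \<open>\<omega> = (\<mu> + \<rho>) * tan \<theta>\<close> and so
determines \<open>\<tau>\<close>; comparing moduli leaves the single equation \<open>F \<rho> = b\<close>, which the intermediate value
theorem solves. The second requirement reads \<open>(\<mu> + \<rho>)\<^sup>2 < b * (cos \<theta>)\<^sup>2 * (\<mu> + 2 * \<rho>)\<close>.
\<close>

lemma oscillatory_characteristic_root:
  fixes \<mu> b :: real
  assumes "0 < \<mu>" "\<mu> < b"
  obtains \<rho> \<tau> \<omega> where "0 < \<rho>" "0 < \<tau>" "b * exp (- 2 * \<rho> * \<tau>) < \<mu> + 2 * \<rho>"
    "\<forall>t. \<rho> * cos (\<omega> * t) - \<omega> * sin (\<omega> * t) = - \<mu> * cos (\<omega> * t) - b * exp (- \<rho> * \<tau>) * cos (\<omega> * (t - \<tau>))"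
proof -
  \<comment> \<open>\<open>c = cos \<theta>\<close> is chosen so that \<open>b * c\<^sup>2\<close> is the midpoint of \<open>\<mu>\<close> and \<open>b\<close>\<close>
  define c where "c = sqrt ((b + \<mu>) / (2 * b))"
  have c2: "b * c\<^sup>2 = (b + \<mu>) / 2" using assms by (simp add: c_def)
  have "0 < c" "c < 1" using assms by (auto simp: c_def)
  define \<theta> where "\<theta> = arccos c"
  have \<theta>: "0 < \<theta>" "\<theta> < pi" "cos \<theta> = c"
    using arccos_lt_bounded[of c] \<open>0 < c\<close> \<open>c < 1\<close> by (auto simp: \<theta>_def cos_arccos)
  have "0 < sin \<theta>" using \<theta> by (simp add: sin_gt_zero)
  have "0 < tan \<theta>" using \<open>0 < sin \<theta>\<close> \<open>0 < c\<close> \<theta>(3) by (simp add: tan_def)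
  define F where "F l = (\<mu> + l) / c * exp ((pi - \<theta>) * l / ((\<mu> + l) * tan \<theta>))" for l
  have "continuous_on {0..b - \<mu>} F"
    unfolding F_def using assms \<open>0 < c\<close> \<open>0 < tan \<theta>\<close> by (intro continuous_intros) auto
  moreover have "F 0 < b"
  proof -
    have "\<mu> < b * c\<^sup>2" using c2 assms by simp
    also have "\<dots> \<le> b * c" using \<open>0 < c\<close> \<open>c < 1\<close> assms by (simp add: power2_eq_square)
    finally show ?thesis using \<open>0 < c\<close> by (simp add: F_def field_simps)
  qed
  moreover have "b \<le> F (b - \<mu>)"
  proof -
    have "b * 1 \<le> b / c * exp ((pi - \<theta>) * (b - \<mu>) / ((\<mu> + (b - \<mu>)) * tan \<theta>))"
    proof (rule mult_mono)
      show "b \<le> b / c" using \<open>0 < c\<close> \<open>c < 1\<close> assms by (simp add: field_simps)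
      show "1 \<le> exp ((pi - \<theta>) * (b - \<mu>) / ((\<mu> + (b - \<mu>)) * tan \<theta>))"
        using \<theta> assms \<open>0 < tan \<theta>\<close> by simp
    qed (use assms \<open>0 < c\<close> in auto)
    then show ?thesis by (simp add: F_def)
  qed
  ultimately obtain \<rho> where \<rho>: "0 \<le> \<rho>" "\<rho> \<le> b - \<mu>" "F \<rho> = b"
    using IVT'[of F 0 b "b - \<mu>"] assms by auto
  have "\<rho> \<noteq> 0" using \<rho>(3) \<open>F 0 < b\<close> by auto
  then have "0 < \<rho>" using \<rho> by simp
  define \<omega> where "\<omega> = (\<mu> + \<rho>) * tan \<theta>"
  define \<tau> where "\<tau> = (pi - \<theta>) / \<omega>"
  have "0 < \<omega>" using assms \<open>0 < \<rho>\<close> \<open>0 < tan \<theta>\<close> by (simp add: \<omega>_def)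
  then have "0 < \<tau>" using \<theta> by (simp add: \<tau>_def)
  have exp1: "b * exp (- \<rho> * \<tau>) = (\<mu> + \<rho>) / c"
  proof -
    have "b = (\<mu> + \<rho>) / c * exp (\<rho> * \<tau>)"
      using \<rho>(3) by (simp add: F_def \<tau>_def \<omega>_def mult.commute)
    then have "b * exp (- \<rho> * \<tau>) = (\<mu> + \<rho>) / c * (exp (\<rho> * \<tau>) * exp (- \<rho> * \<tau>))"
      by (metis mult.assoc)
    then show ?thesis by (simp add: exp_add[symmetric])
  qed
  show thesis
  proof (rule that[of \<rho> \<tau> \<omega>])
    show "0 < \<rho>" "0 < \<tau>" by fact+
    show "b * exp (- 2 * \<rho> * \<tau>) < \<mu> + 2 * \<rho>"
    proof -
      have "b * (b * exp (- 2 * \<rho> * \<tau>)) * c\<^sup>2 = (b * exp (- \<rho> * \<tau>))\<^sup>2 * c\<^sup>2"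
        by (simp add: power2_eq_square exp_add[symmetric] algebra_simps)
      also have "\<dots> = (\<mu> + \<rho>)\<^sup>2" unfolding exp1 using \<open>0 < c\<close> by (simp add: power_divide)
      also have "\<dots> < (\<mu> + \<rho> / 2) * (\<mu> + 2 * \<rho>)"
        using assms \<open>0 < \<rho>\<close> by (simp add: power2_eq_square algebra_simps)
      also have "\<dots> \<le> (b * c\<^sup>2) * (\<mu> + 2 * \<rho>)"
        unfolding c2 using \<rho> assms by (intro mult_right_mono) auto
      finally have "(b * c\<^sup>2) * (b * exp (- 2 * \<rho> * \<tau>)) < (b * c\<^sup>2) * (\<mu> + 2 * \<rho>)"
        by (simp add: mult_ac)
      moreover have "0 < b * c\<^sup>2" using assms \<open>0 < c\<close> by simp
      ultimately show ?thesis using mult_less_cancel_left_pos by blast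
    qed
    show "\<forall>t. \<rho> * cos (\<omega> * t) - \<omega> * sin (\<omega> * t) =
        - \<mu> * cos (\<omega> * t) - b * exp (- \<rho> * \<tau>) * cos (\<omega> * (t - \<tau>))"
    proof
      fix t
      have "\<omega> * (t - \<tau>) = (\<omega> * t + \<theta>) - pi" using \<open>0 < \<omega>\<close> by (simp add: \<tau>_def field_simps)
      then have "cos (\<omega> * (t - \<tau>)) = - cos (\<omega> * t + \<theta>)" by simp
      also have "\<dots> = - (cos (\<omega> * t) * c - sin (\<omega> * t) * sin \<theta>)" using \<theta>(3) by (simp add: cos_add)
      finally have shift: "cos (\<omega> * (t - \<tau>)) = - (cos (\<omega> * t) * c - sin (\<omega> * t) * sin \<theta>)" .
      have "(\<mu> + \<rho>) / c * (X * c - Y * sin \<theta>) = (\<mu> + \<rho>) * X - \<omega> * Y" for X Y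
        unfolding \<omega>_def using \<open>0 < c\<close> \<theta>(3) by (simp add: tan_def field_simps)
      from this[of "cos (\<omega> * t)" "sin (\<omega> * t)"]
      show "\<rho> * cos (\<omega> * t) - \<omega> * sin (\<omega> * t) =
          - \<mu> * cos (\<omega> * t) - b * exp (- \<rho> * \<tau>) * cos (\<omega> * (t - \<tau>))"
        unfolding exp1 shift by (simp add: algebra_simps)
    qed
  qed
qed

text \<open>
Differentiability of \<open>f'\<close> at the single point \<open>K\<close> makes \<open>f'\<close> Lipschitz at \<open>K\<close>, and the mean value
theorem turns this into a quadratic bound for \<open>f\<close>.
\<close>

lemma quadratic_remainder:
  fixes f f1 :: "real \<Rightarrow> real"
  assumes f1: "\<And>x. x \<in> {p<..<q} \<Longrightarrow> (f has_real_derivative f1 x) (at x)"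
    and f2: "(f1 has_real_derivative l) (at K)" and K: "p < K" "K < q"
  obtains R r where "0 < R" "0 < r" "\<And>y. \<bar>y\<bar> \<le> r \<Longrightarrow> \<bar>f (K + y) - f K - f1 K * y\<bar> \<le> R * y\<^sup>2"
proof -
  have "((\<lambda>h. (f1 (K + h) - f1 K) / h) \<longlongrightarrow> l) (at 0)" using f2 by (simp add: DERIV_def)
  then have "\<forall>\<^sub>F h in at 0. dist ((f1 (K + h) - f1 K) / h) l < 1" by (rule tendstoD) simp
  then obtain d where d: "d > 0" "\<And>h. h \<noteq> 0 \<Longrightarrow> \<bar>h\<bar> < d \<Longrightarrow> \<bar>(f1 (K + h) - f1 K) / h - l\<bar> < 1"
    by (auto simp: eventually_at dist_real_def)
  define R where "R = \<bar>l\<bar> + 1"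
  define r where "r = min (d / 2) (min ((K - p) / 2) ((q - K) / 2))"
  have r: "0 < r" "r < d" "r < K - p" "r < q - K" using d K by (auto simp: r_def min_def field_simps)
  have slope: "\<bar>f1 (K + h) - f1 K\<bar> \<le> R * \<bar>h\<bar>" if "\<bar>h\<bar> \<le> r" for h
  proof (cases "h = 0")
    case False
    then have "\<bar>(f1 (K + h) - f1 K) / h\<bar> \<le> R" using d(2)[of h] that r by (simp add: R_def)
    then show ?thesis using False by (simp add: abs_divide field_simps)
  qed simp
  show thesis
  proof (rule that[of R r])
    show "0 < R" "0 < r" using r by (auto simp: R_def)
    fix y :: real assume y: "\<bar>y\<bar> \<le> r"
    have "\<exists>h. \<bar>h\<bar> \<le> \<bar>y\<bar> \<and> f (K + y) - f K = y * f1 (K + h)"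
    proof (cases y "0 :: real" rule: linorder_cases)
      case less
      obtain z where "K + y < z" "z < K" "f K - f (K + y) = (K - (K + y)) * f1 z"
        using MVT2[of "K + y" K f f1] f1 less y r K by force
      then show ?thesis by (intro exI[of _ "z - K"]) auto
    next
      case greater
      obtain z where "K < z" "z < K + y" "f (K + y) - f K = (K + y - K) * f1 z"
        using MVT2[of K "K + y" f f1] f1 greater y r K by force
      then show ?thesis by (intro exI[of _ "z - K"]) auto
    qed auto
    then obtain h where h: "\<bar>h\<bar> \<le> \<bar>y\<bar>" "f (K + y) - f K = y * f1 (K + h)" by blast
    have "\<bar>f (K + y) - f K - f1 K * y\<bar> = \<bar>y\<bar> * \<bar>f1 (K + h) - f1 K\<bar>"
      unfolding h(2) by (simp add: abs_mult[symmetric] algebra_simps)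
    also have "\<dots> \<le> \<bar>y\<bar> * (R * \<bar>y\<bar>)"
    proof (intro mult_left_mono)
      have "\<bar>f1 (K + h) - f1 K\<bar> \<le> R * \<bar>h\<bar>" using slope[of h] h y by simp
      also have "\<dots> \<le> R * \<bar>y\<bar>" using h by (intro mult_left_mono) (auto simp: R_def)
      finally show "\<bar>f1 (K + h) - f1 K\<bar> \<le> R * \<bar>y\<bar>" .
    qed simp
    also have "\<dots> = R * y\<^sup>2" by (simp add: power2_eq_square[of y] abs_mult_self_eq mult_ac)
    finally show "\<bar>f (K + y) - f K - f1 K * y\<bar> \<le> R * y\<^sup>2" .
  qed
qed

text \<open>
The difference of \<open>x\<close> and \<open>K + p\<close>, where \<open>p\<close> is the growing oscillation, satisfies the linearised
equation with a forcing quadratic in \<open>x - K\<close>, hence of order \<open>\<epsilon>\<^sup>2 * exp (2 * \<rho> * (t - T))\<close>. As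
\<open>2 * \<rho>\<close> lies above the growth rates of the linearisation, a constant multiple \<open>v\<close> of
\<open>exp (2 * \<rho> * (t - T))\<close> is a supersolution, which is the meaning of the inequality between \<open>D\<close> and
\<open>\<epsilon>\<close>. The normalisation at the final time \<open>T\<close> gives a bound independent of the starting time \<open>T0\<close>.
\<close>

lemma (in delay_equation) growing_oscillation_tracked:
  assumes root: "0 < \<rho>" "\<And>t. \<rho> * cos (\<omega> * t) - \<omega> * sin (\<omega> * t) = - \<mu> * cos (\<omega> * t) - b * exp (- \<rho> * \<tau>) * cos (\<omega> * (t - \<tau>))"
    and "0 < b"
    and fix_K: "f K = \<mu> * K"
    and rem: "\<And>y. \<bar>y\<bar> \<le> r \<Longrightarrow> \<bar>f (K + y) - f K + b * y\<bar> \<le> R * y\<^sup>2" and "0 < R"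
    and eps: "0 < \<epsilon>" "2 * \<epsilon> \<le> r" and D: "0 < D" "D \<le> \<epsilon>"
    and gap: "(b * D + 4 * R * \<epsilon>\<^sup>2) * exp (- 2 * \<rho> * \<tau>) \<le> (\<mu> + 2 * \<rho>) * D"
    and x: "solves_after T0 x" and "T0 \<le> T"
    and init: "\<And>s. s \<in> {T0 - \<tau>..T0} \<Longrightarrow> x s = K + \<epsilon> * exp (\<rho> * (s - T)) * cos (\<omega> * (s - T))"
    and t: "T0 - \<tau> \<le> t" "t \<le> T"
  shows "\<bar>x t - K - \<epsilon> * exp (\<rho> * (t - T)) * cos (\<omega> * (t - T))\<bar> \<le> D * exp (2 * \<rho> * (t - T))"
proof -
  define p where "p t = \<epsilon> * exp (\<rho> * (t - T)) * cos (\<omega> * (t - T))" for t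
  define v where "v t = D * exp (2 * \<rho> * (t - T))" for t
  have p_deriv: "(p has_real_derivative (- \<mu> * p t - b * p (t - \<tau>))) (at t)" for t
  proof -
    have "(p has_real_derivative \<epsilon> * exp (\<rho> * (t - T)) * (\<rho> * cos (\<omega> * (t - T)) - \<omega> * sin (\<omega> * (t - T)))) (at t)"
      unfolding p_def[abs_def] by (auto intro!: derivative_eq_intros simp: algebra_simps)
    moreover have "\<epsilon> * exp (\<rho> * (t - T)) * (\<rho> * cos (\<omega> * (t - T)) - \<omega> * sin (\<omega> * (t - T)))
        = - \<mu> * p t - b * p (t - \<tau>)"
    proof -
      have "exp (\<rho> * (t - \<tau> - T)) = exp (\<rho> * (t - T)) * exp (- \<rho> * \<tau>)"
        by (simp add: exp_add[symmetric] algebra_simps)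
      moreover have "t - \<tau> - T = t - T - \<tau>" by simp
      ultimately show ?thesis unfolding root(2) p_def by (simp add: algebra_simps)
    qed
    ultimately show ?thesis by simp
  qed
  have v_deriv: "(v has_real_derivative 2 * \<rho> * v t) (at t)" for t
    unfolding v_def[abs_def] by (auto intro!: derivative_eq_intros)
  have v_pos: "0 < v t" for t using D by (simp add: v_def)
  have "t \<le> T \<longrightarrow> \<bar>x t - K - p t\<bar> \<le> v t"
  proof (rule method_of_steps[of \<tau> T0 "\<lambda>t. t \<le> T \<longrightarrow> \<bar>x t - K - p t\<bar> \<le> v t"])
    fix t assume t: "T0 < t" and IH: "\<And>r. T0 - \<tau> \<le> r \<Longrightarrow> r \<le> t - \<tau> \<Longrightarrow> r \<le> T \<longrightarrow> \<bar>x r - K - p r\<bar> \<le> v r"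
    show "t \<le> T \<longrightarrow> \<bar>x t - K - p t\<bar> \<le> v t"
    proof
      assume "t \<le> T"
      have forcing: "\<bar>f (x (s - \<tau>)) - \<mu> * K + b * p (s - \<tau>)\<bar> \<le> (\<mu> + 2 * \<rho>) * v s" if s: "T0 < s" "s < t" for s
      proof -
        define y where "y = x (s - \<tau>) - K"
        define E where "E = exp (\<rho> * (s - \<tau> - T))"
        have E: "0 < E" "E \<le> 1" using s \<open>t \<le> T\<close> tau_pos root(1) by (auto simp: E_def mult_le_0_iff)
        have v_E: "v (s - \<tau>) = D * E\<^sup>2" by (simp add: v_def E_def power2_eq_square exp_add[symmetric])
        have close: "\<bar>y - p (s - \<tau>)\<bar> \<le> D * E\<^sup>2"
          using IH[of "s - \<tau>"] s \<open>t \<le> T\<close> tau_pos unfolding v_E y_def by simp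
        have "E\<^sup>2 \<le> E" using E by (simp add: power2_eq_square)
        then have "D * E\<^sup>2 \<le> \<epsilon> * E" using D E by (intro mult_mono) auto
        moreover have "\<bar>p (s - \<tau>)\<bar> \<le> \<epsilon> * E"
        proof -
          have "\<epsilon> * E * \<bar>cos (\<omega> * (s - \<tau> - T))\<bar> \<le> \<epsilon> * E * 1"
            using eps E by (intro mult_left_mono) auto
          then show ?thesis using eps by (simp add: p_def E_def abs_mult)
        qed
        ultimately have yE: "\<bar>y\<bar> \<le> 2 * \<epsilon> * E" using close by linarith
        also have "\<dots> \<le> 2 * \<epsilon>" using E eps by simp
        finally have "\<bar>y\<bar> \<le> r" using eps by simp
        then have "\<bar>f (x (s - \<tau>)) - \<mu> * K + b * y\<bar> \<le> R * y\<^sup>2"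
          using rem[of y] fix_K by (simp add: y_def)
        also have "\<dots> \<le> R * (2 * \<epsilon> * E)\<^sup>2"
          using yE \<open>0 < R\<close> by (intro mult_left_mono) (auto simp: abs_le_square_iff[symmetric])
        also have "\<dots> = 4 * R * \<epsilon>\<^sup>2 * E\<^sup>2" by (simp add: power_mult_distrib)
        finally have 1: "\<bar>f (x (s - \<tau>)) - \<mu> * K + b * y\<bar> \<le> 4 * R * \<epsilon>\<^sup>2 * E\<^sup>2" .
        have "\<bar>b * y - b * p (s - \<tau>)\<bar> = b * \<bar>y - p (s - \<tau>)\<bar>"
          using \<open>0 < b\<close> by (simp add: abs_mult right_diff_distrib[symmetric])
        also have "\<dots> \<le> b * (D * E\<^sup>2)" using close \<open>0 < b\<close> by simp
        finally have "\<bar>f (x (s - \<tau>)) - \<mu> * K + b * p (s - \<tau>)\<bar> \<le> 4 * R * \<epsilon>\<^sup>2 * E\<^sup>2 + b * (D * E\<^sup>2)"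
          using 1 by linarith
        also have "\<dots> = (b * D + 4 * R * \<epsilon>\<^sup>2) * exp (- 2 * \<rho> * \<tau>) * exp (2 * \<rho> * (s - T))"
        proof -
          have "E\<^sup>2 = exp (- 2 * \<rho> * \<tau>) * exp (2 * \<rho> * (s - T))"
            by (simp add: E_def power2_eq_square exp_add[symmetric] algebra_simps)
          then show ?thesis by (simp add: algebra_simps)
        qed
        also have "\<dots> \<le> (\<mu> + 2 * \<rho>) * D * exp (2 * \<rho> * (s - T))"
          using gap by (intro mult_right_mono) auto
        finally show ?thesis by (simp add: v_def)
      qed
      have x_deriv: "(x has_real_derivative (- \<mu> * x s + f (x (s - \<tau>)))) (at s)" if "T0 < s" for s
        using x that by (simp add: solves_after_def)
      have cont: "continuous_on {T0..t} (\<lambda>s. \<sigma> * (x s - K - p s) - v s)" for \<sigma>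
      proof -
        have "continuous_on {T0..t} x" by (rule solves_after_continuous_on[OF x]) (use tau_pos in auto)
        moreover have "continuous_on {T0..t} p" "continuous_on {T0..t} v"
          using p_deriv v_deriv by (auto intro!: continuous_at_imp_continuous_on DERIV_isCont)
        ultimately show ?thesis by (intro continuous_intros)
      qed
      \<comment> \<open>\<open>\<sigma>\<close> is a sign, so that both sides of the absolute value are handled together\<close>
      have bound: "\<sigma> * (x t - K - p t) - v t \<le> 0" if "\<bar>\<sigma>\<bar> = 1" for \<sigma>
      proof -
        have "\<sigma> * (x t - K - p t) - v t \<le> exp (- \<mu> * (t - T0)) * (\<sigma> * (x T0 - K - p T0) - v T0)"
        proof (rule exp_decay[of T0 t "\<lambda>s. \<sigma> * (x s - K - p s) - v s"])
          fix s assume s: "T0 < s" "s < t"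
          define d where "d = \<sigma> * ((- \<mu> * x s + f (x (s - \<tau>))) - (- \<mu> * p s - b * p (s - \<tau>))) - 2 * \<rho> * v s"
          have "((\<lambda>s. \<sigma> * (x s - K - p s) - v s) has_real_derivative d) (at s)"
            unfolding d_def by (auto intro!: derivative_eq_intros x_deriv p_deriv v_deriv s)
          moreover have "d + \<mu> * (\<sigma> * (x s - K - p s) - v s) \<le> 0"
          proof -
            have "\<sigma> * (f (x (s - \<tau>)) - \<mu> * K + b * p (s - \<tau>)) \<le> \<bar>\<sigma> * (f (x (s - \<tau>)) - \<mu> * K + b * p (s - \<tau>))\<bar>"
              by simp
            also have "\<dots> \<le> (\<mu> + 2 * \<rho>) * v s" using forcing[OF s] that by (simp add: abs_mult)
            finally show ?thesis by (simp add: d_def algebra_simps)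
          qed
          ultimately show "\<exists>D. ((\<lambda>s. \<sigma> * (x s - K - p s) - v s) has_real_derivative D) (at s) \<and>
              D + \<mu> * (\<sigma> * (x s - K - p s) - v s) \<le> 0" by blast
        qed (use t cont in auto)
        also have "\<dots> = - (exp (- \<mu> * (t - T0)) * v T0)"
          using init[of T0] tau_pos by (simp add: p_def)
        also have "\<dots> \<le> 0" using v_pos[of T0] by simp
        finally show ?thesis .
      qed
      show "\<bar>x t - K - p t\<bar> \<le> v t" using bound[of 1] bound[of "-1"] by simp
    qed
  next
    fix s assume "T0 - \<tau> \<le> s" "s \<le> T0"
    then show "s \<le> T \<longrightarrow> \<bar>x s - K - p s\<bar> \<le> v s" using init[of s] v_pos[of s] by (simp add: p_def)
  qed (use tau_pos t in auto)
  then show ?thesis using t by (simp add: p_def v_def)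
qed

text \<open>
The initial functions \<open>\<Phi> n\<close> are the pieces of \<open>K + p\<close> at times around \<open>- n * \<tau>\<close>. They tend to \<open>K\<close>, so
they form a compact set with it. The solution with initial function \<open>\<Phi> n\<close> is at time \<open>n * \<tau>\<close> still
at distance at least \<open>\<epsilon> / 2\<close> from \<open>K\<close>, which contradicts attraction uniformly on compact sets.
\<close>

lemma unstable_equilibrium_not_attractor:
  assumes "0 < \<mu>" and f_nonneg: "\<And>x. 0 \<le> x \<Longrightarrow> 0 \<le> f x" and f_cont: "continuous_on {0..} f"
    and "0 < K" and fix_K: "f K = \<mu> * K" and "\<mu> < b"
    and "0 < R" "0 < r" and rem: "\<And>y. \<bar>y\<bar> \<le> r \<Longrightarrow> \<bar>f (K + y) - f K + b * y\<bar> \<le> R * y\<^sup>2"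
  shows "\<exists>\<tau>>0. \<not> contains_global_attractor \<mu> f \<tau> K K"
proof -
  obtain \<rho> \<tau> \<omega> where root: "0 < \<rho>" "0 < \<tau>" "b * exp (- 2 * \<rho> * \<tau>) < \<mu> + 2 * \<rho>"
    "\<forall>t. \<rho> * cos (\<omega> * t) - \<omega> * sin (\<omega> * t) = - \<mu> * cos (\<omega> * t) - b * exp (- \<rho> * \<tau>) * cos (\<omega> * (t - \<tau>))"
    by (rule oscillatory_characteristic_root[OF \<open>0 < \<mu>\<close> \<open>\<mu> < b\<close>])
  interpret delay_equation \<mu> \<tau> f
    by unfold_locales (use assms root in auto)
  define \<gamma> where "\<gamma> = \<mu> + 2 * \<rho> - b * exp (- 2 * \<rho> * \<tau>)"
  have "0 < \<gamma>" using root by (simp add: \<gamma>_def)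
  define \<epsilon> where "\<epsilon> = min (r / 2) (min (K / 2) (\<gamma> / (8 * R)))"
  have "\<epsilon> \<le> r / 2" "\<epsilon> \<le> K / 2" "\<epsilon> \<le> \<gamma> / (8 * R)" by (simp_all add: \<epsilon>_def)
  moreover have "0 < \<epsilon>" using \<open>0 < r\<close> \<open>0 < K\<close> \<open>0 < \<gamma>\<close> \<open>0 < R\<close> by (simp add: \<epsilon>_def)
  ultimately have eps: "0 < \<epsilon>" "2 * \<epsilon> \<le> r" "2 * \<epsilon> \<le> K" "\<epsilon> \<le> \<gamma> / (8 * R)" by simp_all
  \<comment> \<open>an amplitude for which the quadratic forcing is absorbed by the spectral gap \<open>\<gamma>\<close>\<close>
  define D where "D = 4 * R * \<epsilon>\<^sup>2 / \<gamma>"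
  have D: "0 < D" "D \<le> \<epsilon> / 2"
    using eps \<open>0 < R\<close> \<open>0 < \<gamma>\<close> by (auto simp: D_def field_simps power2_eq_square)
  have gap: "(b * D + 4 * R * \<epsilon>\<^sup>2) * exp (- 2 * \<rho> * \<tau>) \<le> (\<mu> + 2 * \<rho>) * D"
  proof -
    have "4 * R * \<epsilon>\<^sup>2 * exp (- 2 * \<rho> * \<tau>) \<le> 4 * R * \<epsilon>\<^sup>2 * 1"
      using root \<open>0 < R\<close> by (intro mult_left_mono) auto
    also have "\<dots> = \<gamma> * D" using \<open>0 < \<gamma>\<close> by (simp add: D_def)
    finally show ?thesis by (simp add: \<gamma>_def algebra_simps)
  qed
  define p where "p t = \<epsilon> * exp (\<rho> * t) * cos (\<omega> * t)" for t
  have p_le: "\<bar>p t\<bar> \<le> \<epsilon> * exp (\<rho> * t)" for t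
  proof -
    have "\<epsilon> * exp (\<rho> * t) * \<bar>cos (\<omega> * t)\<bar> \<le> \<epsilon> * exp (\<rho> * t) * 1"
      using eps by (intro mult_left_mono) auto
    then show ?thesis using eps by (simp add: p_def abs_mult)
  qed
  have p_small: "\<bar>p t\<bar> \<le> \<epsilon>" if "t \<le> 0" for t
  proof -
    have "\<epsilon> * exp (\<rho> * t) \<le> \<epsilon> * 1" using that root eps by (intro mult_left_mono) (auto simp: mult_le_0_iff)
    then show ?thesis using p_le[of t] by simp
  qed
  define \<Phi> where "\<Phi> n = restrict (\<lambda>s. K + p (s - real n * \<tau>)) {-\<tau>..0}" for n :: nat
  define \<kappa> where "\<kappa> = restrict (\<lambda>s. K) {-\<tau>..0}"
  have \<Phi>: "\<Phi> n \<in> mspace (phase_space \<tau>)" for n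
  proof -
    have "continuous_on {-\<tau>..0} (\<lambda>s. K + p (s - real n * \<tau>))"
      unfolding p_def by (intro continuous_intros)
    then have "continuous_on {-\<tau>..0} (\<Phi> n)"
      by (subst continuous_on_cong[OF refl, where g = "\<lambda>s. K + p (s - real n * \<tau>)"]) (auto simp: \<Phi>_def)
    moreover have "0 < \<Phi> n s" if "s \<in> {-\<tau>..0}" for s
    proof -
      have "0 \<le> real n * \<tau>" "s \<le> 0" using root that by auto
      then have "s - real n * \<tau> \<le> 0" by linarith
      then show ?thesis using p_small[of "s - real n * \<tau>"] that eps by (simp add: \<Phi>_def)
    qed
    moreover have "0 \<in> {-\<tau>..0}" using root by simp
    ultimately show ?thesis unfolding mspace_phase_space
      by (metis \<Phi>_def less_imp_le less_irrefl restrict_extensional)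
  qed
  have \<kappa>: "\<kappa> \<in> mspace (phase_space \<tau>)"
    unfolding \<kappa>_def by (rule constant_in_phase_space) (use \<open>0 < K\<close> root in auto)
  have "uniform_limit {-\<tau>..0} \<Phi> \<kappa> sequentially"
    unfolding uniform_limit_iff
  proof (intro allI impI)
    fix e :: real assume "e > 0"
    have "(\<lambda>n. \<epsilon> * exp (- \<rho> * \<tau> * real n)) \<longlonglongrightarrow> 0"
    proof -
      define q where "q = \<rho> * \<tau>"
      have "0 < q" using root by (simp add: q_def)
      then have "(\<lambda>n. \<epsilon> * exp (- q * real n)) \<longlonglongrightarrow> 0" by real_asymp
      then show ?thesis by (simp add: q_def)
    qed
    then have "\<forall>\<^sub>F n in sequentially. \<epsilon> * exp (- \<rho> * \<tau> * real n) < e"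
      using \<open>e > 0\<close> by (rule order_tendstoD)
    then show "\<forall>\<^sub>F n in sequentially. \<forall>s\<in>{-\<tau>..0}. dist (\<Phi> n s) (\<kappa> s) < e"
    proof eventually_elim
      case (elim n)
      show ?case
      proof
        fix s assume s: "s \<in> {-\<tau>..0}"
        have "\<rho> * (s - real n * \<tau>) \<le> - \<rho> * \<tau> * real n"
          using s root by (simp add: algebra_simps mult_le_0_iff)
        then have "\<epsilon> * exp (\<rho> * (s - real n * \<tau>)) \<le> \<epsilon> * exp (- \<rho> * \<tau> * real n)"
          using eps by simp
        then show "dist (\<Phi> n s) (\<kappa> s) < e"
          using p_le[of "s - real n * \<tau>"] elim s by (simp add: \<Phi>_def \<kappa>_def dist_real_def)
      qed
    qed
  qed
  then have "limitin (mtopology_of (phase_space \<tau>)) \<Phi> \<kappa> sequentially"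
    using limitin_phase_space[OF \<kappa>] \<Phi> by blast
  then have C: "compactin (mtopology_of (phase_space \<tau>)) (insert \<kappa> (range \<Phi>))"
    by (rule compactin_sequence_with_limit) (use \<Phi> in auto)
  have escape: "K + \<epsilon> / 2 \<le> dde_solution \<mu> f \<tau> (\<Phi> n) (real n * \<tau>)" for n
  proof -
    define x where "x = dde_solution \<mu> f \<tau> (\<Phi> n)"
    have nt: "0 \<le> real n * \<tau>" using root by simp
    have "\<bar>x (real n * \<tau>) - K - \<epsilon> * exp (\<rho> * (real n * \<tau> - real n * \<tau>)) * cos (\<omega> * (real n * \<tau> - real n * \<tau>))\<bar>
        \<le> D * exp (2 * \<rho> * (real n * \<tau> - real n * \<tau>))"
    proof (rule growing_oscillation_tracked[OF root(1) root(4)[rule_format] _ fix_K rem \<open>0 < R\<close> eps(1,2) D(1) _ gap])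
      show "solves_after 0 x" unfolding x_def by (rule dde_solution_props[OF \<Phi>])
      show "x s = K + \<epsilon> * exp (\<rho> * (s - real n * \<tau>)) * cos (\<omega> * (s - real n * \<tau>))" if "s \<in> {0 - \<tau>..0}" for s
        using dde_solution_props(2)[OF \<Phi>, of s n] that by (simp add: x_def \<Phi>_def p_def)
      show "0 - \<tau> \<le> real n * \<tau>" using nt root by linarith
    qed (use nt \<open>\<mu> < b\<close> \<open>0 < \<mu>\<close> D eps in auto)
    then show ?thesis using D unfolding x_def[symmetric] by simp
  qed
  have "\<not> contains_global_attractor \<mu> f \<tau> K K"
  proof
    assume "contains_global_attractor \<mu> f \<tau> K K"
    then obtain A where A: "is_global_attractor \<mu> f \<tau> A" "\<And>\<psi> s. \<psi> \<in> A \<Longrightarrow> s \<in> {-\<tau>..0} \<Longrightarrow> \<psi> s = K"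
      unfolding contains_global_attractor_def by (metis order_antisym)
    have "A \<subseteq> mspace (phase_space \<tau>)"
      using A(1) compactin_subset_topspace unfolding is_global_attractor_def by fastforce
    have "attracts \<mu> f \<tau> A (insert \<kappa> (range \<Phi>))" using A(1) C unfolding is_global_attractor_def by blast
    then obtain t0 where t0: "t0 \<ge> 0" "\<And>t \<phi>. t \<ge> t0 \<Longrightarrow> \<phi> \<in> insert \<kappa> (range \<Phi>) \<Longrightarrow>
        \<exists>\<psi>\<in>A. mdist (phase_space \<tau>) (semiflow \<mu> f \<tau> t \<phi>) \<psi> < \<epsilon> / 2"
      unfolding attracts_def using eps(1) by (meson half_gt_zero)
    obtain n where "t0 / \<tau> \<le> real n" using real_arch_simple by blast
    then have n: "t0 \<le> real n * \<tau>" using root by (simp add: field_simps)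
    then obtain \<psi> where \<psi>: "\<psi> \<in> A" "mdist (phase_space \<tau>) (semiflow \<mu> f \<tau> (real n * \<tau>) (\<Phi> n)) \<psi> < \<epsilon> / 2"
      using t0(2)[of "real n * \<tau>" "\<Phi> n"] by blast
    have "\<bar>dde_solution \<mu> f \<tau> (\<Phi> n) (real n * \<tau>) - \<psi> 0\<bar> < \<epsilon> / 2"
      by (rule near_point_of_semiflow[OF \<Phi> _ _ \<psi>(2)]) (use \<open>A \<subseteq> _\<close> \<psi> root in auto)
    moreover have "\<psi> 0 = K" using A(2)[OF \<psi>(1), of 0] root(2) by simp
    ultimately show False using escape[of n] by linarith
  qed
  then show ?thesis using root by blast
qed

section \<open>Sharpness\<close>

text \<open>
With the constant initial function \<open>p\<close> the equation on \<open>{0..\<tau>}\<close> is \<open>x' = - \<mu> x + f p\<close>, so that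
\<open>x \<tau>\<close> tends to \<open>f p / \<mu>\<close> as \<open>\<tau> \<longlonglongrightarrow> \<infinity>\<close>.
\<close>

lemma invariant_for_all_delays_imp_map_invariant:
  assumes "0 < \<mu>" and f_nonneg: "\<And>x. 0 \<le> x \<Longrightarrow> 0 \<le> f x" and f_cont: "continuous_on {0..} f"
    and "0 < c" and inv: "\<And>\<tau>. 0 < \<tau> \<Longrightarrow> invariant_interval \<mu> f \<tau> c d" and p: "p \<in> {c..d}"
  shows "f p / \<mu> \<in> {c..d}"
proof -
  have "f p / \<mu> + exp (- \<mu> * \<tau>) * (p - f p / \<mu>) \<in> {c..d}" if "0 < \<tau>" for \<tau>
  proof -
    interpret delay_equation \<mu> \<tau> f by unfold_locales (use assms that in auto)
    define \<phi> where "\<phi> = restrict (\<lambda>s. p) {-\<tau>..0}"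
    define x where "x = dde_solution \<mu> f \<tau> \<phi>"
    have \<phi>: "\<phi> \<in> mspace (phase_space \<tau>)"
      unfolding \<phi>_def by (rule constant_in_phase_space) (use p \<open>0 < c\<close> that in auto)
    have x: "solves_after 0 x" and x_init: "x s = p" if "s \<in> {-\<tau>..0}" for s
      using dde_solution_props[OF \<phi>] that by (auto simp: x_def \<phi>_def)
    have x0: "x 0 = p" using x_init[of 0] that by simp
    have F: "f (x (r - \<tau>)) = \<mu> * (f p / \<mu>)" if "0 < r" "r < \<tau>" for r
      using x_init[of "r - \<tau>"] that mu_pos by simp
    have "x \<tau> - f p / \<mu> \<le> exp (- \<mu> * (\<tau> - 0)) * (x 0 - f p / \<mu>)"
      by (rule relax_upper[OF x]) (use that F in auto)
    moreover have "exp (- \<mu> * (\<tau> - 0)) * (x 0 - f p / \<mu>) \<le> x \<tau> - f p / \<mu>"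
      by (rule relax_lower[OF x]) (use that F in auto)
    ultimately have "x \<tau> = f p / \<mu> + exp (- \<mu> * \<tau>) * (p - f p / \<mu>)" using x0 by simp
    moreover have "x \<tau> \<in> {c..d}"
      using inv[OF that] \<phi> p that unfolding invariant_interval_def x_def by (auto simp: \<phi>_def)
    ultimately show ?thesis by simp
  qed
  then have "\<forall>\<^sub>F n in sequentially. f p / \<mu> + exp (- \<mu> * real n) * (p - f p / \<mu>) \<in> {c..d}"
    unfolding eventually_sequentially by (intro exI[of _ 1]) auto
  moreover have "(\<lambda>n. f p / \<mu> + exp (- \<mu> * real n) * (p - f p / \<mu>)) \<longlonglongrightarrow> f p / \<mu>"
    using \<open>0 < \<mu>\<close> by real_asymp
  ultimately show ?thesis by (rule Lim_in_closed_set[OF closed_atLeastAtMost _ sequentially_bot])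
qed

lemma (in delay_equation) attracting_contains_equilibrium:
  assumes "0 < K" "f K = \<mu> * K" and attr: "attracting_interval \<mu> f \<tau> c d"
  shows "c \<le> K" "K \<le> d"
proof -
  define \<phi> where "\<phi> = restrict (\<lambda>s. K) {-\<tau>..0}"
  have \<phi>: "\<phi> \<in> mspace (phase_space \<tau>)"
    unfolding \<phi>_def by (rule constant_in_phase_space) (use assms tau_pos in auto)
  have "solves_after 0 (\<lambda>s. K)"
    unfolding solves_after_def using assms(2) by auto
  then have "dde_solution \<mu> f \<tau> \<phi> t = K" if "0 \<le> t" for t
    using dde_solution_eqI[of "\<lambda>s. K" t] \<phi> that tau_pos by (simp add: \<phi>_def)
  then have "\<forall>\<^sub>F t in at_top. ereal (dde_solution \<mu> f \<tau> \<phi> t) = ereal K"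
    unfolding eventually_at_top_linorder by (intro exI[of _ 0]) auto
  then have "((\<lambda>t. ereal (dde_solution \<mu> f \<tau> \<phi> t)) \<longlongrightarrow> ereal K) at_top"
    by (rule tendsto_eventually)
  then have "Liminf at_top (\<lambda>t. ereal (dde_solution \<mu> f \<tau> \<phi> t)) = ereal K"
    "Limsup at_top (\<lambda>t. ereal (dde_solution \<mu> f \<tau> \<phi> t)) = ereal K"
    by (auto intro: lim_imp_Liminf lim_imp_Limsup trivial_limit_at_top_linorder)
  then show "c \<le> K" "K \<le> d"
    using attr \<phi> unfolding attracting_interval_def by force+
qed

text \<open>
If \<open>c\<close> were strictly between \<open>a\<close> and \<open>K\<close>, the second iterate of \<open>g\<close> would map \<open>c\<close> below itself and
thus out of the \<open>g\<close>-invariant interval \<open>{c..d}\<close>.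
\<close>

lemma sharpest_core_interval:
  assumes core: "\<And>\<tau>. 0 < \<tau> \<Longrightarrow> unimodal_delay_equation \<mu> \<tau> f x0 K a b" and "a < K"
    and above_a: "\<And>x. a < x \<Longrightarrow> x < K \<Longrightarrow> f (f x / \<mu>) / \<mu> < x"
    and unstable: "\<exists>\<tau>>0. \<not> contains_global_attractor \<mu> f \<tau> K K"
  shows "sharpest_interval \<mu> f a b"
proof -
  interpret U: unimodal_delay_equation \<mu> 1 f x0 K a b by (rule core) simp
  have "delay_independent_interval \<mu> f a b"
    unfolding delay_independent_interval_def
    using unimodal_delay_equation.core_invariant[OF core] unimodal_delay_equation.core_attracting[OF core]
      unimodal_delay_equation.core_contains_global_attractor[OF core] U.a_b by blast
  moreover have "{a..b} \<subseteq> {c..d}" if "delay_independent_interval \<mu> f c d" for c d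
  proof -
    have "0 < c" and inv: "\<And>\<tau>. 0 < \<tau> \<Longrightarrow> invariant_interval \<mu> f \<tau> c d"
      and attr: "attracting_interval \<mu> f 1 c d" and contains: "\<And>\<tau>. 0 < \<tau> \<Longrightarrow> contains_global_attractor \<mu> f \<tau> c d"
      using that by (auto simp: delay_independent_interval_def)
    have "0 < K" using U.x0_pos U.x0_less_K by simp
    have fK: "f K = \<mu> * K" using U.g_K U.mu_pos by (simp add: field_simps)
    have cKd: "c \<le> K" "K \<le> d" using U.attracting_contains_equilibrium[OF \<open>0 < K\<close> fK attr] by auto
    have g_inv: "f p / \<mu> \<in> {c..d}" if "p \<in> {c..d}" for p
      using invariant_for_all_delays_imp_map_invariant[OF U.mu_pos U.f_nonneg U.f_cont \<open>0 < c\<close> inv that] .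
    have "c < K"
    proof (rule ccontr)
      assume "\<not> c < K"
      then have "c = K" using cKd by simp
      have "d = K"
      proof (rule ccontr)
        assume "d \<noteq> K"
        then have "f d / \<mu> < f K / \<mu>" using U.g_decreasing[of K d] cKd U.x0_less_K by simp
        then show False using g_inv[of d] cKd \<open>c = K\<close> U.g_K by simp
      qed
      then show False using unstable contains \<open>c = K\<close> by blast
    qed
    have "c \<le> a"
    proof (rule ccontr)
      assume "\<not> c \<le> a"
      then have "f (f c / \<mu>) / \<mu> < c" using above_a[of c] \<open>c < K\<close> by simp
      moreover have "f (f c / \<mu>) / \<mu> \<in> {c..d}" by (intro g_inv) (use cKd in simp)
      ultimately show False by simp
    qed
    then have "a \<in> {c..d}" using cKd \<open>a < K\<close> by simp
    then have "b \<in> {c..d}" using g_inv U.cycle(1) by auto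
    then show ?thesis using \<open>a \<in> {c..d}\<close> by auto
  qed
  ultimately show ?thesis unfolding sharpest_interval_def by blast
qed

section \<open>Consequences of conditions (U) and (S)\<close>

lemma has_real_derivative_deriv_on:
  "f differentiable (at x within S) \<Longrightarrow> (f has_real_derivative deriv_on S f x) (at x within S)"
  unfolding deriv_on_def has_real_derivative_iff_has_vector_derivative
  by (simp add: vector_derivative_works)

lemma deriv_on_eqI:
  assumes "(f has_real_derivative y) (at x within {0..})" "0 \<le> (x :: real)"
  shows "deriv_on {0..} f x = y"
  unfolding deriv_on_def
proof (rule vector_derivative_within)
  have "at_right x \<le> at x within {0..}" using assms(2) by (intro at_le) auto
  then show "at x within {0..} \<noteq> bot" using trivial_limit_at_right_real bot.extremum_uniqueI by metis
qed (use assms in \<open>simp add: has_real_derivative_iff_has_vector_derivative\<close>)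

lemma at_within_atLeast_interior: "0 < (x :: real) \<Longrightarrow> at x within {0..} = at x"
  by (rule at_within_interior) simp

lemma strictly_decreasing_of_deriv_on_neg:
  fixes F :: "real \<Rightarrow> real"
  assumes "0 \<le> x" "x < y"
    and d: "\<And>z. x \<le> z \<Longrightarrow> z \<le> y \<Longrightarrow> F differentiable (at z within {0..})"
    and neg: "\<And>z. x < z \<Longrightarrow> z < y \<Longrightarrow> deriv_on {0..} F z < 0"
  shows "F y < F x"
proof (rule DERIV_neg_imp_decreasing_open[of x y F, OF \<open>x < y\<close>])
  fix z assume z: "x < z" "z < y"
  then have "(F has_real_derivative deriv_on {0..} F z) (at z)"
    using has_real_derivative_deriv_on[OF d[of z]] assms(1) by (simp add: at_within_atLeast_interior)
  then show "\<exists>l. (F has_real_derivative l) (at z) \<and> l < 0" using neg z by blast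
next
  have "F differentiable_on {x..y}"
    unfolding differentiable_on_def
    by (intro ballI differentiable_within_subset[OF d]) (use assms(1) in auto)
  then show "continuous_on {x..y} F" by (rule differentiable_imp_continuous_on)
qed

text \<open>
By concavity on \<open>{0..x0}\<close> a chord argument shows that once the graph of \<open>g\<close> has met the diagonal it
stays below it up to \<open>x0\<close>. If \<open>g x0 \<le> x0\<close>, then \<open>g' 0 > 1\<close> produces a unique positive fixed point
in \<open>{0..x0}\<close>, against \<open>x0 < K\<close>. Hence \<open>g x0 > x0\<close>, the graph lies above the diagonal on the
increasing branch, and the decreasing branch crosses it exactly once. Uniqueness has to be proved
in both cases, because \<open>K\<close> is given by a definite description.
\<close>

lemma unimodal_map_of_condition_U:
  fixes f :: "real \<Rightarrow> real"
  assumes "0 < \<mu>" and f_cont: "continuous_on {0..} f" and U: "condition_U f x0"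
    and slope0: "1 < deriv_on {0..} (\<lambda>x. f x / \<mu>) 0"
    and K: "K = (THE y. 0 < y \<and> f y / \<mu> = y)" and "x0 < K"
    and g_g_x0: "x0 < f (f x0 / \<mu>) / \<mu>"
  shows "unimodal_map (\<lambda>x. f x / \<mu>) x0 K"
proof -
  define g where "g x = f x / \<mu>" for x
  define f1 where "f1 = deriv_on {0..} f"
  define g1 where "g1 x = f1 x / \<mu>" for x
  have f_nonneg: "\<And>x. 0 \<le> x \<Longrightarrow> 0 \<le> f x" and "f 0 = 0" and f_diff: "f differentiable_on {0..}"
    and peak: "is_peak f x0"
    and f1_diff: "\<And>x. x \<in> {0..x0} \<Longrightarrow> f1 differentiable (at x within {0..})"
    and f2_neg: "\<And>x. x \<in> {0..x0} \<Longrightarrow> deriv_on {0..} f1 x < 0"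
    using U unfolding condition_U_def f1_def by blast+
  have "0 < x0" and f1_pos: "\<And>x. 0 \<le> x \<Longrightarrow> x < x0 \<Longrightarrow> 0 < f1 x" and f1_neg: "\<And>x. x0 < x \<Longrightarrow> f1 x < 0"
    using peak unfolding is_peak_def f1_def by blast+
  have f_deriv: "(f has_real_derivative f1 x) (at x within {0..})" if "0 \<le> x" for x
    unfolding f1_def using has_real_derivative_deriv_on f_diff that by (auto simp: differentiable_on_def)
  then have g_deriv_within: "(g has_real_derivative g1 x) (at x within {0..})" if "0 \<le> x" for x
    unfolding g_def[abs_def] g1_def using that by (intro DERIV_cdivide) auto
  then have g_deriv: "(g has_real_derivative g1 x) (at x)" if "0 < x" for x
    using that at_within_atLeast_interior[of x] by (metis less_imp_le)
  have g_cont: "continuous_on S g" if "S \<subseteq> {0..}" for S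
    unfolding g_def using continuous_on_subset[OF f_cont that] \<open>0 < \<mu>\<close> by (intro continuous_intros) auto
  have g1_decreasing: "g1 y < g1 x" if "0 \<le> x" "x < y" "y \<le> x0" for x y
  proof -
    have "f1 y < f1 x"
      by (rule strictly_decreasing_of_deriv_on_neg) (use that f1_diff f2_neg in auto)
    then show ?thesis using \<open>0 < \<mu>\<close> by (simp add: g1_def divide_strict_right_mono)
  qed
  have increasing: "g x < g y" if "0 \<le> x" "x < y" "y \<le> x0" for x y
  proof (rule DERIV_pos_imp_increasing_open[OF \<open>x < y\<close>])
    show "\<exists>l. (g has_real_derivative l) (at z) \<and> 0 < l" if "x < z" "z < y" for z
      using g_deriv[of z] f1_pos[of z] that \<open>0 \<le> x\<close> \<open>y \<le> x0\<close> \<open>0 < \<mu>\<close>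
      by (intro exI[of _ "g1 z"]) (auto simp: g1_def)
  qed (rule g_cont, use that in auto)
  have decreasing: "g y < g x" if "x0 \<le> x" "x < y" for x y
  proof (rule DERIV_neg_imp_decreasing_open[of x y g, OF \<open>x < y\<close>])
    show "\<exists>l. (g has_real_derivative l) (at z) \<and> l < 0" if "x < z" "z < y" for z
      using g_deriv[of z] f1_neg[of z] that \<open>x0 \<le> x\<close> \<open>0 < x0\<close> \<open>0 < \<mu>\<close>
      by (intro exI[of _ "g1 z"]) (auto simp: g1_def divide_neg_pos)
  qed (rule g_cont, use that \<open>0 < x0\<close> in auto)
  have g0: "g 0 = 0" using \<open>f 0 = 0\<close> by (simp add: g_def)
  have mvt: "\<exists>z. x < z \<and> z < y \<and> g y - g x = (y - x) * g1 z" if "0 \<le> x" "x < y" for x y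
  proof -
    have "continuous_on {x..y} g" using that by (intro g_cont) auto
    moreover have "g differentiable (at z)" if "x < z" "z < y" for z
      using g_deriv[of z] that \<open>0 \<le> x\<close> by (auto simp: real_differentiable_def)
    ultimately obtain l z where z: "x < z" "z < y" "(g has_real_derivative l) (at z)" "g y - g x = (y - x) * l"
      using MVT[OF \<open>x < y\<close>, of g] by blast
    then have "l = g1 z" using DERIV_unique g_deriv[of z] that by auto
    then show ?thesis using z by blast
  qed
  have below_secant: "g y - y < 0" if "0 < x" "x < y" "y \<le> x0" "g x \<le> x" for x y
  proof -
    obtain z where z: "0 < z" "z < x" "g x - g 0 = (x - 0) * g1 z" using mvt[of 0 x] \<open>0 < x\<close> by auto
    obtain w where w: "x < w" "w < y" "g y - g x = (y - x) * g1 w" using mvt[of x y] \<open>0 < x\<close> \<open>x < y\<close> by auto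
    have "x * g1 z \<le> x * 1" using z(3) g0 that by simp
    then have "g1 z \<le> 1" using \<open>0 < x\<close> by simp
    moreover have "g1 w < g1 z" using g1_decreasing[of z w] z w that by simp
    ultimately have "(y - x) * g1 w < (y - x) * 1" using that by (intro mult_strict_left_mono) auto
    then have "g y - g x < y - x" unfolding w(3) by simp
    then show ?thesis using \<open>g x \<le> x\<close> by linarith
  qed
  have bound: "g x \<le> g x0" if "0 \<le> x" for x
    using increasing[of x x0] decreasing[of x0 x] that by (cases x x0 rule: linorder_cases) auto
  have "x0 < g x0"
  proof (rule ccontr)
    assume "\<not> x0 < g x0"
    then have no_fix_right: "g y < y" if "x0 < y" for y using decreasing[of x0 y] that by simp
    have "g1 0 = deriv_on {0..} (\<lambda>x. f x / \<mu>) 0"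
      using deriv_on_eqI[OF g_deriv_within[of 0]] by (simp add: g_def[abs_def])
    then have "1 < g1 0" using slope0 by simp
    moreover have "((\<lambda>x. g x - x) has_real_derivative g1 0 - 1) (at 0 within {0..})"
      by (intro DERIV_diff g_deriv_within DERIV_ident) simp
    ultimately obtain e where e: "0 < e" "\<And>h. 0 < h \<Longrightarrow> h < e \<Longrightarrow> 0 < g h - h"
      using has_real_derivative_pos_inc_right[of "\<lambda>x. g x - x" "g1 0 - 1" 0 "{0..}"] g0 by auto
    define x where "x = min (e / 2) (x0 / 2)"
    \<comment> \<open>a point to the left of \<open>x0\<close> at which \<open>g\<close> is above the diagonal\<close>
    have x: "0 < x" "x < e" "x < x0" using e \<open>0 < x0\<close> by (auto simp: x_def min_def)
    have "continuous_on {x..x0} (\<lambda>x. g x - x)" using x by (intro continuous_intros g_cont) auto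
    then obtain y where y: "x \<le> y" "y \<le> x0" "g y - y = 0"
      using IVT2'[of "\<lambda>x. g x - x" x0 0 x] e(2)[of x] x \<open>\<not> x0 < g x0\<close> by auto
    have "y' = y" if "0 < y'" "g y' = y'" for y'
    proof -
      have "y' \<le> x0" using no_fix_right[of y'] that by force
      then show ?thesis
        using below_secant[of y y'] below_secant[of y' y] y x that by (cases y y' rule: linorder_cases) auto
    qed
    then have "(THE y. 0 < y \<and> g y = y) = y" using y x by (intro the_equality) auto
    then show False using K \<open>x0 < K\<close> y by (simp add: g_def)
  qed
  have "continuous_on {x0..g x0} (\<lambda>x. g x - x)" using \<open>0 < x0\<close> by (intro continuous_intros g_cont) auto
  then obtain y where y: "x0 \<le> y" "y \<le> g x0" "g y - y = 0"
    using IVT2'[of "\<lambda>x. g x - x" "g x0" 0 x0] \<open>x0 < g x0\<close> bound[of "g x0"] \<open>0 < x0\<close> by auto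
  have above_left: "x < g x" if "0 < x" "x \<le> x0" for x
    using below_secant[of x x0] that \<open>x0 < g x0\<close> by (cases "x = x0") force+
  have "y' = y" if "0 < y'" "g y' = y'" for y'
  proof -
    have "x0 < y'" using above_left[of y'] that by force
    then show ?thesis using decreasing[of y y'] decreasing[of y' y] y that by (cases y y' rule: linorder_cases) auto
  qed
  then have "(THE y. 0 < y \<and> g y = y) = y" using y \<open>0 < x0\<close> by (intro the_equality) auto
  then have gK: "g K = K" using K y by (simp add: g_def)
  show ?thesis
    unfolding g_def[symmetric, abs_def]
  proof
    show "continuous_on {0..} g" by (rule g_cont) simp
    show "x < g x" if "0 < x" "x < K" for x
      using above_left[of x] decreasing[of x K] gK that by (cases "x \<le> x0") auto
    show "0 \<le> g x" if "0 \<le> x" for x using f_nonneg[OF that] \<open>0 < \<mu>\<close> by (simp add: g_def)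
    show "x0 < g (g x0)" using g_g_x0 by (simp add: g_def)
  qed (fact g0 \<open>0 < x0\<close> \<open>x0 < K\<close> increasing decreasing gK | assumption)+
qed

text \<open>
Division by \<open>\<mu>\<close> leaves the Schwarzian derivative unchanged, and on the open interval the derivatives
within \<open>{\<alpha>..\<beta>}\<close>, within \<open>{0..}\<close> and on the line coincide. The equilibrium \<open>K\<close> is an interior point.
\<close>

lemma singer_map_of_condition_S:
  fixes f :: "real \<Rightarrow> real"
  assumes "0 < \<mu>" and U: "condition_U f x0" and g: "unimodal_map (\<lambda>x. f x / \<mu>) x0 K"
    and S: "condition_S f {\<alpha>..\<beta>}" and \<beta>: "\<beta> = f x0 / \<mu>" and \<alpha>: "\<alpha> = f \<beta> / \<mu>"
  defines "F \<equiv> (\<lambda>k. (deriv_on {\<alpha>..\<beta>} ^^ k) f)"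
  shows "singer_map (\<lambda>x. f x / \<mu>) x0 K (\<lambda>x. F 1 x / \<mu>) (\<lambda>x. F 2 x / \<mu>) (\<lambda>x. F 3 x / \<mu>)"
    and "deriv_on {0..} (\<lambda>x. f x / \<mu>) K = F 1 K / \<mu>"
    and "\<And>x. x \<in> {\<alpha><..<\<beta>} \<Longrightarrow> (f has_real_derivative F 1 x) (at x)"
    and "\<And>x. x \<in> {\<alpha><..<\<beta>} \<Longrightarrow> (F 1 has_real_derivative F 2 x) (at x)"
    and "F 1 K < 0"
proof -
  interpret G: unimodal_map "\<lambda>x. f x / \<mu>" x0 K by (rule g)
  have ab: "G.\<alpha> = \<alpha>" "G.\<beta> = \<beta>" by (simp_all add: G.\<alpha>_def G.\<beta>_def \<alpha> \<beta>)
  have F_diff: "F k differentiable_on {\<alpha>..\<beta>}" if "k < 3" for k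
    using S that unfolding condition_S_def F_def by blast
  have F_deriv: "(F k has_real_derivative F (Suc k) x) (at x)" if "k < 3" "x \<in> {\<alpha><..<\<beta>}" for k x
  proof -
    have "(F k has_real_derivative deriv_on {\<alpha>..\<beta>} (F k) x) (at x within {\<alpha>..\<beta>})"
      using F_diff[OF that(1)] that(2) by (intro has_real_derivative_deriv_on) (simp add: differentiable_on_def)
    then show ?thesis using that(2) by (simp add: F_def at_within_Icc_at)
  qed
  have F0: "F 0 = f" by (simp add: F_def)
  show d1: "\<And>x. x \<in> {\<alpha><..<\<beta>} \<Longrightarrow> (f has_real_derivative F 1 x) (at x)"
    using F_deriv[of 0] F0 by simp
  show d2: "\<And>x. x \<in> {\<alpha><..<\<beta>} \<Longrightarrow> (F 1 has_real_derivative F 2 x) (at x)"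
    using F_deriv[of 1] by (simp add: numeral_2_eq_2)
  have d3: "\<And>x. x \<in> {\<alpha><..<\<beta>} \<Longrightarrow> (F 2 has_real_derivative F 3 x) (at x)"
    using F_deriv[of 2] by (simp add: numeral_3_eq_3 numeral_2_eq_2)
  have pos: "0 < x" if "x \<in> {\<alpha><..<\<beta>}" for x using that G.order G.x0_pos by (simp add: ab)
  have F1: "F 1 x = deriv_on {0..} f x" if "x \<in> {\<alpha><..<\<beta>}" for x
    using deriv_on_eqI[OF has_field_derivative_at_within[OF d1[OF that]]] pos[OF that] by simp
  have F1_neg: "F 1 x < 0" if "x \<in> {\<alpha><..<\<beta>}" for x
  proof -
    have "is_peak f x0" using U unfolding condition_U_def by blast
    moreover have "x0 < x" using that G.order by (simp add: ab)
    ultimately show ?thesis unfolding F1[OF that] is_peak_def by blast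
  qed
  have K: "K \<in> {\<alpha><..<\<beta>}" using G.order by (simp add: ab)
  show "F 1 K < 0" by (rule F1_neg[OF K])
  have "((\<lambda>x. f x / \<mu>) has_real_derivative F 1 K / \<mu>) (at K within {0..})"
    by (rule DERIV_cdivide[OF has_field_derivative_at_within[OF d1[OF K]]])
  then show "deriv_on {0..} (\<lambda>x. f x / \<mu>) K = F 1 K / \<mu>"
    by (rule deriv_on_eqI) (use pos[OF K] in simp)
  show "singer_map (\<lambda>x. f x / \<mu>) x0 K (\<lambda>x. F 1 x / \<mu>) (\<lambda>x. F 2 x / \<mu>) (\<lambda>x. F 3 x / \<mu>)"
  proof (intro singer_map.intro g singer_map_axioms.intro, unfold ab)
    fix x assume x: "x \<in> {\<alpha><..<\<beta>}"
    show "((\<lambda>x. f x / \<mu>) has_real_derivative F 1 x / \<mu>) (at x)"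
      "((\<lambda>x. F 1 x / \<mu>) has_real_derivative F 2 x / \<mu>) (at x)"
      "((\<lambda>x. F 2 x / \<mu>) has_real_derivative F 3 x / \<mu>) (at x)"
      using d1 d2 d3 x by (auto intro: DERIV_cdivide)
    show "F 1 x / \<mu> < 0" using F1_neg[OF x] \<open>0 < \<mu>\<close> by (simp add: divide_neg_pos)
    have "schwarzian_on {\<alpha>..\<beta>} f x < 0"
    proof -
      have "x \<in> {\<alpha>..\<beta>}" "deriv_on {\<alpha>..\<beta>} f x \<noteq> 0" using x F1_neg[OF x] by (auto simp: F_def)
      then show ?thesis using S unfolding condition_S_def by blast
    qed
    then have "F 3 x / F 1 x - 3/2 * (F 2 x / F 1 x)\<^sup>2 < 0"
      by (simp add: schwarzian_on_def F_def)
    then show "(F 3 x / \<mu>) / (F 1 x / \<mu>) - 3/2 * ((F 2 x / \<mu>) / (F 1 x / \<mu>))\<^sup>2 < 0"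
      using \<open>0 < \<mu>\<close> by simp
  qed
qed

section \<open>Dichotomy\<close>

theorem theorem6:
  fixes \<mu> x0 K \<alpha> \<beta> :: real and f g :: "real \<Rightarrow> real"
  assumes "\<mu> > 0"
    and "f ` {0..} \<subseteq> {0..}" and "continuous_on {0..} f"
    and "condition_U f x0"
    and "g = (\<lambda>x. f x / \<mu>)"
    and "deriv_on {0..} g 0 > 1"
    and "K = (THE y. y > 0 \<and> g y = y)" and "K > x0"
    and "\<beta> = g x0" and "\<alpha> = g \<beta>"
    and "\<alpha> > x0"
    and "condition_S f {\<alpha>..\<beta>}"
  shows
    "(\<bar>deriv_on {0..} g K\<bar> \<le> 1 \<and>
        (\<forall>\<tau>>0. is_global_attractor \<mu> f \<tau> {restrict (\<lambda>s. K) {-\<tau>..0}}))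
     \<noteq>
     (\<bar>deriv_on {0..} g K\<bar> > 1 \<and>
        (\<exists>\<alpha>' \<beta>'. \<alpha>' < \<beta>' \<and>
           is_2cycle g {\<alpha>', \<beta>'} \<and> {\<alpha>', \<beta>'} \<subseteq> {\<alpha>..\<beta>} \<and>
           (\<forall>C. is_2cycle g C \<and> C \<subseteq> {\<alpha>..\<beta>} \<longrightarrow> C = {\<alpha>', \<beta>'}) \<and>
           sharpest_interval \<mu> f \<alpha>' \<beta>'))"
proof -
  note g = \<open>g = (\<lambda>x. f x / \<mu>)\<close>
  have \<alpha>\<beta>: "\<beta> = f x0 / \<mu>" "\<alpha> = f \<beta> / \<mu>" using assms(9,10) by (simp_all add: g)
  have f_nonneg: "\<And>x. 0 \<le> x \<Longrightarrow> 0 \<le> f x" using assms(2) by auto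
  have uni: "unimodal_map (\<lambda>x. f x / \<mu>) x0 K"
    by (rule unimodal_map_of_condition_U) (use assms in \<open>simp_all add: g\<close>)
  define F where "F k = (deriv_on {\<alpha>..\<beta>} ^^ k) f" for k
  note S = singer_map_of_condition_S[OF assms(1,4) uni assms(12) \<alpha>\<beta>, folded F_def]
  interpret G: singer_map "\<lambda>x. f x / \<mu>" x0 K "\<lambda>x. F 1 x / \<mu>" "\<lambda>x. F 2 x / \<mu>" "\<lambda>x. F 3 x / \<mu>"
    by (rule S(1))
  have ab: "G.\<alpha> = \<alpha>" "G.\<beta> = \<beta>" by (simp_all add: G.\<alpha>_def G.\<beta>_def \<alpha>\<beta>)
  have slope: "deriv_on {0..} g K = F 1 K / \<mu>" using S(2) by (simp add: g)
  have fK: "f K = \<mu> * K" using G.g_K assms(1) by (simp add: field_simps)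
  have core: "unimodal_delay_equation \<mu> \<tau> f x0 K a (f a / \<mu>)"
    if "0 < \<tau>" "\<alpha> \<le> a" "a \<le> K" "f (f a / \<mu>) / \<mu> = a"
      and "\<And>x. \<alpha> \<le> x \<Longrightarrow> x < a \<Longrightarrow> x < f (f x / \<mu>) / \<mu>" for \<tau> a
    by (intro unimodal_delay_equation.intro unimodal_delay_equation_axioms.intro delay_equation.intro uni, unfold ab)
       (use that assms(1,3) f_nonneg in auto)
  show ?thesis
  proof (cases "\<bar>deriv_on {0..} g K\<bar> \<le> 1")
    case True
    have "is_global_attractor \<mu> f \<tau> {restrict (\<lambda>s. K) {-\<tau>..0}}" if "0 < \<tau>" for \<tau>
    proof -
      have "unimodal_delay_equation \<mu> \<tau> f x0 K K (f K / \<mu>)"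
        using True G.order that G.g_K by (intro core G.stable_core) (simp_all add: slope ab)
      then show ?thesis by (rule unimodal_delay_equation.constant_attractor) simp
    qed
    then show ?thesis using True by auto
  next
    case False
    then have unstable: "1 < \<bar>F 1 K / \<mu>\<bar>" by (simp add: slope)
    show ?thesis
    proof (rule G.unstable_core[OF unstable, unfolded ab])
      fix a
      assume a: "\<alpha> \<le> a" "a < K" "f (f a / \<mu>) / \<mu> = a"
        "\<And>x. \<alpha> \<le> x \<Longrightarrow> x < a \<Longrightarrow> x < f (f x / \<mu>) / \<mu>"
        "\<And>x. a < x \<Longrightarrow> x < K \<Longrightarrow> f (f x / \<mu>) / \<mu> < x"
        "\<And>x. \<alpha> \<le> x \<Longrightarrow> x < K \<Longrightarrow> f (f x / \<mu>) / \<mu> = x \<Longrightarrow> x = a"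
      define b where "b = f a / \<mu>"
      have b: "K < b" "b \<le> \<beta>" unfolding b_def using G.h_mirror_fixpoint(1,2)[of a, unfolded G.h_def ab, OF a(1-3)] by simp_all
      have "sharpest_interval \<mu> f a b"
      proof (rule sharpest_core_interval)
        show "unimodal_delay_equation \<mu> \<tau> f x0 K a b" if "0 < \<tau>" for \<tau>
          unfolding b_def by (rule core[OF that a(1) less_imp_le[OF a(2)] a(3,4)])
        obtain R r where "0 < R" "0 < r" and R: "\<And>y. \<bar>y\<bar> \<le> r \<Longrightarrow> \<bar>f (K + y) - f K - F 1 K * y\<bar> \<le> R * y\<^sup>2"
          using quadratic_remainder[OF S(3) S(4)[of K], of \<alpha> \<beta>] G.order by (auto simp: ab)
        show "\<exists>\<tau>>0. \<not> contains_global_attractor \<mu> f \<tau> K K"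
        proof (rule unstable_equilibrium_not_attractor[where b = "- F 1 K"])
          show "\<mu> < - F 1 K" using False S(5) assms(1) by (simp add: slope abs_if field_simps split: if_splits)
          show "\<bar>f (K + y) - f K + - F 1 K * y\<bar> \<le> R * y\<^sup>2" if "\<bar>y\<bar> \<le> r" for y
            using R[OF that] by simp
        qed (use assms f_nonneg fK \<open>0 < R\<close> \<open>0 < r\<close> G.x0_pos G.x0_less_K in auto)
      qed (fact a(2), rule a(5))
      moreover have "is_2cycle g {a, b}"
        unfolding is_2cycle_def using a(2,3) b by (intro exI[of _ a] exI[of _ b]) (simp add: g b_def)
      moreover have "C = {a, b}" if "is_2cycle g C \<and> C \<subseteq> {\<alpha>..\<beta>}" for C
        using G.two_cycle_unique[of a C, unfolded ab, OF a(6)] that unfolding g b_def by blast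
      moreover have "a < b" using a(2) b(1) by linarith
      moreover have "{a, b} \<subseteq> {\<alpha>..\<beta>}" using a(1) b(2) \<open>a < b\<close> by simp
      ultimately have "\<exists>\<alpha>' \<beta>'. \<alpha>' < \<beta>' \<and> is_2cycle g {\<alpha>', \<beta>'} \<and> {\<alpha>', \<beta>'} \<subseteq> {\<alpha>..\<beta>} \<and>
           (\<forall>C. is_2cycle g C \<and> C \<subseteq> {\<alpha>..\<beta>} \<longrightarrow> C = {\<alpha>', \<beta>'}) \<and> sharpest_interval \<mu> f \<alpha>' \<beta>'"
        by blast
      then show ?thesis using False by simp
    qed
  qed
qed

end
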